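(* For a Banach lattice $X$, regarded as a norm closed sublattice of $(X^* )_n^\sim$ via the evaluation map, the following are equivalent: (i) $X\subset (X^* )_{uo}^\sim$; (ii) $X$ is order continuous; (iii) $X=(X^* )_{uo}^\sim$. In particular, a Banach lattice has at most one order continuous lattice isomorphic predual, up to lattice isomorphism; that is, if $X_1$ and $X_2$ are order continuous Banach lattices whose duals $X_1^*$ and $X_2^*$ are both lattice isomorphic to a Banach lattice $Y$, then $X_1$ and $X_2$ are lattice isomorphic.
   Context: A net $(x_\alpha)$ in a vector lattice $Z$ order converges to $x\in Z$ ($x_\alpha\xrightarrow{o}x$) if there is a net $(y_\gamma)$ in $Z$ (possibly with a different index set) with $y_\gamma\downarrow 0$ such that for every $\gamma$ there is $\alpha_0$ with $|x_\alpha-x|\le y_\gamma$ for all $\alpha\ge\alpha_0$. The net uo-converges to $x$ if $|x_\alpha-x|\wedge y\xrightarrow{o}0$ for every $y\in Z_+$; it is uo-null if it uo-converges to $0$. For a Banach lattice $Z$: $Z_n^\sim$ is the set of linear functionals $\phi$ on $Z$ with $\phi(x_\alpha)\to0$ whenever $x_\alpha\xrightarrow{o}0$; $Z_{uo}^\sim$ is the set of linear functionals $\phi$ on $Z$ with $\phi(x_\alpha)\to 0$ for every norm bounded uo-null net $(x_\alpha)$ in $Z$. A Banach lattice $Z$ is order continuous if $\|x_\alpha\|\to0$ for every net with $x_\alpha\xrightarrow{o}0$ in $Z$. The evaluation map is $j:X\to X^{**}$, $j(x)(\phi)=\phi(x)$; its image lies in $(X^* )_n^\sim$, and $X$ is identified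 with $j(X)$, so that (i) means $j(X)\subset (X^* )_{uo}^\sim$ and (iii) means $j(X)=(X^* )_{uo}^\sim$. Lattice isomorphisms between Banach lattices are bijective linear lattice homomorphisms (automatically norm isomorphisms, not necessarily isometric). *)

theory Defs
  imports "HOL-Analysis.Analysis" "HOL-Library.Lattice_Algebras"
begin

section \<open>Vector lattices and Banach lattices\<close>

class vector_lattice = ordered_real_vector + lattice_ab_group_add_abs

class banach_lattice = banach + vector_lattice +
  assumes norm_mono_abs: "\<bar>x\<bar> \<le> \<bar>y\<bar> \<Longrightarrow> norm x \<le> norm y"

definition lattice_isomorphism :: "('a::vector_lattice \<Rightarrow> 'b::vector_lattice) \<Rightarrow> bool" where
  "lattice_isomorphism T \<longleftrightarrow> linear T \<and> bij T \<and>
     (\<forall>x y. T (sup x y) = sup (T x) (T y)) \<and> (\<forall>x y. T (inf x y) = inf (T x) (T y))"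

section \<open>Nets\<close>

definition directed_set :: "'i set \<Rightarrow> ('i \<Rightarrow> 'i \<Rightarrow> bool) \<Rightarrow> bool" where
  "directed_set I le \<longleftrightarrow> I \<noteq> {} \<and> (\<forall>a\<in>I. le a a) \<and>
     (\<forall>a\<in>I. \<forall>b\<in>I. \<forall>c\<in>I. le a b \<longrightarrow> le b c \<longrightarrow> le a c) \<and>
     (\<forall>a\<in>I. \<forall>b\<in>I. \<exists>c\<in>I. le a c \<and> le b c)"

definition tails :: "'i set \<Rightarrow> ('i \<Rightarrow> 'i \<Rightarrow> bool) \<Rightarrow> 'i filter" where
  "tails I le = (INF a\<in>I. principal {b\<in>I. le a b})"

lemma eventually_tails:
  assumes "directed_set I le"
  shows "eventually P (tails I le) \<longleftrightarrow> (\<exists>a\<in>I. \<forall>b\<in>I. le a b \<longrightarrow> P b)"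
proof -
  have "eventually P (tails I le) \<longleftrightarrow> (\<exists>a\<in>I. eventually P (principal {b\<in>I. le a b}))"
    unfolding tails_def
  proof (rule eventually_INF_base)
    show "I \<noteq> {}" using assms by (simp add: directed_set_def)
  next
    fix a b assume ab: "a \<in> I" "b \<in> I"
    then obtain c where c: "c \<in> I" "le a c" "le b c"
      using assms unfolding directed_set_def by meson
    have "{d\<in>I. le c d} \<subseteq> {d\<in>I. le a d} \<inter> {d\<in>I. le b d}"
      using assms ab c unfolding directed_set_def by blast
    then show "\<exists>x\<in>I. principal {b \<in> I. le x b}
        \<le> inf (principal {b \<in> I. le a b}) (principal {d \<in> I. le b d})"
      using c(1) by (auto intro!: bexI[of _ c])
  qed
  then show ?thesis by (auto simp: eventually_principal)
qed

section \<open>Order convergence and unbounded order convergence\<close>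

definition decreases_to_zero :: "'i set \<Rightarrow> ('i \<Rightarrow> 'i \<Rightarrow> bool) \<Rightarrow> ('i \<Rightarrow> 'z::vector_lattice) \<Rightarrow> bool" where
  "decreases_to_zero I le y \<longleftrightarrow> (\<forall>a\<in>I. \<forall>b\<in>I. le a b \<longrightarrow> y b \<le> y a) \<and>
     (\<forall>a\<in>I. 0 \<le> y a) \<and> (\<forall>z. (\<forall>a\<in>I. z \<le> y a) \<longrightarrow> z \<le> 0)"

text \<open>A quantifier inside a definition cannot range over the index types of nets.
  The dominating net is therefore indexed by a set of elements of the space.
  By \<open>order_convergesI\<close> below, dominating nets with any other index type give nothing more,
  since \<open>y\<close> can be replaced by its range indexed by itself.\<close>

definition order_converges ::
    "'i set \<Rightarrow> ('i \<Rightarrow> 'i \<Rightarrow> bool) \<Rightarrow> ('i \<Rightarrow> 'z::vector_lattice) \<Rightarrow> 'z \<Rightarrow> bool" where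
  "order_converges I le x l \<longleftrightarrow>
     (\<exists>(J :: 'z set) le' (y :: 'z \<Rightarrow> 'z). directed_set J le' \<and> decreases_to_zero J le' y \<and>
        (\<forall>c\<in>J. \<exists>a\<in>I. \<forall>b\<in>I. le a b \<longrightarrow> \<bar>x b - l\<bar> \<le> y c))"

definition uo_converges ::
    "'i set \<Rightarrow> ('i \<Rightarrow> 'i \<Rightarrow> bool) \<Rightarrow> ('i \<Rightarrow> 'z::vector_lattice) \<Rightarrow> 'z \<Rightarrow> bool" where
  "uo_converges I le x l \<longleftrightarrow>
     (\<forall>y\<ge>0. order_converges I le (\<lambda>a. inf \<bar>x a - l\<bar> y) 0)"

lemma order_convergesI:
  fixes x :: "'i \<Rightarrow> 'z::vector_lattice" and y :: "'g \<Rightarrow> 'z"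
  assumes "directed_set J le'" "decreases_to_zero J le' y"
    and "\<And>c. c \<in> J \<Longrightarrow> \<exists>a\<in>I. \<forall>b\<in>I. le a b \<longrightarrow> \<bar>x b - l\<bar> \<le> y c"
  shows "order_converges I le x l"
  unfolding order_converges_def
proof (intro exI conjI)
  show "directed_set (y ` J) (\<lambda>a b. b \<le> a)"
    unfolding directed_set_def
  proof (intro conjI ballI impI)
    fix u v assume "u \<in> y ` J" "v \<in> y ` J"
    then obtain a b where ab: "a \<in> J" "u = y a" "b \<in> J" "v = y b" by blast
    then obtain c where "c \<in> J" "le' a c" "le' b c"
      using assms(1) unfolding directed_set_def by meson
    then show "\<exists>w\<in>y ` J. w \<le> u \<and> w \<le> v"
      using assms(2) ab unfolding decreases_to_zero_def by blast
  next
    show "y ` J \<noteq> {}" using assms(1) unfolding directed_set_def by simp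
  qed (assumption | rule order.refl | (rule order.trans, assumption, assumption))+
  show "decreases_to_zero (y ` J) (\<lambda>a b. b \<le> a) (\<lambda>v. v)"
    using assms(2) unfolding decreases_to_zero_def by auto
  show "\<forall>c\<in>y ` J. \<exists>a\<in>I. \<forall>b\<in>I. le a b \<longrightarrow> \<bar>x b - l\<bar> \<le> c"
    using assms(3) by auto
qed

section \<open>Order continuity and the functionals on norm bounded uo-null nets\<close>

text \<open>For the same reason the nets below are indexed by sets of subsets of the space. The lemmas
  \<open>order_continuousD\<close> and \<open>uo_dualD\<close> show that the conclusions then hold for nets with arbitrary
  index types.\<close>

definition order_continuous :: "'z::banach_lattice itself \<Rightarrow> bool" where
  "order_continuous (_ :: 'z itself) \<longleftrightarrow>
     (\<forall>(I :: 'z set set) le (x :: 'z set \<Rightarrow> 'z). directed_set I le \<longrightarrow> order_converges I le x 0 \<longrightarrow>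
        ((\<lambda>a. norm (x a)) \<longlongrightarrow> 0) (tails I le))"

definition uo_dual :: "('z::banach_lattice \<Rightarrow> real) set" where
  "uo_dual = {\<phi>. linear \<phi> \<and>
     (\<forall>(I :: 'z set set) le (x :: 'z set \<Rightarrow> 'z). directed_set I le \<longrightarrow>
        (\<exists>C. \<forall>a\<in>I. norm (x a) \<le> C) \<longrightarrow> uo_converges I le x 0 \<longrightarrow>
        ((\<lambda>a. \<phi> (x a)) \<longlongrightarrow> 0) (tails I le))}"

lemma subnet_by_sets:
  fixes x :: "'i \<Rightarrow> 'z"
  assumes dir: "directed_set I le" and nQ: "\<not> eventually (\<lambda>a. Q (x a)) (tails I le)"
  obtains K :: "'z set set" and z :: "'z set \<Rightarrow> 'z"
  where "directed_set K (\<lambda>A B. B \<subseteq> A)" "\<forall>A\<in>K. z A \<in> x ` I" "\<forall>A\<in>K. \<not> Q (z A)"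
    "\<forall>P. (\<exists>a\<in>I. \<forall>b\<in>I. le a b \<longrightarrow> P (x b)) \<longrightarrow> (\<exists>A\<in>K. \<forall>B\<in>K. B \<subseteq> A \<longrightarrow> P (z B))"
proof -
  define S where "S a = x ` {b\<in>I. le a b}" for a
  define z where "z A = (SOME v. v \<in> A \<and> \<not> Q v)" for A
  have z: "z A \<in> A \<and> \<not> Q (z A)" if A: "A \<in> S ` I" for A
  proof -
    obtain a where a: "a \<in> I" "A = S a" using A by blast
    then obtain b where "b \<in> I" "le a b" "\<not> Q (x b)"
      using nQ unfolding eventually_tails[OF dir] by blast
    then have "x b \<in> A \<and> \<not> Q (x b)" using a by (auto simp: S_def)
    then show ?thesis unfolding z_def by (rule someI)
  qed
  show thesis
  proof (rule that[of "S ` I" z])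
    have "\<exists>C\<in>S ` I. C \<subseteq> A \<and> C \<subseteq> B" if AB: "A \<in> S ` I" "B \<in> S ` I" for A B
    proof -
      obtain a b where ab: "a \<in> I" "A = S a" "b \<in> I" "B = S b" using AB by blast
      then obtain c where c: "c \<in> I" "le a c" "le b c"
        using dir unfolding directed_set_def by meson
      have "le a d \<and> le b d" if "d \<in> I" "le c d" for d
        using dir ab c that unfolding directed_set_def by blast
      then have "S c \<subseteq> A" "S c \<subseteq> B" using ab by (auto simp: S_def)
      then show ?thesis using c by blast
    qed
    moreover have "S ` I \<noteq> {}" using dir unfolding directed_set_def by simp
    ultimately show "directed_set (S ` I) (\<lambda>A B. B \<subseteq> A)"
      unfolding directed_set_def by (intro conjI ballI impI) (assumption | rule subset_refl | blast)+
    show "\<forall>A\<in>S ` I. z A \<in> x ` I"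
    proof
      fix A assume A: "A \<in> S ` I"
      then obtain a where "A = S a" by blast
      then show "z A \<in> x ` I" using z[OF A] unfolding S_def by blast
    qed
    show "\<forall>A\<in>S ` I. \<not> Q (z A)"
      using z by blast
    have "\<exists>A\<in>S ` I. \<forall>B\<in>S ` I. B \<subseteq> A \<longrightarrow> P (z B)"
      if P: "\<exists>a\<in>I. \<forall>b\<in>I. le a b \<longrightarrow> P (x b)" for P
    proof -
      obtain a where a: "a \<in> I" "\<And>b. b \<in> I \<Longrightarrow> le a b \<Longrightarrow> P (x b)" using P by blast
      have "P (z B)" if "B \<in> S ` I" "B \<subseteq> S a" for B
        using z[OF that(1)] that(2) a(2) by (auto simp: S_def)
      then show ?thesis using a(1) by blast
    qed
    then show "\<forall>P. (\<exists>a\<in>I. \<forall>b\<in>I. le a b \<longrightarrow> P (x b)) \<longrightarrow>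
        (\<exists>A\<in>S ` I. \<forall>B\<in>S ` I. B \<subseteq> A \<longrightarrow> P (z B))"
      by blast
  qed
qed

lemma order_converges_subnet:
  fixes f :: "'a \<Rightarrow> 'b::vector_lattice"
  assumes "order_converges I le (\<lambda>a. f (x a)) l"
    and "\<And>P. \<exists>a\<in>I. \<forall>b\<in>I. le a b \<longrightarrow> P (x b) \<Longrightarrow> \<exists>A\<in>K. \<forall>B\<in>K. le' A B \<longrightarrow> P (z B)"
  shows "order_converges K le' (\<lambda>A. f (z A)) l"
proof -
  obtain J :: "'b set" and le'' and y :: "'b \<Rightarrow> 'b" where y: "directed_set J le''" "decreases_to_zero J le'' y"
    "\<And>c. c \<in> J \<Longrightarrow> \<exists>a\<in>I. \<forall>b\<in>I. le a b \<longrightarrow> \<bar>f (x b) - l\<bar> \<le> y c"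
    using assms(1) unfolding order_converges_def by blast
  show ?thesis
    by (rule order_convergesI[OF y(1,2)]) (rule assms(2)[OF y(3)])
qed

lemma order_continuousD:
  fixes x :: "'i \<Rightarrow> 'z::banach_lattice"
  assumes oc: "order_continuous TYPE('z)"
    and dir: "directed_set I le" and x: "order_converges I le x 0"
  shows "((\<lambda>a. norm (x a)) \<longlongrightarrow> 0) (tails I le)"
proof (rule ccontr)
  assume "\<not> ?thesis"
  then obtain e where e: "e > 0" "\<not> eventually (\<lambda>a. dist (norm (x a)) 0 < e) (tails I le)"
    unfolding tendsto_iff by blast
  obtain K and z :: "'z set \<Rightarrow> 'z" where K: "directed_set K (\<lambda>A B. B \<subseteq> A)"
    "\<forall>A\<in>K. z A \<in> x ` I" "\<forall>A\<in>K. \<not> dist (norm (z A)) 0 < e"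
    "\<forall>P. (\<exists>a\<in>I. \<forall>b\<in>I. le a b \<longrightarrow> P (x b)) \<longrightarrow> (\<exists>A\<in>K. \<forall>B\<in>K. B \<subseteq> A \<longrightarrow> P (z B))"
    by (rule subnet_by_sets[OF dir, where Q = "\<lambda>v. dist (norm v) 0 < e", OF e(2)]) (rule that)
  have "order_converges K (\<lambda>A B. B \<subseteq> A) z 0"
    by (rule order_converges_subnet[where f = "\<lambda>v. v", OF x]) (use K(4) in blast)
  then have "((\<lambda>A. norm (z A)) \<longlongrightarrow> 0) (tails K (\<lambda>A B. B \<subseteq> A))"
    using oc K(1) unfolding order_continuous_def by blast
  then have "eventually (\<lambda>A. dist (norm (z A)) 0 < e) (tails K (\<lambda>A B. B \<subseteq> A))"
    using e(1) unfolding tendsto_iff by blast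
  then obtain A where A: "A \<in> K" "\<forall>B\<in>K. B \<subseteq> A \<longrightarrow> dist (norm (z B)) 0 < e"
    unfolding eventually_tails[OF K(1)] by (rule bexE)
  then have "dist (norm (z A)) 0 < e" by simp
  then show False using K(3) A(1) by simp
qed

lemma uo_dualD:
  fixes x :: "'i \<Rightarrow> 'z::banach_lattice"
  assumes \<phi>: "\<phi> \<in> uo_dual"
    and dir: "directed_set I le" and C: "\<And>a. a \<in> I \<Longrightarrow> norm (x a) \<le> C"
    and x: "uo_converges I le x 0"
  shows "((\<lambda>a. \<phi> (x a)) \<longlongrightarrow> 0) (tails I le)"
proof (rule ccontr)
  assume "\<not> ?thesis"
  then obtain e where e: "e > 0" "\<not> eventually (\<lambda>a. dist (\<phi> (x a)) 0 < e) (tails I le)"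
    unfolding tendsto_iff by blast
  obtain K and z :: "'z set \<Rightarrow> 'z" where K: "directed_set K (\<lambda>A B. B \<subseteq> A)" "\<forall>A\<in>K. z A \<in> x ` I"
    "\<forall>A\<in>K. \<not> dist (\<phi> (z A)) 0 < e"
    "\<forall>P. (\<exists>a\<in>I. \<forall>b\<in>I. le a b \<longrightarrow> P (x b)) \<longrightarrow> (\<exists>A\<in>K. \<forall>B\<in>K. B \<subseteq> A \<longrightarrow> P (z B))"
    by (rule subnet_by_sets[OF dir, where Q = "\<lambda>v. dist (\<phi> v) 0 < e", OF e(2)]) (rule that)
  have "uo_converges K (\<lambda>A B. B \<subseteq> A) z 0"
    unfolding uo_converges_def
  proof (intro allI impI)
    fix y :: 'z assume "0 \<le> y"
    then have "order_converges I le (\<lambda>a. inf \<bar>x a - 0\<bar> y) 0"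
      using x unfolding uo_converges_def by blast
    then show "order_converges K (\<lambda>A B. B \<subseteq> A) (\<lambda>A. inf \<bar>z A - 0\<bar> y) 0"
      by (rule order_converges_subnet[where f = "\<lambda>v. inf \<bar>v - 0\<bar> y"]) (use K(4) in blast)
  qed
  moreover have "\<exists>C. \<forall>A\<in>K. norm (z A) \<le> C" using K(2) C by (metis imageE)
  ultimately have "((\<lambda>A. \<phi> (z A)) \<longlongrightarrow> 0) (tails K (\<lambda>A B. B \<subseteq> A))"
    using \<phi> K(1) unfolding uo_dual_def by blast
  then have "eventually (\<lambda>A. dist (\<phi> (z A)) 0 < e) (tails K (\<lambda>A B. B \<subseteq> A))"
    using e(1) unfolding tendsto_iff by blast
  then obtain A where A: "A \<in> K" "\<forall>B\<in>K. B \<subseteq> A \<longrightarrow> dist (\<phi> (z B)) 0 < e"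
    unfolding eventually_tails[OF K(1)] by (rule bexE)
  then have "dist (\<phi> (z A)) 0 < e" by simp
  then show False using K(3) A(1) by simp
qed

section \<open>The dual Banach lattice\<close>

text \<open>A copy of the space of bounded linear functionals, because the order on functionals cannot
  be given as a class instance on \<^typ>\<open>'a \<Rightarrow>\<^sub>L 'b\<close>, where the codomain is arbitrary.\<close>

typedef (overloaded) 'a dual = "UNIV :: ('a::real_normed_vector \<Rightarrow>\<^sub>L real) set"
  morphisms blinfun_of_dual dual_of_blinfun
  by simp

setup_lifting type_definition_dual

lift_definition dual_apply :: "'a::real_normed_vector dual \<Rightarrow> 'a \<Rightarrow> real" is blinfun_apply .

lemma dual_eqI: "(\<And>x. dual_apply f x = dual_apply g x) \<Longrightarrow> f = g"
  by transfer (rule blinfun_eqI)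

lemma linear_dual_apply: "linear (dual_apply f)"
  by transfer (simp add: blinfun.bounded_linear_right bounded_linear.linear)

lemmas dual_apply_right = linear_add[OF linear_dual_apply] linear_diff[OF linear_dual_apply]
  linear_neg[OF linear_dual_apply] linear_0[OF linear_dual_apply] linear_scale[OF linear_dual_apply]

instantiation dual :: (real_normed_vector) real_normed_vector
begin

lift_definition norm_dual :: "'a dual \<Rightarrow> real" is norm .
lift_definition zero_dual :: "'a dual" is 0 .
lift_definition plus_dual :: "'a dual \<Rightarrow> 'a dual \<Rightarrow> 'a dual" is "(+)" .
lift_definition minus_dual :: "'a dual \<Rightarrow> 'a dual \<Rightarrow> 'a dual" is "(-)" .
lift_definition uminus_dual :: "'a dual \<Rightarrow> 'a dual" is uminus .
lift_definition scaleR_dual :: "real \<Rightarrow> 'a dual \<Rightarrow> 'a dual" is scaleR .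

definition dist_dual :: "'a dual \<Rightarrow> 'a dual \<Rightarrow> real" where
  "dist_dual f g = norm (f - g)"

definition uniformity_dual :: "('a dual \<times> 'a dual) filter" where
  "uniformity_dual = (INF e\<in>{0 <..}. principal {(x, y). dist x y < e})"

definition open_dual :: "'a dual set \<Rightarrow> bool" where
  "open_dual S = (\<forall>x\<in>S. \<forall>\<^sub>F (x', y) in uniformity. x' = x \<longrightarrow> y \<in> S)"

definition sgn_dual :: "'a dual \<Rightarrow> 'a dual" where
  "sgn_dual f = scaleR (inverse (norm f)) f"

instance
proof
  fix f g h :: "'a dual" and a b :: real
  show "f + g + h = f + (g + h)" "f + g = g + f" "0 + f = f" "- f + f = 0" "f - g = f + - g"
    by (transfer, simp)+
  show "a *\<^sub>R (f + g) = a *\<^sub>R f + a *\<^sub>R g" "(a + b) *\<^sub>R f = a *\<^sub>R f + b *\<^sub>R f"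
    "a *\<^sub>R b *\<^sub>R f = (a * b) *\<^sub>R f" "1 *\<^sub>R f = f"
    by (transfer, simp add: scaleR_add_left scaleR_add_right)+
  show "norm f = 0 \<longleftrightarrow> f = 0" "norm (a *\<^sub>R f) = \<bar>a\<bar> * norm f"
    by (transfer, simp)+
  show "norm (f + g) \<le> norm f + norm g"
    by transfer (rule norm_triangle_ineq)
  show "sgn f = inverse (norm f) *\<^sub>R f" "dist f g = norm (f - g)"
    by (rule sgn_dual_def dist_dual_def)+
  show "uniformity = (INF e\<in>{0 <..}. principal {(f :: 'a dual, g). dist f g < e})"
    by (rule uniformity_dual_def)
  show "open U \<longleftrightarrow> (\<forall>f\<in>U. \<forall>\<^sub>F (f', g) in uniformity. f' = f \<longrightarrow> g \<in> U)" for U :: "'a dual set"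
    by (rule open_dual_def)
qed

end

lemma dual_apply_left [simp]:
  "dual_apply (f + g) x = dual_apply f x + dual_apply g x"
  "dual_apply (f - g) x = dual_apply f x - dual_apply g x"
  "dual_apply (- f) x = - dual_apply f x"
  "dual_apply 0 x = 0"
  "dual_apply (c *\<^sub>R f) x = c * dual_apply f x"
  by (transfer, simp add: blinfun.bilinear_simps)+

lemma norm_dual_bound: "\<bar>dual_apply f x\<bar> \<le> norm f * norm x"
  by transfer (metis norm_blinfun real_norm_def)

lemma norm_dual_le:
  "0 \<le> C \<Longrightarrow> (\<And>x. \<bar>dual_apply f x\<bar> \<le> C * norm x) \<Longrightarrow> norm f \<le> C"
  by transfer (simp add: norm_blinfun_bound)

instance dual :: (real_normed_vector) banach
proof
  fix X :: "nat \<Rightarrow> 'a dual" assume X: "Cauchy X"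
  have d: "dist (blinfun_of_dual f) (blinfun_of_dual g) = dist f g" for f g :: "'a dual"
    unfolding dist_norm by transfer simp
  have "Cauchy (\<lambda>n. blinfun_of_dual (X n))"
    using X unfolding Cauchy_def d .
  then obtain L where L: "(\<lambda>n. blinfun_of_dual (X n)) \<longlonglongrightarrow> L"
    using Cauchy_convergent convergent_def by blast
  have "blinfun_of_dual (dual_of_blinfun L) = L"
    by (simp add: dual_of_blinfun_inverse)
  then have "X \<longlonglongrightarrow> dual_of_blinfun L"
    using L unfolding tendsto_iff by (metis (no_types, lifting) d eventually_mono)
  then show "convergent X" unfolding convergent_def by blast
qed

lemma pprt_diff: "(x :: 'a::banach_lattice) = pprt x - (- nprt x)"
  by (simp add: prts[symmetric])

lemma norm_mono_pos: "0 \<le> (x :: 'a::banach_lattice) \<Longrightarrow> x \<le> y \<Longrightarrow> norm x \<le> norm y"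
  by (rule norm_mono_abs) simp

lemma norm_abs: "norm \<bar>x :: 'a::banach_lattice\<bar> = norm x"
  by (rule order.antisym; rule norm_mono_abs) simp_all

lemma dual_mono_ext:
  fixes f g :: "'a::banach_lattice dual"
  assumes "\<And>x. 0 \<le> x \<Longrightarrow> dual_apply f x = dual_apply g x"
  shows "f = g"
proof (rule dual_eqI)
  fix x :: 'a
  have "dual_apply f (pprt x) = dual_apply g (pprt x)"
    "dual_apply f (- nprt x) = dual_apply g (- nprt x)"
    by (rule assms, simp)+
  then show "dual_apply f x = dual_apply g x"
    by (subst (1 2) pprt_diff) (simp only: dual_apply_right)
qed

lemma dual_extend_cone:
  fixes p :: "'a::banach_lattice \<Rightarrow> real"
  assumes add: "\<And>x y. 0 \<le> x \<Longrightarrow> 0 \<le> y \<Longrightarrow> p (x + y) = p x + p y"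
    and scale: "\<And>c x. 0 \<le> x \<Longrightarrow> 0 < c \<Longrightarrow> p (c *\<^sub>R x) = c * p x"
    and bound: "\<And>x. 0 \<le> x \<Longrightarrow> \<bar>p x\<bar> \<le> C * norm x"
  obtains f :: "'a dual" where "\<And>x. 0 \<le> x \<Longrightarrow> dual_apply f x = p x"
proof -
  define F where "F x = p (pprt x) - p (- nprt x)" for x
  have F: "F (u - v) = p u - p v" if "0 \<le> u" "0 \<le> v" for u v
  proof -
    define w where "w = u - v"
    have "pprt w + v = u + (- nprt w)"
      using pprt_diff[of w] unfolding w_def by (simp add: algebra_simps)
    then have "p (pprt w) + p v = p u + p (- nprt w)"
      using add[of "pprt w" v] add[of u "- nprt w"] that by simp
    then show ?thesis unfolding F_def w_def by simp
  qed
  have p0: "p 0 = 0" using add[of 0 0] by simp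
  have Fadd: "F (x + y) = F x + F y" for x y
  proof -
    have "x + y = (pprt x + pprt y) - (- nprt x + - nprt y)"
      using prts[of x] prts[of y] by (simp add: algebra_simps) (metis add.assoc add.left_commute)
    then have "F (x + y) = p (pprt x + pprt y) - p (- nprt x + - nprt y)"
      by (metis F add_nonneg_nonneg neg_0_le_iff_le nprt_le_zero zero_le_pprt)
    moreover have "p (pprt x + pprt y) = p (pprt x) + p (pprt y)" by (rule add) simp_all
    moreover have "p (- nprt x + - nprt y) = p (- nprt x) + p (- nprt y)" by (rule add) simp_all
    ultimately show ?thesis unfolding F_def by linarith
  qed
  have Fpos: "F (c *\<^sub>R x) = c * F x" if c: "0 < c" for c x
  proof -
    have "c *\<^sub>R x = c *\<^sub>R pprt x - c *\<^sub>R (- nprt x)"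
      using pprt_diff[of x] by (metis scaleR_diff_right)
    moreover have "0 \<le> c *\<^sub>R pprt x" "0 \<le> c *\<^sub>R (- nprt x)"
      using c by (intro scaleR_nonneg_nonneg; simp)+
    ultimately have "F (c *\<^sub>R x) = p (c *\<^sub>R pprt x) - p (c *\<^sub>R (- nprt x))" using F by metis
    also have "\<dots> = c * F x"
      using scale[of "pprt x" c] scale[of "- nprt x" c] c unfolding F_def
      by (simp add: algebra_simps)
    finally show ?thesis .
  qed
  have F0: "F 0 = 0" unfolding F_def by simp
  have Fneg: "F (- x) = - F x" for x using Fadd[of x "- x"] F0 by simp
  have Fscale: "F (c *\<^sub>R x) = c * F x" for c x
  proof -
    consider "c > 0" | "c = 0" | "- c > 0" by linarith
    then show ?thesis
    proof cases
      case 3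
      then show ?thesis using Fpos[OF 3, of x] Fneg[of "c *\<^sub>R x"] by simp
    qed (simp_all add: Fpos F0)
  qed
  have Fb: "\<bar>F x\<bar> \<le> norm x * (2 * \<bar>C\<bar>)" for x
  proof -
    have "norm (pprt x) \<le> norm \<bar>x\<bar>" "norm (- nprt x) \<le> norm \<bar>x\<bar>"
      by (rule norm_mono_pos, simp, simp add: abs_prts)+
    then have n: "norm (pprt x) \<le> norm x" "norm (- nprt x) \<le> norm x" by (simp_all add: norm_abs)
    have b: "\<bar>p v\<bar> \<le> \<bar>C\<bar> * norm x" if "0 \<le> v" "norm v \<le> norm x" for v
    proof -
      have "C * norm v \<le> \<bar>C\<bar> * norm x" by (rule mult_mono) (use that in simp_all)
      then show ?thesis using bound[OF that(1)] by simp
    qed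
    show ?thesis
      using b[OF _ n(1)] b[OF _ n(2)] unfolding F_def by (simp add: algebra_simps)
  qed
  have bl: "bounded_linear F"
    using bounded_linear_intro[of F "2 * \<bar>C\<bar>"] Fadd Fscale Fb by simp
  have "dual_apply (dual_of_blinfun (Blinfun F)) x = F x" for x
    using bl by (simp add: dual_apply.rep_eq dual_of_blinfun_inverse bounded_linear_Blinfun_apply)
  moreover have "F x = p x" if "0 \<le> x" for x
    using F[OF that order.refl] p0 by simp
  ultimately show thesis using that[of "dual_of_blinfun (Blinfun F)"] by simp
qed

lemma Riesz_decomposition:
  fixes x y z :: "'a::banach_lattice"
  assumes "0 \<le> x" "0 \<le> y" "0 \<le> z" "z \<le> x + y"
  obtains u v where "0 \<le> u" "u \<le> x" "0 \<le> v" "v \<le> y" "z = u + v"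
proof (rule that[of "inf z x" "z - inf z x"])
  have "z - y \<le> inf z x" using assms by (simp add: algebra_simps)
  then show "z - inf z x \<le> y" by (metis add.commute diff_le_eq)
  show "0 \<le> z - inf z x" by (simp only: diff_ge_0_iff_ge inf_le1)
  show "z = inf z x + (z - inf z x)" by (simp only: add_diff_cancel_left' add_diff_eq)
qed (use assms in auto)

text \<open>The positive part of a functional by the Riesz--Kantorovich formula.\<close>

lemma dual_positive_part:
  fixes f :: "'a::banach_lattice dual"
  obtains g :: "'a dual" where
    "\<And>x. 0 \<le> x \<Longrightarrow> dual_apply g x = Sup (dual_apply f ` {0..x})"
    "\<And>x. 0 \<le> x \<Longrightarrow> 0 \<le> dual_apply g x"
    "\<And>x. 0 \<le> x \<Longrightarrow> dual_apply f x \<le> dual_apply g x"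
    "\<And>h x. \<lbrakk>\<And>y. 0 \<le> y \<Longrightarrow> 0 \<le> dual_apply h y; \<And>y. 0 \<le> y \<Longrightarrow> dual_apply f y \<le> dual_apply h y;
        0 \<le> x\<rbrakk> \<Longrightarrow> dual_apply g x \<le> dual_apply h x"
proof -
  define p where "p x = Sup (dual_apply f ` {0..x})" for x
  have fb: "\<bar>dual_apply f y\<bar> \<le> norm f * norm x" if "0 \<le> y" "y \<le> x" for x y
    using norm_dual_bound[of f y] norm_mono_pos[OF that] 
    by (meson mult_left_mono norm_ge_zero order_trans)
  have bdd: "bdd_above (dual_apply f ` {0..x})" for x
    by (rule bdd_aboveI2[of _ _ "norm f * norm x"]) (use fb in \<open>fastforce simp: abs_le_iff\<close>)
  have up: "dual_apply f y \<le> p x" if "0 \<le> y" "y \<le> x" for x y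
    unfolding p_def by (rule cSUP_upper[OF _ bdd]) (use that in simp)
  have least: "p x \<le> B" if "0 \<le> x" "\<And>y. 0 \<le> y \<Longrightarrow> y \<le> x \<Longrightarrow> dual_apply f y \<le> B" for x B
    unfolding p_def by (rule cSUP_least) (use that in auto)
  have p_pos: "0 \<le> p x" if "0 \<le> x" for x
    using up[of 0 x] that by (simp add: dual_apply_right)
  have p_add: "p (x + y) = p x + p y" if xy: "0 \<le> x" "0 \<le> y" for x y
  proof (rule order.antisym)
    show "p (x + y) \<le> p x + p y"
    proof (rule least)
      fix z assume "0 \<le> z" "z \<le> x + y"
      then obtain u v where "0 \<le> u" "u \<le> x" "0 \<le> v" "v \<le> y" "z = u + v"
        using Riesz_decomposition[OF xy] by blast
      then show "dual_apply f z \<le> p x + p y"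
        using up[of u x] up[of v y] by (simp add: dual_apply_right)
    qed (use xy in simp)
    have "p x \<le> p (x + y) - p y"
    proof (rule least[OF xy(1)])
      fix u assume u: "0 \<le> u" "u \<le> x"
      have "p y \<le> p (x + y) - dual_apply f u"
      proof (rule least[OF xy(2)])
        fix v assume v: "0 \<le> v" "v \<le> y"
        show "dual_apply f v \<le> p (x + y) - dual_apply f u"
          using up[of "u + v" "x + y"] u v by (simp add: dual_apply_right add_mono)
      qed
      then show "dual_apply f u \<le> p (x + y) - p y" by simp
    qed
    then show "p x + p y \<le> p (x + y)" by simp
  qed
  have sc: "p (c *\<^sub>R x) \<le> c * p x" if "0 \<le> x" "0 < c" for c x
  proof (rule least)
    show "0 \<le> c *\<^sub>R x" using that by (simp add: scaleR_nonneg_nonneg)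
    fix y assume y: "0 \<le> y" "y \<le> c *\<^sub>R x"
    have "0 \<le> inverse c *\<^sub>R y" using y that by (simp add: scaleR_nonneg_nonneg)
    moreover have "inverse c *\<^sub>R y \<le> x"
      using scaleR_left_mono[OF y(2), of "inverse c"] that by simp
    ultimately have "dual_apply f (inverse c *\<^sub>R y) \<le> p x" by (rule up)
    then have "inverse c * dual_apply f y \<le> p x" by (simp add: dual_apply_right)
    then show "dual_apply f y \<le> c * p x" using that by (simp add: field_simps)
  qed
  have p_scale: "p (c *\<^sub>R x) = c * p x" if "0 \<le> x" "0 < c" for c x
  proof (rule order.antisym[OF sc[OF that]])
    have "p (inverse c *\<^sub>R (c *\<^sub>R x)) \<le> inverse c * p (c *\<^sub>R x)"
      by (rule sc) (use that in \<open>auto intro: scaleR_nonneg_nonneg\<close>)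
    then show "c * p x \<le> p (c *\<^sub>R x)" using that by (simp add: field_simps)
  qed
  have p_bound: "\<bar>p x\<bar> \<le> norm f * norm x" if "0 \<le> x" for x
    using p_pos[OF that] least[OF that, of "norm f * norm x"] fb[of _ x] by (simp add: abs_le_iff)
  obtain g :: "'a dual" where g: "\<And>x. 0 \<le> x \<Longrightarrow> dual_apply g x = p x"
    using dual_extend_cone[of p "norm f"] p_add p_scale p_bound by blast
  show thesis
  proof (rule that[of g])
    show "dual_apply g x = Sup (dual_apply f ` {0..x})" if "0 \<le> x" for x
      using g[OF that] by (simp add: p_def)
    show "0 \<le> dual_apply g x" if "0 \<le> x" for x using g p_pos that by simp
    show "dual_apply f x \<le> dual_apply g x" if "0 \<le> x" for x using g up that by simp
    fix h :: "'a dual" and x :: 'a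
    assume h: "\<And>y. 0 \<le> y \<Longrightarrow> 0 \<le> dual_apply h y"
      "\<And>y. 0 \<le> y \<Longrightarrow> dual_apply f y \<le> dual_apply h y" and x: "0 \<le> x"
    have "p x \<le> dual_apply h x"
    proof (rule least[OF x])
      fix y assume y: "0 \<le> y" "y \<le> x"
      show "dual_apply f y \<le> dual_apply h x"
        using h(2)[OF y(1)] h(1)[of "x - y"] y by (simp add: dual_apply_right)
    qed
    then show "dual_apply g x \<le> dual_apply h x" using g x by simp
  qed
qed

instantiation dual :: (banach_lattice) banach_lattice
begin

definition less_eq_dual :: "'a dual \<Rightarrow> 'a dual \<Rightarrow> bool" where
  "f \<le> g \<longleftrightarrow> (\<forall>x\<ge>0. dual_apply f x \<le> dual_apply g x)"

definition less_dual :: "'a dual \<Rightarrow> 'a dual \<Rightarrow> bool" where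
  "less_dual f g \<longleftrightarrow> f \<le> g \<and> \<not> g \<le> f"

definition sup_dual :: "'a dual \<Rightarrow> 'a dual \<Rightarrow> 'a dual" where
  "sup_dual f g = (THE h. f \<le> h \<and> g \<le> h \<and> (\<forall>k. f \<le> k \<longrightarrow> g \<le> k \<longrightarrow> h \<le> k))"

definition inf_dual :: "'a dual \<Rightarrow> 'a dual \<Rightarrow> 'a dual" where
  "inf_dual f g = - sup (- f) (- g)"

definition abs_dual :: "'a dual \<Rightarrow> 'a dual" where
  "abs_dual f = sup f (- f)"

instance
proof
  fix f g h :: "'a dual" and a b :: real
  have antisym: "f = g" if "f \<le> g" "g \<le> f" for f g :: "'a dual"
    using that dual_mono_ext[of f g] unfolding less_eq_dual_def by (simp add: order.antisym)
  have trans: "f \<le> h" if "f \<le> g" "g \<le> h" for f g h :: "'a dual"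
    using that unfolding less_eq_dual_def by (meson order_trans)
  have sup_ex: "\<exists>s. f \<le> s \<and> g \<le> s \<and> (\<forall>k. f \<le> k \<longrightarrow> g \<le> k \<longrightarrow> s \<le> k) \<and>
      (\<forall>x\<ge>0. dual_apply s x = dual_apply f x + Sup (dual_apply (g - f) ` {0..x}))" for f g :: "'a dual"
  proof -
    obtain q :: "'a dual" where q:
      "\<And>x. 0 \<le> x \<Longrightarrow> dual_apply q x = Sup (dual_apply (g - f) ` {0..x})"
      "\<And>x. 0 \<le> x \<Longrightarrow> 0 \<le> dual_apply q x"
      "\<And>x. 0 \<le> x \<Longrightarrow> dual_apply (g - f) x \<le> dual_apply q x"
      "\<And>h x. \<lbrakk>\<And>y. 0 \<le> y \<Longrightarrow> 0 \<le> dual_apply h y;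
        \<And>y. 0 \<le> y \<Longrightarrow> dual_apply (g - f) y \<le> dual_apply h y; 0 \<le> x\<rbrakk>
        \<Longrightarrow> dual_apply q x \<le> dual_apply h x"
      using dual_positive_part[of "g - f"] by blast
    have "f \<le> f + q" using q(2) unfolding less_eq_dual_def by simp
    moreover have "g \<le> f + q" using q(3) unfolding less_eq_dual_def by (simp add: algebra_simps)
    moreover have "f + q \<le> k" if "f \<le> k" "g \<le> k" for k
      using q(4)[of "k - f"] that unfolding less_eq_dual_def by (simp add: algebra_simps)
    ultimately show ?thesis using q(1) by (intro exI[of _ "f + q"]) simp
  qed
  have sup_eq: "sup f g = s"
    if "f \<le> s \<and> g \<le> s \<and> (\<forall>k. f \<le> k \<longrightarrow> g \<le> k \<longrightarrow> s \<le> k)" for f g s :: "'a dual"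
    unfolding sup_dual_def using that antisym by (intro the_equality) blast+
  have sup: "f \<le> sup f g" "g \<le> sup f g" "\<And>k. f \<le> k \<Longrightarrow> g \<le> k \<Longrightarrow> sup f g \<le> k"
    "\<And>x. 0 \<le> x \<Longrightarrow> dual_apply (sup f g) x = dual_apply f x + Sup (dual_apply (g - f) ` {0..x})"
    for f g :: "'a dual"
  proof -
    obtain s where s: "f \<le> s \<and> g \<le> s \<and> (\<forall>k. f \<le> k \<longrightarrow> g \<le> k \<longrightarrow> s \<le> k)"
      "\<forall>x\<ge>0. dual_apply s x = dual_apply f x + Sup (dual_apply (g - f) ` {0..x})"
      using sup_ex[of f g] by blast
    have "sup f g = s" using sup_eq[OF s(1)] .
    then show "f \<le> sup f g" "g \<le> sup f g" "\<And>k. f \<le> k \<Longrightarrow> g \<le> k \<Longrightarrow> sup f g \<le> k"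
      "\<And>x. 0 \<le> x \<Longrightarrow> dual_apply (sup f g) x = dual_apply f x + Sup (dual_apply (g - f) ` {0..x})"
      using s by blast+
  qed
  have neg: "- f \<le> g \<longleftrightarrow> - g \<le> f" "f \<le> - g \<longleftrightarrow> g \<le> - f" for f g :: "'a dual"
    unfolding less_eq_dual_def by (auto simp: minus_le_iff le_minus_iff)
  have negneg: "- f \<le> - g \<longleftrightarrow> g \<le> f" for f g :: "'a dual"
    unfolding less_eq_dual_def by auto
  show "f < g \<longleftrightarrow> f \<le> g \<and> \<not> g \<le> f" by (rule less_dual_def)
  show "f \<le> f" unfolding less_eq_dual_def by simp
  show "f \<le> g \<Longrightarrow> g \<le> h \<Longrightarrow> f \<le> h" by (rule trans)
  show "f \<le> g \<Longrightarrow> g \<le> f \<Longrightarrow> f = g" by (rule antisym)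
  show "f \<le> g \<Longrightarrow> h + f \<le> h + g" unfolding less_eq_dual_def by simp
  show "f \<le> g \<Longrightarrow> 0 \<le> a \<Longrightarrow> a *\<^sub>R f \<le> a *\<^sub>R g"
    unfolding less_eq_dual_def by (simp add: mult_left_mono)
  show "a \<le> b \<Longrightarrow> 0 \<le> f \<Longrightarrow> a *\<^sub>R f \<le> b *\<^sub>R f"
    unfolding less_eq_dual_def by (simp add: mult_right_mono)
  show "inf f g \<le> f" "inf f g \<le> g"
    unfolding inf_dual_def
    by (rule neg(1)[THEN iffD1, OF sup(1)], rule neg(1)[THEN iffD1, OF sup(2)])
  show "f \<le> inf g h" if "f \<le> g" "f \<le> h"
    unfolding inf_dual_def
    by (rule neg(2)[THEN iffD2], rule sup(3)) (use that in \<open>simp_all only: negneg\<close>)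
  show "f \<le> sup f g" "g \<le> sup f g" by (rule sup)+
  show "g \<le> f \<Longrightarrow> h \<le> f \<Longrightarrow> sup g h \<le> f" by (rule sup)
  show "\<bar>f\<bar> = sup f (- f)" by (rule abs_dual_def)
  have abs_bound: "\<bar>dual_apply f x\<bar> \<le> dual_apply \<bar>f\<bar> \<bar>x\<bar>" for f :: "'a dual" and x :: 'a
  proof -
    have le: "\<bar>dual_apply f y\<bar> \<le> dual_apply \<bar>f\<bar> y" if "0 \<le> y" for y
      using sup(1,2)[where f = f and g = "- f"] that unfolding less_eq_dual_def abs_dual_def
      by (auto simp: abs_le_iff)
    have "dual_apply f x = dual_apply f (pprt x) - dual_apply f (- nprt x)"
      using pprt_diff[of x] by (metis dual_apply_right(2))
    moreover have "dual_apply \<bar>f\<bar> \<bar>x\<bar> = dual_apply \<bar>f\<bar> (pprt x) + dual_apply \<bar>f\<bar> (- nprt x)"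
      by (simp add: abs_prts flip: dual_apply_right(1))
    ultimately show ?thesis using le[of "pprt x"] le[of "- nprt x"] by simp
  qed
  have abs_norm: "dual_apply \<bar>f\<bar> x \<le> norm f * norm x" if x: "0 \<le> x" for f :: "'a dual" and x :: 'a
  proof -
    have s: "\<bar>f\<bar> = sup (- f) f"
      unfolding abs_dual_def by (rule antisym; intro sup(3); rule sup)
    have "Sup (dual_apply (f - - f) ` {0..x}) \<le> norm f * norm x + dual_apply f x"
    proof (rule cSUP_least)
      fix y assume "y \<in> {0..x}"
      then have y: "0 \<le> y" "y \<le> x" by auto
      have "\<bar>y + y - x\<bar> \<le> x"
      proof (rule abs_leI)
        show "y + y - x \<le> x" using add_mono[OF y(2) y(2)] by (simp add: algebra_simps)
        have "x \<le> x + (y + y)" using y(1) by simp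
        then show "- (y + y - x) \<le> x" by (simp add: algebra_simps)
      qed
      then have "norm (y + y - x) \<le> norm x" using x by (intro norm_mono_abs) simp
      then have "norm f * norm (y + y - x) \<le> norm f * norm x" by (simp add: mult_left_mono)
      then have "dual_apply f (y + y - x) \<le> norm f * norm x"
        using norm_dual_bound[of f "y + y - x"] by (simp add: abs_le_iff)
      then show "dual_apply (f - - f) y \<le> norm f * norm x + dual_apply f x"
        by (simp add: dual_apply_right)
    qed (use x in simp)
    then show ?thesis unfolding s sup(4)[OF x] by simp
  qed
  show "norm f \<le> norm g" if fg: "\<bar>f\<bar> \<le> \<bar>g\<bar>"
  proof (rule norm_dual_le)
    fix x
    have "\<bar>dual_apply f x\<bar> \<le> dual_apply \<bar>f\<bar> \<bar>x\<bar>" by (rule abs_bound)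
    also have "\<dots> \<le> dual_apply \<bar>g\<bar> \<bar>x\<bar>" using fg unfolding less_eq_dual_def by simp
    also have "\<dots> \<le> norm g * norm \<bar>x\<bar>" by (rule abs_norm) simp
    finally show "\<bar>dual_apply f x\<bar> \<le> norm g * norm x" by (simp add: norm_abs)
  qed simp
qed

end

section \<open>The evaluation map into the bidual\<close>

definition evaluation :: "'a::real_normed_vector \<Rightarrow> 'a dual dual" where
  "evaluation x = dual_of_blinfun (Blinfun (\<lambda>f. dual_apply f x))"

lemma dual_apply_evaluation: "dual_apply (evaluation x) f = dual_apply f x"
proof -
  have "bounded_linear (\<lambda>f. dual_apply f x)"
    by (rule bounded_linear_intro[of _ "norm x"]) (use norm_dual_bound in auto)
  then show ?thesis
    by (simp add: evaluation_def dual_apply.rep_eq[of "dual_of_blinfun _"] dual_of_blinfun_inverse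
      bounded_linear_Blinfun_apply)
qed

end

theory Submission
  imports Defs
begin

text \<open>For positive \<open>F\<close> in \<open>(X\<^sup>*)\<^sub>u\<^sub>o\<^sup>\<sim>\<close> the positive part of the unit ball of \<open>X\<^sup>*\<close> is almost order bounded with respect
  to \<open>F\<close>: for every \<open>\<epsilon> > 0\<close> there is an \<open>h\<close> with \<open>F ((f - h)\<^sup>+) \<le> \<epsilon>\<close> for all \<open>f \<ge> 0\<close> in the ball, since
  otherwise a disjointification produces a norm bounded disjoint, hence uo-null, sequence on which
  \<open>F\<close> does not tend to zero. It follows that an upward directed set \<open>K\<close> of positive elements of \<open>X\<close> with
  \<open>K \<le> F\<close> converges in norm. For \<open>F = x \<in> X\<close> this is the order continuity of \<open>X\<close>.
  Conversely, in an order continuous \<open>X\<close> every \<open>F = x \<ge> 0\<close> has the almost order boundedness property,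
  which forces \<open>x\<close> into \<open>(X\<^sup>*)\<^sub>u\<^sub>o\<^sup>\<sim>\<close>. Finally every order continuous functional \<open>F > 0\<close> on the dual
  of an order continuous \<open>X\<close> dominates some \<open>y > 0\<close> in \<open>X\<close>, so that a positive \<open>F\<close> in \<open>(X\<^sup>*)\<^sub>u\<^sub>o\<^sup>\<sim>\<close> equals
  the norm limit of \<open>{k \<in> X. 0 \<le> k \<le> F}\<close>. As lattice isomorphisms of duals preserve \<open>(X\<^sup>*)\<^sub>u\<^sub>o\<^sup>\<sim>\<close>,
  an order continuous predual can be recovered from the dual.\<close>

section \<open>Vector lattices\<close>

text \<open>Disjoint sequences in the dual are uo-null for a reason special to duals: the dual is
  Dedekind complete, and its order is determined by the positive elements \<open>x\<close> of the
  space, each of which acts on it as an order continuous functional. Limits superior in the dual can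
  therefore be tested on one \<open>x\<close> at a time.

  In identifying a positive \<open>F\<close> in \<open>uo_dual\<close> with an element of the space,
  the obstacle is that \<open>F\<close> is not known to lie below any evaluation. The way around it
  is a Radon-Nikodym argument: some \<open>x\<close> is not disjoint from \<open>F\<close>, the
  density of \<open>inf F (evaluation x)\<close> with respect to \<open>x\<close> is at least a
  constant \<open>c > 0\<close> on a part of the dual, and this part cuts a nonzero component out of
  \<open>x\<close>. The cuts are Hahn decompositions and smallest carriers, available because all
  functionals involved are order continuous on Dedekind complete spaces.

  Members of \<open>uo_dual\<close> are only assumed linear. Boundedness is derived from their
  behaviour on rapidly decreasing sequences, and closure of \<open>uo_dual\<close> under positive
  parts reduces everything to positive functionals.\<close>

lemma pprt_scaleR:
  fixes x :: "'a::vector_lattice"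
  assumes "0 \<le> c"
  shows "pprt (c *\<^sub>R x) = c *\<^sub>R pprt x"
proof (cases "c = 0")
  case False
  then have c: "0 < c" using assms by simp
  show ?thesis
  proof (rule order.antisym)
    have "c *\<^sub>R x \<le> c *\<^sub>R pprt x"
      by (rule scaleR_left_mono) (use assms in \<open>simp_all add: pprt_def\<close>)
    then show "pprt (c *\<^sub>R x) \<le> c *\<^sub>R pprt x"
      using assms unfolding pprt_def[of "c *\<^sub>R x"] by (simp add: scaleR_nonneg_nonneg)
    have "x = inverse c *\<^sub>R (c *\<^sub>R x)" using c by simp
    also have "\<dots> \<le> inverse c *\<^sub>R pprt (c *\<^sub>R x)"
      by (rule scaleR_left_mono) (use c in \<open>simp_all add: pprt_def\<close>)
    finally have "pprt x \<le> inverse c *\<^sub>R pprt (c *\<^sub>R x)"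
      using c unfolding pprt_def[of x] by (simp add: scaleR_nonneg_nonneg)
    then have "c *\<^sub>R pprt x \<le> c *\<^sub>R (inverse c *\<^sub>R pprt (c *\<^sub>R x))"
      by (rule scaleR_left_mono) (use c in simp)
    then show "c *\<^sub>R pprt x \<le> pprt (c *\<^sub>R x)" using c by simp
  qed
qed simp

lemma le_pprt: "(x :: 'a::lattice_ab_group_add) \<le> pprt x"
  by (simp add: pprt_def)

lemma pprt_least: "(x :: 'a::lattice_ab_group_add) \<le> y \<Longrightarrow> 0 \<le> y \<Longrightarrow> pprt x \<le> y"
  by (simp add: pprt_def)

lemma pprt_le_abs: "pprt (x :: 'a::lattice_ab_group_add_abs) \<le> \<bar>x\<bar>"
  by (rule pprt_least) (simp_all add: abs_ge_self)

lemma inf_plus_pprt: "inf x y + pprt (x - y) = (x :: 'a::lattice_ab_group_add)"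
proof -
  have "pprt (x - y) = x + sup (- y) (- x)"
    unfolding pprt_def by (simp add: add_sup_distrib_left)
  also have "\<dots> = x - inf x y" using diff_inf_eq_sup[of x y x] by (metis inf_commute)
  finally have "pprt (x - y) = x - inf x y" .
  then show ?thesis by (simp only: add_diff_cancel_left' add_diff_eq)
qed

lemma pprt_minus_swap: "pprt x - pprt (- x) = (x :: 'a::lattice_ab_group_add)"
  using prts[of x] by (simp add: pprt_neg)

lemma inf_pprt_pprt_minus: "inf (pprt x) (pprt (- x)) = (0 :: 'a::lattice_ab_group_add)"
proof -
  have "inf (pprt x) (pprt (- x)) = pprt (- x) + inf x 0"
    using pprt_minus_swap[of x]
    by (metis add.commute add_inf_distrib_left add.right_neutral diff_add_cancel)
  also have "\<dots> = 0" using neg_inf_eq_sup[of x 0] unfolding pprt_def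
    by (metis left_minus minus_zero neg_inf_eq_sup)
  finally show ?thesis .
qed

text \<open>Distributing addition over infima turns \<open>inf a c + inf b c\<close> into the
  infimum of \<open>a + b\<close>, \<open>a + c\<close>, \<open>c + b\<close> and
  \<open>c + c\<close>, and each of these lies above \<open>inf (a + b) c\<close>.\<close>

lemma inf_add_le:
  fixes a b c :: "'a::lattice_ab_group_add"
  assumes "0 \<le> a" "0 \<le> b" "0 \<le> c"
  shows "inf (a + b) c \<le> inf a c + inf b c"
proof -
  have h: "c \<le> a + c" "c \<le> c + b" "c \<le> c + c" using assms by simp_all
  have "inf (a + b) c \<le> inf (inf (a + b) (a + c)) (inf (c + b) (c + c))"
    by (rule le_infI[OF le_infI[OF inf_le1 order.trans[OF inf_le2 h(1)]]
      le_infI[OF order.trans[OF inf_le2 h(2)] order.trans[OF inf_le2 h(3)]]])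
  also have "\<dots> = inf a c + inf b c"
    by (simp only: add_inf_distrib_left[symmetric] add_inf_distrib_right[symmetric])
  finally show ?thesis .
qed

lemma inf_sum_eq_0:
  fixes t :: "nat \<Rightarrow> 'a::lattice_ab_group_add"
  assumes "\<And>i. i < n \<Longrightarrow> 0 \<le> t i" "0 \<le> c" "\<And>i. i < n \<Longrightarrow> inf (t i) c = 0"
  shows "inf (\<Sum>i<n. t i) c = 0"
  using assms
proof (induction n)
  case 0
  then show ?case by (simp add: inf_absorb1)
next
  case (Suc n)
  have "0 \<le> (\<Sum>i<n. t i)" using Suc.prems by (intro sum_nonneg) auto
  then have "inf ((\<Sum>i<n. t i) + t n) c \<le> inf (\<Sum>i<n. t i) c + inf (t n) c"
    using Suc.prems by (intro inf_add_le) auto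
  also have "\<dots> = 0" using Suc by simp
  finally show ?case using Suc.prems \<open>0 \<le> (\<Sum>i<n. t i)\<close>
    by (intro order.antisym) (simp_all add: add_nonneg_nonneg)
qed

text \<open>Disjoint positive elements add up to their supremum, so a common upper bound of the
  terms bounds all partial sums. This yields the summability behind the uo-nullity of disjoint
  sequences.\<close>

lemma sum_disjoint_le:
  fixes t :: "nat \<Rightarrow> 'a::lattice_ab_group_add"
  assumes "\<And>i. 0 \<le> t i" "\<And>i. t i \<le> h" "\<And>i j. i < j \<Longrightarrow> inf (t i) (t j) = 0"
  shows "(\<Sum>i<n. t i) \<le> h"
proof (induction n)
  case 0
  then show ?case using order.trans[OF assms(1,2)] by simp
next
  case (Suc n)
  have "inf (\<Sum>i<n. t i) (t n) = 0" by (rule inf_sum_eq_0) (use assms in auto)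
  then have "(\<Sum>i<Suc n. t i) = sup (\<Sum>i<n. t i) (t n)"
    using add_eq_inf_sup[of "\<Sum>i<n. t i" "t n"] by simp
  then show ?case using Suc assms(2) by simp
qed

section \<open>Banach lattices\<close>

lemma norm_pprt_le: "norm (pprt x) \<le> norm (x :: 'a::banach_lattice)"
  using norm_mono_pos[OF zero_le_pprt pprt_le_abs, of x] by (simp add: norm_abs)

lemma le_if_norm_pprt_small:
  fixes x y :: "'a::banach_lattice"
  assumes "\<And>e. 0 < e \<Longrightarrow> norm (pprt (x - y)) \<le> e"
  shows "x \<le> y"
proof -
  have "norm (pprt (x - y)) \<le> 0" by (rule field_le_epsilon) (use assms in simp)
  then have "pprt (x - y) = 0" by simp
  then show ?thesis by (simp add: le_zero_iff_zero_pprt[symmetric])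
qed

text \<open>The positive cone is norm closed: \<open>pprt (l - y)\<close> is dominated by
  \<open>pprt (l - f i)\<close> as soon as \<open>f i \<le> y\<close>.\<close>

lemma tendsto_le_const:
  fixes f :: "'i \<Rightarrow> 'a::banach_lattice"
  assumes f: "(f \<longlongrightarrow> l) F" and ev: "eventually (\<lambda>i. f i \<le> y) F" and F: "F \<noteq> bot"
  shows "l \<le> y"
proof (rule le_if_norm_pprt_small)
  fix e :: real assume "0 < e"
  then have "eventually (\<lambda>i. norm (l - f i) < e) F"
    using f by (simp add: tendsto_iff dist_norm norm_minus_commute)
  then obtain i where i: "norm (l - f i) < e" "f i \<le> y"
    using eventually_happens'[OF F eventually_conj[OF _ ev]] by blast
  have "pprt (l - y) \<le> pprt (l - f i)" using i by simp
  then have "norm (pprt (l - y)) \<le> norm (pprt (l - f i))" by (intro norm_mono_pos) simp_all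
  then show "norm (pprt (l - y)) \<le> e" using norm_pprt_le[of "l - f i"] i by linarith
qed

lemma tendsto_ge_const:
  fixes f :: "'i \<Rightarrow> 'a::banach_lattice"
  assumes "(f \<longlongrightarrow> l) F" "eventually (\<lambda>i. y \<le> f i) F" "F \<noteq> bot"
  shows "y \<le> l"
  using tendsto_le_const[OF tendsto_minus[OF assms(1)], of "- y"] assms by simp

text \<open>Dividing by \<open>n\<close> bounds \<open>z\<close> by a null sequence, and the order
  is norm closed. No sign of \<open>z\<close> is assumed, so the lemma applies to arbitrary lower
  bounds.\<close>

lemma archimedean_le_0:
  fixes z w :: "'a::banach_lattice"
  assumes "\<And>n :: nat. real n *\<^sub>R z \<le> w"
  shows "z \<le> 0"
proof (rule tendsto_ge_const)
  show "(\<lambda>n. inverse (real (Suc n)) *\<^sub>R w) \<longlonglongrightarrow> 0"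
    using tendsto_scaleR[OF LIMSEQ_inverse_real_of_nat tendsto_const[of w]] by simp
  have "z \<le> inverse (real (Suc n)) *\<^sub>R w" for n
    using scaleR_left_mono[OF assms[of "Suc n"], of "inverse (real (Suc n))"] by simp
  then show "\<forall>\<^sub>F n in sequentially. z \<le> inverse (real (Suc n)) *\<^sub>R w" by simp
qed simp

lemma summable_scaleR_power:
  fixes f :: "nat \<Rightarrow> 'a::banach"
  assumes "\<And>n. norm (f n) \<le> C"
  shows "summable (\<lambda>n. (1/2)^n *\<^sub>R f n)"
proof (rule summable_comparison_test')
  show "summable (\<lambda>n. (1/2)^n * C :: real)" by (intro summable_mult2 summable_geometric) simp
  show "norm ((1/2)^n *\<^sub>R f n) \<le> (1/2)^n * C" for n
    using assms[of n] by (simp add: mult_left_mono)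
qed

lemma term_le_suminf:
  fixes f :: "nat \<Rightarrow> 'a::banach_lattice"
  assumes f: "summable f" and pos: "\<And>n. 0 \<le> f n"
  shows "f n \<le> suminf f"
proof (rule tendsto_ge_const[OF summable_LIMSEQ[OF f]])
  have "f n \<le> (\<Sum>i<m. f i)" if "n < m" for m
  proof -
    have "(\<Sum>i\<in>{n}. f i) \<le> (\<Sum>i<m. f i)"
      by (rule sum_mono2) (use that pos in auto)
    then show ?thesis by simp
  qed
  then show "\<forall>\<^sub>F m in sequentially. f n \<le> (\<Sum>i<m. f i)"
    by (auto simp: eventually_at_top_dense)
qed simp

section \<open>The Hahn--Banach theorem\<close>

definition sublinear :: "('a::real_vector \<Rightarrow> real) \<Rightarrow> bool" where
  "sublinear p \<longleftrightarrow> (\<forall>x y. p (x + y) \<le> p x + p y) \<and> (\<forall>c x. 0 < c \<longrightarrow> p (c *\<^sub>R x) = c * p x)"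

lemma sublinear_zero:
  assumes "sublinear p"
  shows "p 0 = 0"
proof -
  have "p ((2::real) *\<^sub>R 0) = 2 * p 0" using assms unfolding sublinear_def by (metis zero_less_numeral)
  then show ?thesis by simp
qed

lemma sublinear_minus: "sublinear p \<Longrightarrow> - p (- x) \<le> p x"
proof -
  assume p: "sublinear p"
  then have "p (x + - x) \<le> p x + p (- x)" unfolding sublinear_def by blast
  then show ?thesis using sublinear_zero[OF p] by simp
qed

text \<open>The largest sublinear functional below \<open>p\<close> with value at most
  \<open>- p v\<close> at \<open>- v\<close>. Every linear functional below it agrees with
  \<open>p\<close> at \<open>v\<close>.\<close>

definition lowered :: "('a::real_vector \<Rightarrow> real) \<Rightarrow> 'a \<Rightarrow> 'a \<Rightarrow> real" where
  "lowered p v x = (INF t\<in>{0..}. p (x + t *\<^sub>R v) - t * p v)"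

lemma lowered:
  assumes p: "sublinear p"
  shows "sublinear (lowered p v)" "lowered p v x \<le> p x" "lowered p v (- v) \<le> - p v"
proof -
  have add: "p (x + y) \<le> p x + p y" and scale: "0 < c \<Longrightarrow> p (c *\<^sub>R x) = c * p x" for x y c
    using p unfolding sublinear_def by blast+
  have scale0: "p (c *\<^sub>R x) = c * p x" if "0 \<le> c" for c x
    using scale[of c x] sublinear_zero[OF p] that by (cases "c = 0") simp_all
  have bdd: "bdd_below ((\<lambda>t. p (x + t *\<^sub>R v) - t * p v) ` {0..})" for x
  proof (rule bdd_belowI2)
    fix t :: real assume "t \<in> {0..}"
    then have "t * p v = p (t *\<^sub>R v)" by (simp add: scale0)
    also have "\<dots> \<le> p (x + t *\<^sub>R v) + p (- x)" using add[of "x + t *\<^sub>R v" "- x"] by simp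
    finally show "- p (- x) \<le> p (x + t *\<^sub>R v) - t * p v" by simp
  qed
  have le: "lowered p v x \<le> p (x + t *\<^sub>R v) - t * p v" if "0 \<le> t" for x t
    unfolding lowered_def by (rule cINF_lower[OF bdd]) (use that in simp)
  have ge: "B \<le> lowered p v x" if "\<And>t. 0 \<le> t \<Longrightarrow> B \<le> p (x + t *\<^sub>R v) - t * p v" for B x
    unfolding lowered_def by (rule cINF_greatest) (use that in auto)
  show "lowered p v x \<le> p x" using le[of 0 x] by simp
  show "lowered p v (- v) \<le> - p v" using le[of 1 "- v"] sublinear_zero[OF p] by simp
  have sub: "lowered p v (x + y) \<le> lowered p v x + lowered p v y" for x y
  proof -
    have "lowered p v (x + y) - (p (y + s *\<^sub>R v) - s * p v) \<le> p (x + t *\<^sub>R v) - t * p v"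
      if "0 \<le> t" "0 \<le> s" for t s
    proof -
      have "lowered p v (x + y) \<le> p ((x + t *\<^sub>R v) + (y + s *\<^sub>R v)) - (t + s) * p v"
        using le[of "t + s" "x + y"] that by (simp add: algebra_simps)
      also have "p ((x + t *\<^sub>R v) + (y + s *\<^sub>R v)) \<le> p (x + t *\<^sub>R v) + p (y + s *\<^sub>R v)" by (rule add)
      finally show ?thesis by (simp add: algebra_simps)
    qed
    then have "lowered p v (x + y) - (p (y + s *\<^sub>R v) - s * p v) \<le> lowered p v x" if "0 \<le> s" for s
      using that by (intro ge) blast
    then have "lowered p v (x + y) - lowered p v x \<le> lowered p v y"
      by (intro ge) (simp add: algebra_simps)
    then show ?thesis by simp
  qed
  have hom: "c * lowered p v x \<le> lowered p v (c *\<^sub>R x)" if c: "0 < c" for c x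
  proof (rule ge)
    fix t :: real assume "0 \<le> t"
    then have "lowered p v x \<le> p (x + (t / c) *\<^sub>R v) - (t / c) * p v"
      using c by (intro le) simp
    then have "c * lowered p v x \<le> c * p (x + (t / c) *\<^sub>R v) - t * p v"
      using c by (simp add: field_simps)
    also have "c * p (x + (t / c) *\<^sub>R v) = p (c *\<^sub>R x + t *\<^sub>R v)"
      using c by (simp add: scale[symmetric] scaleR_add_right)
    finally show "c * lowered p v x \<le> p (c *\<^sub>R x + t *\<^sub>R v) - t * p v" .
  qed
  have "lowered p v (c *\<^sub>R x) = c * lowered p v x" if c: "0 < c" for c x
  proof (rule order.antisym[OF _ hom[OF c]])
    show "lowered p v (c *\<^sub>R x) \<le> c * lowered p v x"
      using hom[of "inverse c" "c *\<^sub>R x"] c by (simp add: field_simps)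
  qed
  then show "sublinear (lowered p v)" using sub unfolding sublinear_def by blast
qed

text \<open>A minimal sublinear functional cannot be lowered in any direction, which makes it additive.\<close>

lemma Hahn_Banach_sublinear:
  assumes p: "sublinear p"
  obtains f where "linear f" "\<And>x. f x \<le> p x"
proof -
  define A where "A = {q. sublinear q \<and> (\<forall>x. q x \<le> p x)}"
  \<comment> \<open>The order is reversed: a maximal element for Zorn's lemma is a minimal sublinear
    functional.\<close>
  define r where "r = {(q, q'). q \<in> A \<and> q' \<in> A \<and> (\<forall>x. q' x \<le> q x)}"
  have r: "(q, q') \<in> r \<longleftrightarrow> q \<in> A \<and> q' \<in> A \<and> (\<forall>x. q' x \<le> q x)" for q q' by (simp add: r_def)
  have bound: "- p (- x) \<le> q x" if "q \<in> A" for q x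
  proof -
    have "- q (- x) \<le> q x" "q (- x) \<le> p (- x)"
      using that sublinear_minus[of q x] unfolding A_def by auto
    then show ?thesis by linarith
  qed
  have Field: "Field r = A" unfolding Field_def by (auto simp: r_def)
  have "Partial_order r"
    unfolding partial_order_on_def preorder_on_def Field
    by (auto simp: refl_on_def trans_def antisym_def r fun_eq_iff intro: order.trans order.antisym)
  moreover have "\<exists>u\<in>Field r. \<forall>q\<in>C. (q, u) \<in> r" if C: "C \<in> Chains r" for C
  proof (cases "C = {}")
    case True
    then show ?thesis using p unfolding Field A_def by auto
  next
    case False
    have CA: "C \<subseteq> A" using C unfolding Chains_def by (auto simp: r)
    define u where "u x = (INF q\<in>C. q x)" for x
    have bdd: "bdd_below ((\<lambda>q. q x) ` C)" for x
      by (rule bdd_belowI2[of _ "- p (- x)"]) (use CA bound in blast)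
    have le: "u x \<le> q x" if "q \<in> C" for q x
      unfolding u_def by (rule cINF_lower[OF bdd that])
    have ge: "B \<le> u x" if "\<And>q. q \<in> C \<Longrightarrow> B \<le> q x" for B x
      unfolding u_def by (rule cINF_greatest[OF False that])
    have total: "(\<forall>x. q x \<le> q' x) \<or> (\<forall>x. q' x \<le> q x)" if "q \<in> C" "q' \<in> C" for q q'
      using C that unfolding Chains_def by (auto simp: r)
    have "u (x + y) \<le> u x + u y" for x y
    proof -
      have "u (x + y) \<le> q x + q' y" if qq: "q \<in> C" "q' \<in> C" for q q'
      proof -
        \<comment> \<open>The smaller of \<open>q\<close> and \<open>q'\<close> serves both
          arguments. This is how the chain condition lets subadditivity survive the infimum.\<close>
        obtain q'' where q'': "q'' \<in> C" "q'' x \<le> q x" "q'' y \<le> q' y"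
          using total[OF qq] qq by blast
        have "u (x + y) \<le> q'' (x + y)" by (rule le[OF q''(1)])
        also have "\<dots> \<le> q'' x + q'' y"
          using q''(1) CA unfolding A_def sublinear_def by blast
        finally show ?thesis using q'' by linarith
      qed
      then have "u (x + y) - q' y \<le> u x" if "q' \<in> C" for q'
        using that by (intro ge) (simp add: algebra_simps)
      then have "u (x + y) - u x \<le> u y" by (intro ge) (simp add: algebra_simps)
      then show ?thesis by simp
    qed
    moreover have "u (c *\<^sub>R x) = c * u x" if c: "0 < c" for c x
    proof -
      have sc: "q (c *\<^sub>R x) = c * q x" if "q \<in> C" for q
        using that CA c unfolding A_def sublinear_def by blast
      have "u (c *\<^sub>R x) / c \<le> u x"
      proof (rule ge)
        fix q assume "q \<in> C"
        then show "u (c *\<^sub>R x) / c \<le> q x" using le[of q "c *\<^sub>R x"] sc c by (simp add: field_simps)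
      qed
      moreover have "c * u x \<le> u (c *\<^sub>R x)"
      proof (rule ge)
        fix q assume q: "q \<in> C"
        show "c * u x \<le> q (c *\<^sub>R x)" unfolding sc[OF q] using le[OF q, of x] c by simp
      qed
      ultimately show ?thesis using c by (simp add: field_simps)
    qed
    ultimately have "sublinear u" unfolding sublinear_def by blast
    moreover have "u x \<le> p x" for x
      using False le CA order.trans unfolding A_def by blast
    ultimately have "u \<in> A" unfolding A_def by blast
    then show ?thesis using le CA unfolding Field by (auto simp: r)
  qed
  ultimately obtain f where f: "f \<in> A" and min: "\<And>q. q \<in> A \<Longrightarrow> (\<forall>x. q x \<le> f x) \<Longrightarrow> q = f"
    using Zorns_po_lemma[of r] unfolding Field by (auto simp: r)
  have sf: "sublinear f" using f unfolding A_def by blast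
  have low: "lowered f v = f" for v
  proof (rule min)
    show "\<forall>x. lowered f v x \<le> f x" using lowered(2)[OF sf] by blast
    then show "lowered f v \<in> A"
      using f lowered(1)[OF sf] order.trans unfolding A_def by blast
  qed
  \<comment> \<open>Since lowering changes nothing, \<open>f (- v) \<le> - f v\<close>. Once
    \<open>f\<close> is odd, subadditivity at \<open>- x\<close> and \<open>- y\<close> gives the
    reverse inequality.\<close>
  have neg: "f (- v) = - f v" for v
    using lowered(3)[OF sf, of v] sublinear_minus[OF sf, of v] unfolding low by simp
  have fadd: "f (x + y) = f x + f y" for x y
  proof (rule order.antisym)
    show le: "f (x + y) \<le> f x + f y" for x y using sf unfolding sublinear_def by blast
    show "f x + f y \<le> f (x + y)" using le[of "- x" "- y"] neg[of "x + y"] by (simp add: neg)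
  qed
  have fs: "f (c *\<^sub>R x) = c * f x" if "0 < c" for c x using sf that unfolding sublinear_def by blast
  have "linear f"
  proof (rule linearI)
    fix c :: real and x
    consider "0 < c" | "c = 0" | "0 < - c" by linarith
    then show "f (c *\<^sub>R x) = c *\<^sub>R f x"
    proof cases
      case 3
      then show ?thesis using fs[of "- c" x] neg[of "c *\<^sub>R x"] by simp
    qed (use fs sublinear_zero[OF sf] in auto)
  qed (rule fadd)
  moreover have "f x \<le> p x" for x using f unfolding A_def by blast
  ultimately show thesis by (rule that)
qed

section \<open>Positive functionals\<close>

lemma dual_apply_mono: "0 \<le> f \<Longrightarrow> x \<le> y \<Longrightarrow> dual_apply f x \<le> dual_apply f y"
  for f :: "'a::banach_lattice dual"
  unfolding less_eq_dual_def by (metis diff_ge_0_iff_ge dual_apply_left(4) dual_apply_right(2))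

lemma dual_apply_nonneg: "0 \<le> f \<Longrightarrow> 0 \<le> x \<Longrightarrow> 0 \<le> dual_apply f x"
  for f :: "'a::banach_lattice dual"
  unfolding less_eq_dual_def by simp

lemma abs_dual_apply_le: "\<bar>dual_apply f x\<bar> \<le> dual_apply \<bar>f\<bar> \<bar>x\<bar>"
  for f :: "'a::banach_lattice dual"
proof -
  have le: "\<bar>dual_apply f y\<bar> \<le> dual_apply \<bar>f\<bar> y" if "0 \<le> y" for y
    using abs_ge_self[of f] abs_ge_minus_self[of f] that unfolding less_eq_dual_def
    by (auto simp: abs_le_iff)
  have "dual_apply f x = dual_apply f (pprt x) - dual_apply f (- nprt x)"
    using pprt_diff[of x] by (metis dual_apply_right(2))
  moreover have "dual_apply \<bar>f\<bar> ( \<bar>x\<bar> ) = dual_apply ( \<bar>f\<bar> ) (pprt x) + dual_apply ( \<bar>f\<bar> ) (- nprt x)"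
    unfolding abs_prts[of x] by (simp only: dual_apply_right diff_conv_add_uminus)
  ultimately show ?thesis using le[of "pprt x"] le[of "- nprt x"] by simp
qed

lemma norm_dual_le_pos:
  fixes f :: "'a::banach_lattice dual"
  assumes "0 \<le> f" "0 \<le> C" "\<And>x. 0 \<le> x \<Longrightarrow> norm x \<le> 1 \<Longrightarrow> dual_apply f x \<le> C"
  shows "norm f \<le> C"
proof (rule norm_dual_le[OF assms(2)])
  fix x
  show "\<bar>dual_apply f x\<bar> \<le> C * norm x"
  proof (cases "x = 0")
    case False
    then have n: "0 < norm x" by simp
    have "0 \<le> inverse (norm x) *\<^sub>R \<bar>x\<bar>" by (simp add: scaleR_nonneg_nonneg)
    then have "dual_apply f (inverse (norm x) *\<^sub>R \<bar>x\<bar>) \<le> C"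
      by (rule assms(3)) (use n in \<open>simp add: norm_abs\<close>)
    then have "dual_apply f \<bar>x\<bar> \<le> C * norm x"
      using n by (simp add: dual_apply_right field_simps)
    then show ?thesis using abs_dual_apply_le[of f x] assms(1) by simp
  qed (simp add: dual_apply_right)
qed

text \<open>Applying Hahn-Banach to \<open>lowered p x\<close> instead of \<open>p\<close> gives
  equality at \<open>x\<close> without an extension from the line through \<open>x\<close>.
  Positivity comes from \<open>f (- y) \<le> p (- y) \<le> 0\<close> for
  \<open>y \<ge> 0\<close>.\<close>

lemma supporting_positive_functional:
  fixes x :: "'a::banach_lattice"
  assumes p: "sublinear p" and neg: "\<And>y. y \<le> 0 \<Longrightarrow> p y \<le> 0" and bound: "\<And>y. p y \<le> C * norm y"
  obtains f :: "'a dual" where "0 \<le> f" "\<And>y. dual_apply f y \<le> p y" "dual_apply f x = p x"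
proof -
  obtain f where f: "linear f" "\<And>y. f y \<le> lowered p x y"
    using Hahn_Banach_sublinear[OF lowered(1)[OF p]] by blast
  have fp: "f y \<le> p y" for y using f(2) lowered(2)[OF p] order.trans by blast
  have fneg: "f (- y) = - f y" for y by (rule linear_neg[OF f(1)])
  have pos: "0 \<le> f y" if "0 \<le> y" for y
    using fp[of "- y"] neg[of "- y"] that by (simp add: fneg)
  have "\<bar>f y\<bar> \<le> norm y * C" for y
    using order.trans[OF fp[of y] bound] order.trans[OF fp[of "- y"] bound] fneg[of y]
    by (simp add: abs_le_iff mult.commute)
  then have "bounded_linear f"
    by (intro bounded_linear_intro[of f C]) (use f(1) in \<open>auto simp: linear_add linear_scale\<close>)
  then have g: "dual_apply (dual_of_blinfun (Blinfun f)) y = f y" for y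
    by (simp add: dual_apply.rep_eq dual_of_blinfun_inverse bounded_linear_Blinfun_apply)
  show thesis
  proof (rule that[of "dual_of_blinfun (Blinfun f)"])
    show "0 \<le> dual_of_blinfun (Blinfun f)" unfolding less_eq_dual_def using pos by (simp add: g)
    show "dual_apply (dual_of_blinfun (Blinfun f)) y \<le> p y" for y by (simp add: g fp)
    have "f (- x) \<le> - p x" using f(2)[of "- x"] lowered(3)[OF p, of x] by linarith
    then show "dual_apply (dual_of_blinfun (Blinfun f)) x = p x"
      using fp[of x] by (simp add: g fneg)
  qed
qed

lemma pprt_add_le: "pprt (y + z) \<le> pprt y + pprt (z :: 'a::lattice_ab_group_add)"
  by (rule pprt_least) (simp_all add: add_mono le_pprt)

text \<open>The sublinear functional is the norm of the positive part rather than the norm: it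
  vanishes on negative elements, which forces the supporting functional to be positive.\<close>

lemma norming_positive_functional:
  fixes x :: "'a::banach_lattice"
  obtains f :: "'a dual" where "0 \<le> f" "norm f \<le> 1" "dual_apply f x = norm (pprt x)"
proof -
  have p: "sublinear (\<lambda>y :: 'a. norm (pprt y))"
    unfolding sublinear_def
  proof (intro conjI allI impI)
    fix y z :: 'a
    have "norm (pprt (y + z)) \<le> norm (pprt y + pprt z)"
      by (rule norm_mono_pos[OF _ pprt_add_le]) simp
    then show "norm (pprt (y + z)) \<le> norm (pprt y) + norm (pprt z)"
      using norm_triangle_ineq order.trans by blast
  qed (simp add: pprt_scaleR)
  obtain f :: "'a dual" where f: "0 \<le> f" "\<And>y. dual_apply f y \<le> norm (pprt y)"
    "dual_apply f x = norm (pprt x)"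
    by (rule supporting_positive_functional[OF p, of 1 x]) (simp_all add: norm_pprt_le)
  have "norm f \<le> 1"
    by (rule norm_dual_le_pos[OF f(1)]) (use order.trans[OF f(2) norm_pprt_le] order.trans in \<open>simp, blast\<close>)
  then show thesis using that f by blast
qed

text \<open>The functional \<open>g\<close> imitates the restriction of \<open>f\<close> to the set
  where \<open>x\<close> is positive. It serves to split \<open>f\<close> when comparing two
  elements of the space.\<close>

lemma positive_part_functional:
  fixes f :: "'a::banach_lattice dual"
  assumes f: "0 \<le> f"
  obtains g where "0 \<le> g" "g \<le> f" "dual_apply g x = dual_apply f (pprt x)"
proof -
  have p: "sublinear (\<lambda>y. dual_apply f (pprt y))"
    unfolding sublinear_def
  proof (intro conjI allI impI)
    fix y z
    show "dual_apply f (pprt (y + z)) \<le> dual_apply f (pprt y) + dual_apply f (pprt z)"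
      using dual_apply_mono[OF f pprt_add_le] by (simp add: dual_apply_right)
  qed (simp add: pprt_scaleR dual_apply_right)
  have bound: "dual_apply f (pprt y) \<le> norm f * norm y" for y
  proof -
    have "dual_apply f (pprt y) \<le> norm f * norm (pprt y)" using norm_dual_bound[of f "pprt y"] by simp
    also have "\<dots> \<le> norm f * norm y" by (rule mult_left_mono[OF norm_pprt_le]) simp
    finally show ?thesis .
  qed
  obtain g where g: "0 \<le> g" "\<And>y. dual_apply g y \<le> dual_apply f (pprt y)"
    "dual_apply g x = dual_apply f (pprt x)"
    by (rule supporting_positive_functional[OF p _ bound, of x]) (simp_all add: dual_apply_right)
  have "g \<le> f" unfolding less_eq_dual_def using g(2) by (metis pprt_eq_id)
  then show thesis using that g by blast
qed

lemma le_if_dual_apply_le: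
  fixes x y :: "'a::banach_lattice"
  assumes "\<And>f. 0 \<le> f \<Longrightarrow> dual_apply f x \<le> dual_apply f y"
  shows "x \<le> y"
proof -
  obtain f :: "'a dual" where f: "0 \<le> f" "dual_apply f (x - y) = norm (pprt (x - y))"
    using norming_positive_functional[of "x - y"] by blast
  then have "norm (pprt (x - y)) \<le> 0" 
    using assms[OF f(1)] f(2) dual_apply_right(2)[of f x y] by linarith
  then show ?thesis by (simp add: le_zero_iff_zero_pprt[symmetric])
qed

lemma evaluation_le_iff: "evaluation x \<le> evaluation y \<longleftrightarrow> x \<le> y"
  for x y :: "'a::banach_lattice"
  using le_if_dual_apply_le[of x y] dual_apply_mono[of _ x y]
  unfolding less_eq_dual_def by (auto simp: dual_apply_evaluation)

lemma linear_evaluation: "linear evaluation"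
  by (rule linearI) (auto intro!: dual_eqI simp: dual_apply_evaluation dual_apply_right)

lemmas evaluation_simps = linear_add[OF linear_evaluation] linear_diff[OF linear_evaluation]
  linear_neg[OF linear_evaluation] linear_0[OF linear_evaluation] linear_scale[OF linear_evaluation]

lemma evaluation_nonneg: "0 \<le> evaluation x \<longleftrightarrow> 0 \<le> x" for x :: "'a::banach_lattice"
  using evaluation_le_iff[of 0 x] by (simp add: evaluation_simps)

section \<open>Lattice operations on functionals\<close>

text \<open>The Riesz-Kantorovich functional is positive and above \<open>f\<close>, hence above
  \<open>pprt f\<close>, and its value at \<open>e\<close> is a supremum over the order interval
  \<open>{0..e}\<close>.\<close>

lemma pprt_dual_least:
  fixes f :: "'a::banach_lattice dual"
  assumes "0 \<le> e" "\<And>u. 0 \<le> u \<Longrightarrow> u \<le> e \<Longrightarrow> dual_apply f u \<le> B"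
  shows "dual_apply (pprt f) e \<le> B"
proof -
  obtain g :: "'a dual" where g: "\<And>x. 0 \<le> x \<Longrightarrow> dual_apply g x = Sup (dual_apply f ` {0..x})"
    "\<And>x. 0 \<le> x \<Longrightarrow> 0 \<le> dual_apply g x" "\<And>x. 0 \<le> x \<Longrightarrow> dual_apply f x \<le> dual_apply g x"
    "\<And>h x. \<lbrakk>\<And>y. 0 \<le> y \<Longrightarrow> 0 \<le> dual_apply h y; \<And>y. 0 \<le> y \<Longrightarrow> dual_apply f y \<le> dual_apply h y;
        0 \<le> x\<rbrakk> \<Longrightarrow> dual_apply g x \<le> dual_apply h x"
    using dual_positive_part[of f] by blast
  have "pprt f \<le> g" by (rule pprt_least) (use g(2,3) in \<open>simp_all add: less_eq_dual_def\<close>)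
  then have "dual_apply (pprt f) e \<le> dual_apply g e"
    using assms(1) unfolding less_eq_dual_def by blast
  also have "\<dots> \<le> B"
    unfolding g(1)[OF assms(1)] by (rule cSUP_least) (use assms in auto)
  finally show ?thesis .
qed

lemma pprt_dual_approx:
  fixes f :: "'a::banach_lattice dual"
  assumes "0 \<le> e" "b < dual_apply (pprt f) e"
  obtains u where "0 \<le> u" "u \<le> e" "b < dual_apply f u"
  using pprt_dual_least[OF assms(1), of f b] assms(2) by force

text \<open>For disjoint \<open>f\<close> and \<open>g\<close> the positive part of
  \<open>f - g\<close> is \<open>f\<close> itself, so \<open>f e\<close> is a supremum of values
  \<open>f u - g u\<close>. A nearly optimal \<open>u\<close> carries almost all of \<open>f\<close>
  and almost nothing of \<open>g\<close>.\<close>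

lemma disjoint_dual_approx:
  fixes f g :: "'a::banach_lattice dual"
  assumes "inf f g = 0" "0 \<le> e" "0 < d"
  obtains u where "0 \<le> u" "u \<le> e" "dual_apply f (e - u) + dual_apply g u < d"
proof -
  have "pprt (f - g) = f" using inf_plus_pprt[of f g] assms(1) by simp
  then obtain u where u: "0 \<le> u" "u \<le> e" "dual_apply f e - d < dual_apply (f - g) u"
    using pprt_dual_approx[OF assms(2), of "dual_apply f e - d" "f - g"] assms(3) by auto
  show thesis by (rule that[OF u(1,2)]) (use u(3) in \<open>simp add: dual_apply_right\<close>)
qed

section \<open>Dedekind completeness and order continuous functionals\<close>

definition down_directed :: "'z::vector_lattice set \<Rightarrow> bool" where
  "down_directed D \<longleftrightarrow> D \<noteq> {} \<and> (\<forall>a\<in>D. \<forall>b\<in>D. \<exists>c\<in>D. c \<le> a \<and> c \<le> b)"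

definition is_glb :: "'z::vector_lattice set \<Rightarrow> 'z \<Rightarrow> bool" where
  "is_glb D m \<longleftrightarrow> (\<forall>d\<in>D. m \<le> d) \<and> (\<forall>l. (\<forall>d\<in>D. l \<le> d) \<longrightarrow> l \<le> m)"

text \<open>Directed sets suffice, as the finite infima of the elements of a set form a directed set
  with the same lower bounds.\<close>

definition dedekind_complete :: "'z::vector_lattice itself \<Rightarrow> bool" where
  "dedekind_complete (_ :: 'z itself) \<longleftrightarrow>
     (\<forall>(D :: 'z set) b. down_directed D \<longrightarrow> (\<forall>d\<in>D. b \<le> d) \<longrightarrow> (\<exists>m. is_glb D m))"

text \<open>Positivity is built in. It makes \<open>F m\<close> a lower bound of the values on
  \<open>D\<close>, so a single \<open>d\<close> with value below \<open>F m + e\<close> expresses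
  convergence along \<open>D\<close>.\<close>

definition order_cont :: "'z::banach_lattice dual \<Rightarrow> bool" where
  "order_cont F \<longleftrightarrow> 0 \<le> F \<and> (\<forall>D m. down_directed D \<longrightarrow> is_glb D m \<longrightarrow>
     (\<forall>e>0. \<exists>d\<in>D. dual_apply F d < dual_apply F m + e))"

lemma is_glb_unique: "is_glb D m \<Longrightarrow> is_glb D m' \<Longrightarrow> m = m'"
  unfolding is_glb_def by (blast intro: order.antisym)

lemma order_contD:
  "order_cont F \<Longrightarrow> down_directed D \<Longrightarrow> is_glb D m \<Longrightarrow> 0 < e \<Longrightarrow> \<exists>d\<in>D. dual_apply F d < dual_apply F m + e"
  unfolding order_cont_def by blast

lemma order_cont_dominated:
  fixes F G :: "'z::banach_lattice dual"
  assumes F: "order_cont F" and G: "0 \<le> G" "G \<le> F"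
  shows "order_cont G"
  unfolding order_cont_def
proof (intro conjI allI impI)
  fix D and m :: 'z and e :: real
  assume D: "down_directed D" "is_glb D m" "0 < e"
  then obtain d where d: "d \<in> D" "dual_apply F d < dual_apply F m + e"
    using order_contD[OF F] by blast
  then have "0 \<le> d - m" using D(2) unfolding is_glb_def by simp
  then have "dual_apply G (d - m) \<le> dual_apply F (d - m)" using G(2) unfolding less_eq_dual_def by blast
  then show "\<exists>d\<in>D. dual_apply G d < dual_apply G m + e"
    using d by (intro bexI[of _ d]) (simp_all add: dual_apply_right)
qed (rule G(1))

lemma order_cont_inf_le:
  assumes F: "order_cont F" and D: "down_directed D" "is_glb D m"
    and le: "\<And>d. d \<in> D \<Longrightarrow> c \<le> dual_apply F d"
  shows "c \<le> dual_apply F m"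
proof (rule field_le_epsilon)
  fix e :: real assume "0 < e"
  then obtain d where "d \<in> D" "dual_apply F d < dual_apply F m + e"
    using order_contD[OF F D] by blast
  then show "c \<le> dual_apply F m + e" using le by fastforce
qed

text \<open>Negation turns the directed supremum into a directed infimum. The third conclusion is
  order continuity in the form used for limits superior: bounds on functional values pass to the
  supremum.\<close>

lemma dedekind_complete_lub:
  fixes S :: "'z::banach_lattice set"
  assumes dc: "dedekind_complete TYPE('z)"
    and S: "S \<noteq> {}" "\<And>a b. a \<in> S \<Longrightarrow> b \<in> S \<Longrightarrow> \<exists>c\<in>S. a \<le> c \<and> b \<le> c" "\<And>a. a \<in> S \<Longrightarrow> a \<le> h"
  obtains m where "\<And>a. a \<in> S \<Longrightarrow> a \<le> m" "\<And>l. (\<And>a. a \<in> S \<Longrightarrow> a \<le> l) \<Longrightarrow> m \<le> l"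
    "\<And>F c. order_cont F \<Longrightarrow> (\<And>a. a \<in> S \<Longrightarrow> dual_apply F a \<le> c) \<Longrightarrow> dual_apply F m \<le> c"
proof -
  have D: "down_directed (uminus ` S)"
    unfolding down_directed_def
  proof (intro conjI ballI)
    fix a b assume "a \<in> uminus ` S" "b \<in> uminus ` S"
    then obtain a' b' where ab: "a' \<in> S" "b' \<in> S" "a = - a'" "b = - b'" by blast
    then obtain c where "c \<in> S" "a' \<le> c" "b' \<le> c" using S(2) by blast
    then show "\<exists>c\<in>uminus ` S. c \<le> a \<and> c \<le> b" using ab by auto
  qed (use S(1) in simp)
  have "\<forall>d\<in>uminus ` S. - h \<le> d" using S(3) by auto
  then obtain m where m: "is_glb (uminus ` S) m"
    using dc D unfolding dedekind_complete_def by blast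
  show thesis
  proof (rule that[of "- m"])
    show "a \<le> - m" if "a \<in> S" for a
      using m that unfolding is_glb_def by (metis imageI le_minus_iff)
    show "- m \<le> l" if l: "\<And>a. a \<in> S \<Longrightarrow> a \<le> l" for l
    proof -
      have "\<forall>d\<in>uminus ` S. - l \<le> d" using l by auto
      then have "- l \<le> m" using m unfolding is_glb_def by blast
      then show ?thesis by (simp add: minus_le_iff)
    qed
    show "dual_apply F (- m) \<le> c" if F: "order_cont F" and c: "\<And>a. a \<in> S \<Longrightarrow> dual_apply F a \<le> c" for F c
    proof -
      have "- c \<le> dual_apply F m"
        by (rule order_cont_inf_le[OF F D m]) (use c in \<open>auto simp: dual_apply_right\<close>)
      then show ?thesis by (simp add: dual_apply_right)
    qed
  qed
qed

text \<open>Directed infima in the dual are pointwise on the positive cone, because directedness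
  makes the pointwise infimum additive there. The second conclusion is the order continuity of
  positive evaluations.\<close>

lemma dual_glb:
  fixes D :: "'x::banach_lattice dual set"
  assumes D: "down_directed D" and b: "\<And>d. d \<in> D \<Longrightarrow> b \<le> d"
  obtains m where "is_glb D m" "\<And>x e. 0 \<le> x \<Longrightarrow> 0 < e \<Longrightarrow> \<exists>d\<in>D. dual_apply d x < dual_apply m x + e"
proof -
  obtain d0 where d0: "d0 \<in> D" using D unfolding down_directed_def by blast
  \<comment> \<open>Subtracting the lower bound \<open>b\<close> makes the values nonnegative; any
    single \<open>d0 - b\<close> then bounds \<open>p\<close>, as the extension from the cone
    requires.\<close>
  define p where "p x = (INF d\<in>D. dual_apply (d - b) x)" for x
  have pos: "0 \<le> dual_apply (d - b) x" if "d \<in> D" "0 \<le> x" for d x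
    by (rule dual_apply_nonneg) (use b[OF that(1)] that(2) in simp_all)
  have le: "p x \<le> dual_apply (d - b) x" if "d \<in> D" "0 \<le> x" for d x
    unfolding p_def by (rule cINF_lower[OF bdd_belowI2 that(1)]) (rule pos[OF _ that(2)])
  have ge: "B \<le> p x" if "\<And>d. d \<in> D \<Longrightarrow> B \<le> dual_apply (d - b) x" for B x
    unfolding p_def by (rule cINF_greatest) (use d0 that in auto)
  have p_pos: "0 \<le> p x" if "0 \<le> x" for x by (rule ge) (rule pos[OF _ that])
  have add: "p (x + y) = p x + p y" if xy: "0 \<le> x" "0 \<le> y" for x y
  proof (rule order.antisym)
    have "p (x + y) \<le> dual_apply (d - b) x + dual_apply (d' - b) y" if d: "d \<in> D" "d' \<in> D" for d d'
    proof -
      obtain c where c: "c \<in> D" "c \<le> d" "c \<le> d'"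
        using D d unfolding down_directed_def by blast
      have "p (x + y) \<le> dual_apply (c - b) x + dual_apply (c - b) y"
        using le[OF c(1), of "x + y"] xy by (simp only: dual_apply_right add_nonneg_nonneg)
      moreover have "dual_apply c x \<le> dual_apply d x" "dual_apply c y \<le> dual_apply d' y"
        using c(2,3) xy unfolding less_eq_dual_def by blast+
      ultimately show ?thesis by simp
    qed
    then have "p (x + y) - dual_apply (d' - b) y \<le> p x" if "d' \<in> D" for d'
      using that by (intro ge) (simp add: algebra_simps)
    then have "p (x + y) - p x \<le> p y" by (intro ge) (simp add: algebra_simps)
    then show "p (x + y) \<le> p x + p y" by simp
    show "p x + p y \<le> p (x + y)"
    proof (rule ge)
      fix d assume "d \<in> D"
      then show "p x + p y \<le> dual_apply (d - b) (x + y)"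
        unfolding dual_apply_right using le xy by (intro add_mono)
    qed
  qed
  have sc: "c * p x \<le> p (c *\<^sub>R x)" if "0 \<le> x" "0 < c" for c x
    by (rule ge) (use le[OF _ that(1)] that(2) in \<open>simp add: dual_apply_right flip: right_diff_distrib\<close>)
  have scale: "p (c *\<^sub>R x) = c * p x" if "0 \<le> x" "0 < c" for c x
  proof (rule order.antisym[OF _ sc[OF that]])
    have "0 \<le> c *\<^sub>R x" using that by (simp add: scaleR_nonneg_nonneg)
    then show "p (c *\<^sub>R x) \<le> c * p x" using sc[of "c *\<^sub>R x" "inverse c"] that by (simp add: field_simps)
  qed
  have bound: "\<bar>p x\<bar> \<le> norm (d0 - b) * norm x" if "0 \<le> x" for x
    using p_pos[OF that] le[OF d0 that] norm_dual_bound[of "d0 - b" x] by simp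
  obtain g :: "'x dual" where g: "\<And>x. 0 \<le> x \<Longrightarrow> dual_apply g x = p x"
    using dual_extend_cone[of p, OF add scale bound] by blast
  show thesis
  proof (rule that[of "b + g"])
    have "b + g \<le> d" if "d \<in> D" for d
      unfolding less_eq_dual_def using le[OF that] g by (auto simp: algebra_simps)
    moreover have "l \<le> b + g" if l: "\<forall>d\<in>D. l \<le> d" for l
      unfolding less_eq_dual_def
    proof (intro allI impI)
      fix x :: 'x assume x: "0 \<le> x"
      have "dual_apply (l - b) x \<le> p x"
        by (rule ge) (use l x in \<open>simp add: less_eq_dual_def\<close>)
      then show "dual_apply l x \<le> dual_apply (b + g) x" using g[OF x] by simp
    qed
    ultimately show "is_glb D (b + g)" unfolding is_glb_def by blast
    fix x :: 'x and e :: real assume x: "0 \<le> x" and e: "0 < e"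
    show "\<exists>d\<in>D. dual_apply d x < dual_apply (b + g) x + e"
    proof (rule ccontr)
      assume "\<not> ?thesis"
      then have "p x + e \<le> p x"
        using g[OF x] by (intro ge) (fastforce simp: not_less)
      then show False using e by simp
    qed
  qed
qed

lemma dedekind_complete_dual: "dedekind_complete TYPE('x::banach_lattice dual)"
  unfolding dedekind_complete_def using dual_glb by blast

lemma order_cont_evaluation:
  fixes x :: "'x::banach_lattice"
  assumes x: "0 \<le> x"
  shows "order_cont (evaluation x)"
  unfolding order_cont_def
proof (intro conjI allI impI)
  show "0 \<le> evaluation x" using x by (simp add: evaluation_nonneg)
  fix D and m :: "'x dual" and e :: real
  assume D: "down_directed D" "is_glb D m" and e: "0 < e"
  obtain m' where m': "is_glb D m'"
    "\<And>x e. 0 \<le> x \<Longrightarrow> 0 < e \<Longrightarrow> \<exists>d\<in>D. dual_apply d x < dual_apply m' x + e"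
    using dual_glb[OF D(1), of m] D(2) unfolding is_glb_def by blast
  show "\<exists>d\<in>D. dual_apply (evaluation x) d < dual_apply (evaluation x) m + e"
    unfolding dual_apply_evaluation is_glb_unique[OF D(2) m'(1)] by (rule m'(2)[OF x e])
qed

text \<open>The differences of elements of \<open>D\<close> and lower bounds of \<open>D\<close> form a net decreasing to zero.\<close>

lemma order_continuous_glb:
  fixes D :: "'x::banach_lattice set"
  assumes oc: "order_continuous TYPE('x)" and D: "down_directed D" and b: "\<And>d. d \<in> D \<Longrightarrow> b \<le> d"
  obtains m where "is_glb D m" "\<And>e. 0 < e \<Longrightarrow> \<exists>d\<in>D. norm (d - m) < e"
proof -
  define L where "L = {l. \<forall>d\<in>D. l \<le> d}"
  define le where "le = (\<lambda>(d, l) (d', l'). d' \<le> (d :: 'x) \<and> l \<le> (l' :: 'x))"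
  define y where "y = (\<lambda>(d, l). d - (l :: 'x))"
  have L: "l \<le> d" if "l \<in> L" "d \<in> D" for l d using that by (simp add: L_def)
  have dir: "directed_set (D \<times> L) le"
    unfolding directed_set_def
  proof (intro conjI ballI impI)
    show "D \<times> L \<noteq> {}" using D b unfolding down_directed_def L_def by blast
    fix p q assume "p \<in> D \<times> L" "q \<in> D \<times> L"
    then obtain d l d' l' where pq: "p = (d, l)" "q = (d', l')" "d \<in> D" "d' \<in> D" "l \<in> L" "l' \<in> L" by blast
    then obtain c where "c \<in> D" "c \<le> d" "c \<le> d'" using D unfolding down_directed_def by blast
    moreover have "sup l l' \<in> L" using pq unfolding L_def by simp
    ultimately show "\<exists>r\<in>D \<times> L. le p r \<and> le q r"
      unfolding pq le_def by (intro bexI[of _ "(c, sup l l')"]) auto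
  qed (auto simp: le_def)
  have dec: "decreases_to_zero (D \<times> L) le y"
    unfolding decreases_to_zero_def
  proof (intro conjI ballI allI impI)
    show "y q \<le> y p" if "le p q" for p q
      using that by (auto simp: le_def y_def diff_mono split: prod.splits)
    show "0 \<le> y p" if "p \<in> D \<times> L" for p using that L by (auto simp: y_def)
    fix z assume z: "\<forall>p\<in>D \<times> L. z \<le> y p"
    \<comment> \<open>A common lower bound \<open>z\<close> of all differences \<open>d - l\<close>
      can be added to any lower bound of \<open>D\<close>. Iterating from \<open>b\<close> keeps
      every \<open>b + n z\<close> below a fixed \<open>d\<close>, and the Archimedean property
      finishes.\<close>
    have step: "l + z \<in> L" if "l \<in> L" for l
      using z that unfolding L_def y_def by (fastforce simp: algebra_simps)
    have bL: "b + real n *\<^sub>R z \<in> L" for n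
    proof (induction n)
      case 0
      then show ?case using b by (simp add: L_def)
    next
      case (Suc n)
      then show ?case using step[OF Suc] by (simp add: algebra_simps)
    qed
    obtain d where d: "d \<in> D" using D unfolding down_directed_def by blast
    show "z \<le> 0"
    proof (rule archimedean_le_0)
      show "real n *\<^sub>R z \<le> d - b" for n using L[OF bL d, of n] by (simp add: algebra_simps)
    qed
  qed
  have "order_converges (D \<times> L) le y 0"
  proof (rule order_convergesI[OF dir dec])
    fix p assume p: "p \<in> D \<times> L"
    have "\<bar>y q - 0\<bar> \<le> y p" if "q \<in> D \<times> L" "le p q" for q
    proof -
      have "0 \<le> y q" "y q \<le> y p" using dec p that unfolding decreases_to_zero_def by blast+
      then show ?thesis by simp
    qed
    then show "\<exists>a\<in>D \<times> L. \<forall>q\<in>D \<times> L. le a q \<longrightarrow> \<bar>y q - 0\<bar> \<le> y p" using p by blast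
  qed
  then have lim: "((\<lambda>p. norm (y p)) \<longlongrightarrow> 0) (tails (D \<times> L) le)" by (rule order_continuousD[OF oc dir])
  have small: "\<exists>d\<in>D. \<exists>l\<in>L. norm (d - l) < e" if "0 < e" for e
  proof -
    have "eventually (\<lambda>p. norm (y p) < e) (tails (D \<times> L) le)"
      using lim that by (auto simp: tendsto_iff)
    then obtain p where "p \<in> D \<times> L" "norm (y p) < e"
      unfolding eventually_tails[OF dir] using dir unfolding directed_set_def by blast
    then show ?thesis by (auto simp: y_def)
  qed
  then have "\<forall>n. \<exists>d l. d \<in> D \<and> l \<in> L \<and> norm (d - l) < inverse (real (Suc n))"
    by (meson inverse_positive_iff_positive of_nat_0_less_iff zero_less_Suc)
  then obtain d l where dl: "\<And>n. d n \<in> D" "\<And>n. l n \<in> L" "\<And>n. norm (d n - l n) < inverse (real (Suc n))"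
    by metis
  have d0: "(\<lambda>n. d n - l n) \<longlonglongrightarrow> 0"
    by (rule Lim_null_comparison[OF _ LIMSEQ_inverse_real_of_nat])
       (use dl(3) in \<open>auto intro!: always_eventually less_imp_le\<close>)
  \<comment> \<open>The sequences \<open>d\<close> and \<open>l\<close> need not be monotone. As
    every \<open>l m\<close> lies below every \<open>d n\<close>, the distance of \<open>l m\<close>
    and \<open>l n\<close> is controlled by the two gaps \<open>d m - l m\<close> and
    \<open>d n - l n\<close>.\<close>
  have "Cauchy l"
  proof (rule metric_CauchyI)
    fix e :: real assume "0 < e"
    then obtain N where N: "\<And>n. n \<ge> N \<Longrightarrow> norm (d n - l n) < e / 2"
      using d0 unfolding LIMSEQ_iff by (metis diff_zero half_gt_zero)
    have "dist (l m) (l n) < e" if mn: "m \<ge> N" "n \<ge> N" for m n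
    proof -
      have "\<bar>l m - l n\<bar> \<le> (d m - l m) + (d n - l n)"
      proof (rule abs_leI)
        have "l m \<le> d n" "l m \<le> d m" "l n \<le> d m" "l n \<le> d n" using L dl(1,2) by blast+
        then have *: "0 \<le> d m - l m" "0 \<le> d n - l n" "l m - l n \<le> d n - l n" "l n - l m \<le> d m - l m"
          by simp_all
        show "l m - l n \<le> (d m - l m) + (d n - l n)" by (rule order.trans[OF *(3)]) (use * in simp)
        show "- (l m - l n) \<le> (d m - l m) + (d n - l n)"
          using order.trans[OF *(4), of "(d m - l m) + (d n - l n)"] *(2) by simp
      qed
      then have "norm (l m - l n) \<le> norm ((d m - l m) + (d n - l n))"
        by (intro norm_mono_abs) (metis abs_ge_self order.trans)
      also have "\<dots> \<le> norm (d m - l m) + norm (d n - l n)" by (rule norm_triangle_ineq)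
      finally show ?thesis using N[OF mn(1)] N[OF mn(2)] by (simp add: dist_norm)
    qed
    then show "\<exists>N. \<forall>m\<ge>N. \<forall>n\<ge>N. dist (l m) (l n) < e" by blast
  qed
  then obtain m where m: "l \<longlonglongrightarrow> m" using Cauchy_convergent convergent_def by blast
  have dm: "d \<longlonglongrightarrow> m" using tendsto_add[OF m d0] by simp
  have lower: "m \<le> d'" if "d' \<in> D" for d'
    by (rule tendsto_le_const[OF m]) (use L dl(2) that in simp_all)
  show thesis
  proof (rule that[of m])
    have "l' \<le> m" if "\<forall>d\<in>D. l' \<le> d" for l'
      by (rule tendsto_ge_const[OF dm]) (use that dl(1) in simp_all)
    then show "is_glb D m" unfolding is_glb_def using lower by blast
    fix e :: real assume "0 < e"
    then obtain n where "norm (d n - m) < e" using dm unfolding LIMSEQ_iff by blast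
    then show "\<exists>d\<in>D. norm (d - m) < e" using dl(1) by blast
  qed
qed

lemma order_continuous_dedekind_complete:
  "order_continuous TYPE('x::banach_lattice) \<Longrightarrow> dedekind_complete TYPE('x)"
  unfolding dedekind_complete_def using order_continuous_glb by blast

lemma order_continuous_glb_norm:
  fixes D :: "'x::banach_lattice set"
  assumes "order_continuous TYPE('x)" "down_directed D" "is_glb D m" "0 < e"
  shows "\<exists>d\<in>D. norm (d - m) < e"
proof -
  obtain m' where "is_glb D m'" "\<And>e. 0 < e \<Longrightarrow> \<exists>d\<in>D. norm (d - m') < e"
    using order_continuous_glb[OF assms(1,2), of m] assms(3) unfolding is_glb_def by blast
  then show ?thesis using is_glb_unique[OF assms(3)] assms(4) by blast
qed

lemma order_continuous_order_cont:
  fixes f :: "'x::banach_lattice dual"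
  assumes oc: "order_continuous TYPE('x)" and f: "0 \<le> f"
  shows "order_cont f"
  unfolding order_cont_def
proof (intro conjI allI impI)
  fix D and m :: 'x and e :: real
  assume D: "down_directed D" "is_glb D m" and e: "0 < e"
  have k: "0 < norm f + 1" by (simp add: add_nonneg_pos)
  then obtain d where d: "d \<in> D" "norm (d - m) < e / (norm f + 1)"
    using order_continuous_glb_norm[OF oc D] e by (meson divide_pos_pos)
  have "dual_apply f (d - m) \<le> norm f * norm (d - m)" using norm_dual_bound[of f "d - m"] by simp
  also have "\<dots> \<le> (norm f + 1) * norm (d - m)" by (rule mult_right_mono) simp_all
  also have "\<dots> < e" using d(2) k by (simp add: field_simps)
  finally show "\<exists>d\<in>D. dual_apply f d < dual_apply f m + e"
    using d(1) by (intro bexI[of _ d]) (simp_all add: dual_apply_right)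
qed (rule f)

section \<open>Limits superior and Hahn decompositions\<close>

fun partial_sup :: "(nat \<Rightarrow> 'z::lattice) \<Rightarrow> nat \<Rightarrow> nat \<Rightarrow> 'z" where
  "partial_sup u n 0 = u n"
| "partial_sup u n (Suc m) = sup (partial_sup u n m) (u (n + Suc m))"

lemma partial_sup_upper: "k \<le> m \<Longrightarrow> u (n + k) \<le> partial_sup u n m"
proof (induction m)
  case (Suc m)
  then show ?case by (cases "k = Suc m") (auto intro: le_supI1)
qed simp

lemma partial_sup_least: "(\<And>k. n \<le> k \<Longrightarrow> u k \<le> b) \<Longrightarrow> partial_sup u n m \<le> b"
  by (induction m) auto

lemma partial_sup_mono: "m \<le> m' \<Longrightarrow> partial_sup u n m \<le> partial_sup u n m'"
  by (rule lift_Suc_mono_le[of "partial_sup u n"]) simp_all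

lemma partial_sup_dual_le:
  fixes F :: "'z::banach_lattice dual"
  assumes F: "0 \<le> F" and u: "\<And>k. 0 \<le> u k"
  shows "dual_apply F (partial_sup u n m) \<le> (\<Sum>k\<le>m. dual_apply F (u (k + n)))"
proof (induction m)
  case (Suc m)
  have "0 \<le> partial_sup u n m" for m using partial_sup_upper[of 0 m u n] u[of n] by simp
  then have "partial_sup u n (Suc m) \<le> partial_sup u n m + u (n + Suc m)"
    using u by simp
  then have "dual_apply F (partial_sup u n (Suc m)) \<le> dual_apply F (partial_sup u n m) + dual_apply F (u (n + Suc m))"
    unfolding dual_apply_right(1)[symmetric] by (rule dual_apply_mono[OF F])
  then show ?case using Suc by (simp add: add.commute)
qed simp

lemma suminf_shift_less:
  fixes r :: "nat \<Rightarrow> real"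
  assumes "summable r" "0 < e"
  obtains n where "(\<Sum>k. r (k + n)) < e"
proof -
  obtain n where "norm (\<Sum>k. r (k + n)) < e" using suminf_exist_split[OF assms(2,1)] by blast
  then show thesis using that[of n] by simp
qed

text \<open>Here \<open>s n\<close> is the supremum of the tail from \<open>n\<close> on and
  \<open>v\<close> is the limit superior. The last conclusion holds because a finite supremum of
  positive elements is at most their sum. The tail suprema are exported, since they later serve as
  dominating sequences.\<close>

lemma limsup_sequence:
  fixes u :: "nat \<Rightarrow> 'z::banach_lattice"
  assumes dc: "dedekind_complete TYPE('z)" and u: "\<And>k. 0 \<le> u k" "\<And>k. u k \<le> h"
  obtains s v where "down_directed (range s)" "is_glb (range s) v" "0 \<le> v" "v \<le> h"
    "\<And>m n. m \<le> n \<Longrightarrow> s n \<le> s m" "\<And>n k. n \<le> k \<Longrightarrow> u k \<le> s n"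
    "\<And>F n c. order_cont F \<Longrightarrow> (\<And>m. (\<Sum>k\<le>m. dual_apply F (u (k + n))) \<le> c) \<Longrightarrow> dual_apply F (s n) \<le> c"
proof -
  have "\<exists>t. (\<forall>m. partial_sup u n m \<le> t) \<and> (\<forall>l. (\<forall>m. partial_sup u n m \<le> l) \<longrightarrow> t \<le> l) \<and>
      (\<forall>F c. order_cont F \<longrightarrow> (\<forall>m. dual_apply F (partial_sup u n m) \<le> c) \<longrightarrow> dual_apply F t \<le> c)" for n
  proof -
    have dir: "\<exists>c\<in>range (partial_sup u n). a \<le> c \<and> b \<le> c"
      if ab: "a \<in> range (partial_sup u n)" "b \<in> range (partial_sup u n)" for a b
    proof -
      obtain i j where "a = partial_sup u n i" "b = partial_sup u n j" using ab by blast
      then show ?thesis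
        by (intro bexI[of _ "partial_sup u n (max i j)"]) (auto intro: partial_sup_mono)
    qed
    have bd: "a \<le> h" if "a \<in> range (partial_sup u n)" for a
      using that partial_sup_least[of n u h] u(2) by blast
    obtain t where t: "\<And>a. a \<in> range (partial_sup u n) \<Longrightarrow> a \<le> t"
      "\<And>l. (\<And>a. a \<in> range (partial_sup u n) \<Longrightarrow> a \<le> l) \<Longrightarrow> t \<le> l"
      "\<And>F c. order_cont F \<Longrightarrow> (\<And>a. a \<in> range (partial_sup u n) \<Longrightarrow> dual_apply F a \<le> c) \<Longrightarrow> dual_apply F t \<le> c"
      by (rule dedekind_complete_lub[OF dc _ dir bd]) blast+
    show ?thesis
    proof (intro exI conjI allI impI)
      show "partial_sup u n m \<le> t" for m by (rule t(1)) simp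
      show "t \<le> l" if "\<forall>m. partial_sup u n m \<le> l" for l by (rule t(2)) (use that in blast)
      show "dual_apply F t \<le> c" if "order_cont F" "\<forall>m. dual_apply F (partial_sup u n m) \<le> c" for F c
        by (rule t(3)[OF that(1)]) (use that(2) in blast)
    qed
  qed
  then obtain s where s: "\<And>n m. partial_sup u n m \<le> s n"
    "\<And>n l. (\<And>m. partial_sup u n m \<le> l) \<Longrightarrow> s n \<le> l"
    "\<And>n F c. order_cont F \<Longrightarrow> (\<And>m. dual_apply F (partial_sup u n m) \<le> c) \<Longrightarrow> dual_apply F (s n) \<le> c"
    by metis
  have us: "u k \<le> s n" if "n \<le> k" for n k
    using order.trans[OF partial_sup_upper[of "k - n" "k - n" u n] s(1)] that by simp
  have mono: "s n \<le> s m" if "m \<le> n" for m n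
    by (rule s(2), rule partial_sup_least) (use us that in auto)
  have dir: "down_directed (range s)"
    unfolding down_directed_def
  proof (intro conjI ballI)
    fix a b assume "a \<in> range s" "b \<in> range s"
    then obtain i j where "a = s i" "b = s j" by blast
    then show "\<exists>c\<in>range s. c \<le> a \<and> c \<le> b"
      using mono[of i "max i j"] mono[of j "max i j"] by (intro bexI[of _ "s (max i j)"]) auto
  qed simp
  have s0: "0 \<le> s n" for n using u(1)[of n] us[of n n] by simp
  then obtain v where v: "is_glb (range s) v"
    using dc dir unfolding dedekind_complete_def by (metis rangeE)
  have "0 \<le> v" using v s0 unfolding is_glb_def by blast
  moreover have "v \<le> h"
  proof -
    have "s 0 \<le> h" by (rule s(2), rule partial_sup_least, rule u(2))
    moreover have "v \<le> s 0" using v unfolding is_glb_def by blast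
    ultimately show ?thesis by simp
  qed
  moreover have "dual_apply F (s n) \<le> c"
    if F: "order_cont F" and c: "\<And>m. (\<Sum>k\<le>m. dual_apply F (u (k + n))) \<le> c" for F n c
  proof (rule s(3)[OF F])
    have "0 \<le> F" using F unfolding order_cont_def by blast
    then show "dual_apply F (partial_sup u n m) \<le> c" for m
      using partial_sup_dual_le[of F u n m, OF _ u(1)] c[of m] by linarith
  qed
  ultimately show thesis using that dir v mono us by blast
qed

text \<open>The last two conclusions are a reverse Fatou inequality and a Borel-Cantelli lemma, with
  an order continuous functional in the place of a measure.\<close>

lemma limsup_sequence_bounds:
  fixes u :: "nat \<Rightarrow> 'z::banach_lattice"
  assumes dc: "dedekind_complete TYPE('z)" and u: "\<And>k. 0 \<le> u k" "\<And>k. u k \<le> h"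
  obtains s v where "down_directed (range s)" "is_glb (range s) v" "0 \<le> v" "v \<le> h"
    "\<And>m n. m \<le> n \<Longrightarrow> s n \<le> s m" "\<And>n k. n \<le> k \<Longrightarrow> u k \<le> s n"
    "\<And>F c N. order_cont F \<Longrightarrow> (\<And>k. N \<le> k \<Longrightarrow> c \<le> dual_apply F (u k)) \<Longrightarrow> c \<le> dual_apply F v"
    "\<And>F r N. order_cont F \<Longrightarrow> summable r \<Longrightarrow> (\<And>k. N \<le> k \<Longrightarrow> dual_apply F (u k) \<le> r k) \<Longrightarrow> dual_apply F v = 0"
proof -
  obtain s v where s: "down_directed (range s)" "is_glb (range s) v" "0 \<le> v" "v \<le> h"
    "\<And>m n. m \<le> n \<Longrightarrow> s n \<le> s m" "\<And>n k. n \<le> k \<Longrightarrow> u k \<le> s n"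
    "\<And>F n c. order_cont F \<Longrightarrow> (\<And>m. (\<Sum>k\<le>m. dual_apply F (u (k + n))) \<le> c) \<Longrightarrow> dual_apply F (s n) \<le> c"
    by (rule limsup_sequence[where u = u, OF dc u]) blast+
  show thesis
  proof (rule that[OF s(1-6)])
    fix F :: "'z dual" and c N assume F: "order_cont F" and c: "\<And>k. N \<le> k \<Longrightarrow> c \<le> dual_apply F (u k)"
    have F0: "0 \<le> F" using F unfolding order_cont_def by blast
    show "c \<le> dual_apply F v"
    proof (rule order_cont_inf_le[OF F s(1,2)])
      fix d assume "d \<in> range s"
      then obtain n where n: "d = s n" by blast
      have "u (max n N) \<le> d" unfolding n by (rule s(6)) simp
      then have "dual_apply F (u (max n N)) \<le> dual_apply F d" by (rule dual_apply_mono[OF F0])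
      then show "c \<le> dual_apply F d" using c[of "max n N"] by simp
    qed
  next
    fix F :: "'z dual" and r N
    assume F: "order_cont F" and r: "summable r" "\<And>k. N \<le> k \<Longrightarrow> dual_apply F (u k) \<le> r k"
    have F0: "0 \<le> F" using F unfolding order_cont_def by blast
    have pos: "0 \<le> dual_apply F (u k)" for k by (rule dual_apply_nonneg[OF F0 u(1)])
    have "dual_apply F v \<le> 0"
    proof (rule field_le_epsilon)
      fix e :: real assume "0 < e"
      have r': "summable (\<lambda>k. r (k + N))" using r(1) by (simp add: summable_iff_shift)
      obtain n where n: "(\<Sum>k. r (k + n + N)) < e" by (rule suminf_shift_less[OF r' \<open>0 < e\<close>])
      have sm: "summable (\<lambda>k. r (k + n + N))" using r(1) by (simp add: summable_iff_shift add.assoc)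
      have le: "dual_apply F (u (k + (n + N))) \<le> r (k + n + N)" for k
        using r(2)[of "k + (n + N)"] by (simp add: add.assoc)
      have "dual_apply F v \<le> dual_apply F (s (n + N))"
        by (rule dual_apply_mono[OF F0]) (use s(2) in \<open>simp add: is_glb_def\<close>)
      also have "\<dots> \<le> (\<Sum>k. r (k + n + N))"
      proof (rule s(7)[OF F])
        fix m
        have "(\<Sum>k\<le>m. dual_apply F (u (k + (n + N)))) \<le> (\<Sum>k\<le>m. r (k + n + N))"
          by (rule sum_mono) (rule le)
        also have "\<dots> \<le> (\<Sum>k. r (k + n + N))"
          by (rule sum_le_suminf[OF sm]) (use order.trans[OF pos le] in auto)
        finally show "(\<Sum>k\<le>m. dual_apply F (u (k + (n + N)))) \<le> (\<Sum>k. r (k + n + N))" .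
      qed
      finally show "dual_apply F v \<le> 0 + e" using n by simp
    qed
    then show "dual_apply F v = 0" using dual_apply_nonneg[OF F0 s(3)] by simp
  qed
qed

text \<open>Approximate decompositions with errors \<open>(1/2)^n\<close> have an exact one as limit
  superior: the values of \<open>G\<close> are summable and vanish by Borel-Cantelli, while reverse
  Fatou preserves the full value \<open>F e\<close>.\<close>

lemma Hahn_decomposition:
  fixes F G :: "'z::banach_lattice dual"
  assumes dc: "dedekind_complete TYPE('z)" and F: "order_cont F" and G: "order_cont G"
    and disj: "inf F G = 0" and e: "0 \<le> e"
  obtains u where "0 \<le> u" "u \<le> e" "dual_apply F u = dual_apply F e" "dual_apply G u = 0"
proof -
  have F0: "0 \<le> F" and G0: "0 \<le> G" using F G unfolding order_cont_def by blast+
  have "\<exists>u. 0 \<le> u \<and> u \<le> e \<and> dual_apply F (e - u) + dual_apply G u < (1/2) ^ n" for n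
    by (rule disjoint_dual_approx[OF disj e, of "(1/2)^n"]) auto
  then obtain u where u: "\<And>n. 0 \<le> u n" "\<And>n. u n \<le> e"
    "\<And>n. dual_apply F (e - u n) + dual_apply G (u n) < (1/2) ^ n"
    by metis
  have Fu: "dual_apply F e - (1/2)^n < dual_apply F (u n)" for n
    using u(3)[of n] dual_apply_nonneg[OF G0 u(1)[of n]] by (simp add: dual_apply_right)
  have Gu: "dual_apply G (u n) \<le> (1/2)^n" for n
    using u(3)[of n] dual_apply_nonneg[OF F0, of "e - u n"] u(2)[of n] by simp
  obtain s v where v: "0 \<le> v" "v \<le> e"
    "\<And>F c N. order_cont F \<Longrightarrow> (\<And>k. N \<le> k \<Longrightarrow> c \<le> dual_apply F (u k)) \<Longrightarrow> c \<le> dual_apply F v"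
    "\<And>F r N. order_cont F \<Longrightarrow> summable r \<Longrightarrow> (\<And>k. N \<le> k \<Longrightarrow> dual_apply F (u k) \<le> r k) \<Longrightarrow> dual_apply F v = 0"
    by (rule limsup_sequence_bounds[where u = u, OF dc u(1,2)]) blast+
  show thesis
  proof (rule that[OF v(1,2)])
    show "dual_apply G v = 0"
      by (rule v(4)[OF G, of "\<lambda>n. (1/2)^n" 0]) (auto simp: Gu intro: summable_geometric)
    show "dual_apply F v = dual_apply F e"
    proof (rule order.antisym[OF dual_apply_mono[OF F0 v(2)]])
      show "dual_apply F e \<le> dual_apply F v"
      proof (rule field_le_epsilon)
        fix d :: real assume "0 < d"
        then obtain N where N: "(1/2)^N < d" using real_arch_pow_inv[of d "1/2"] by auto
        have "dual_apply F e - d \<le> dual_apply F v"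
        proof (rule v(3)[OF F])
          fix k assume "N \<le> k"
          then have "(1/2 :: real)^k \<le> (1/2)^N" by (simp add: power_decreasing)
          then show "dual_apply F e - d \<le> dual_apply F (u k)" using Fu[of k] N by linarith
        qed
        then show "dual_apply F e \<le> dual_apply F v + d" by simp
      qed
    qed
  qed
qed

section \<open>Almost order boundedness of the dual unit ball\<close>

lemma directed_set_nat: "directed_set (UNIV :: nat set) (\<le>)"
  unfolding directed_set_def by (auto intro: max.cobounded1 max.cobounded2)

lemma tails_nat: "tails (UNIV :: nat set) (\<le>) = sequentially"
  unfolding filter_eq_iff eventually_tails[OF directed_set_nat] eventually_sequentially by simp

lemma uo_dual_linear: "\<phi> \<in> uo_dual \<Longrightarrow> linear \<phi>"
  unfolding uo_dual_def by blast

lemma uo_dual_LIMSEQ: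
  fixes x :: "nat \<Rightarrow> 'z::banach_lattice"
  assumes "\<phi> \<in> uo_dual" "\<And>n. norm (x n) \<le> C" "uo_converges UNIV (\<le>) x 0"
  shows "(\<lambda>n. \<phi> (x n)) \<longlonglongrightarrow> 0"
  using uo_dualD[OF assms(1) directed_set_nat _ assms(3)] assms(2) unfolding tails_nat by blast

text \<open>The truncations \<open>inf (g n) h\<close> are disjoint, so their sums stay below
  \<open>h\<close> and their values at each \<open>x \<ge> 0\<close> are summable. By Borel-Cantelli
  for \<open>evaluation x\<close> the limit superior vanishes at every \<open>x\<close>; the tail
  suprema thus decrease to zero and dominate the truncations.\<close>

lemma disjoint_sequence_uo_null:
  fixes g :: "nat \<Rightarrow> 'x::banach_lattice dual"
  assumes g: "\<And>n. 0 \<le> g n" and disj: "\<And>m n. m < n \<Longrightarrow> inf (g m) (g n) = 0"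
  shows "uo_converges UNIV (\<le>) g 0"
  unfolding uo_converges_def
proof (intro allI impI)
  fix h :: "'x dual" assume h: "0 \<le> h"
  define t where "t n = inf (g n) h" for n
  have t: "0 \<le> t n" "t n \<le> h" for n using g h by (simp_all add: t_def)
  have tdisj: "inf (t m) (t n) = 0" if "m < n" for m n
  proof (rule order.antisym)
    have "inf (t m) (t n) \<le> inf (g m) (g n)" by (rule inf_mono) (simp_all add: t_def)
    then show "inf (t m) (t n) \<le> 0" using disj[OF that] by simp
  qed (use t in simp)
  obtain s v where s: "down_directed (range s)" "is_glb (range s) v" "0 \<le> v" "v \<le> h"
    "\<And>m n. m \<le> n \<Longrightarrow> s n \<le> s m" "\<And>n k. n \<le> k \<Longrightarrow> t k \<le> s n"
    "\<And>F r N. order_cont F \<Longrightarrow> summable r \<Longrightarrow> (\<And>k. N \<le> k \<Longrightarrow> dual_apply F (t k) \<le> r k) \<Longrightarrow> dual_apply F v = 0"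
    by (rule limsup_sequence_bounds[where u = t, OF dedekind_complete_dual t]) blast+
  have "dual_apply v x = 0" if x: "0 \<le> x" for x
  proof -
    have "summable (\<lambda>n. dual_apply (t n) x)"
    proof (rule summableI_nonneg_bounded)
      show "0 \<le> dual_apply (t n) x" for n by (rule dual_apply_nonneg[OF t(1) x])
      fix n
      have "(\<Sum>i<n. t i) \<le> h" by (rule sum_disjoint_le[OF t tdisj])
      then have "dual_apply (\<Sum>i<n. t i) x \<le> dual_apply h x"
        using x unfolding less_eq_dual_def by blast
      moreover have "dual_apply (\<Sum>i<n. t i) x = (\<Sum>i<n. dual_apply (t i) x)"
        by (induction n) simp_all
      ultimately show "(\<Sum>i<n. dual_apply (t i) x) \<le> dual_apply h x" by simp
    qed
    then show ?thesis
      using s(7)[OF order_cont_evaluation[OF x], of "\<lambda>n. dual_apply (t n) x" 0]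
      by (simp add: dual_apply_evaluation)
  qed
  then have v0: "v = 0" by (intro dual_mono_ext) simp
  show "order_converges UNIV (\<le>) (\<lambda>n. inf \<bar>g n - 0\<bar> h) 0"
  proof (rule order_convergesI[OF directed_set_nat])
    show "decreases_to_zero UNIV (\<le>) s"
      using s(2,5) unfolding v0 decreases_to_zero_def is_glb_def by blast
    have "\<bar>t b\<bar> \<le> s c" if "c \<le> b" for b c using t(1)[of b] s(6)[OF that] by simp
    then show "\<exists>a\<in>UNIV. \<forall>b\<in>UNIV. a \<le> b \<longrightarrow> \<bar>inf \<bar>g b - 0\<bar> h - 0\<bar> \<le> s c" for c
      using g by (auto simp: t_def)
  qed
qed

text \<open>The functionals \<open>(f n - 4\<^sup>n (\<Sum>i<n. f i) - 2\<^sup>-\<^sup>n G)\<^sup>+\<close> with \<open>G = (\<Sum>i. 2\<^sup>-\<^sup>i f i)\<close> are disjoint.\<close>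

lemma uo_dual_disjointification:
  fixes F :: "'x::banach_lattice dual dual" and f :: "nat \<Rightarrow> 'x dual"
  assumes F: "dual_apply F \<in> uo_dual" "0 \<le> F"
    and f: "\<And>n. 0 \<le> f n" "\<And>n. norm (f n) \<le> 1"
  shows "(\<lambda>n. dual_apply F (pprt (f n - 4^n *\<^sub>R (\<Sum>i<n. f i)))) \<longlonglongrightarrow> 0"
proof -
  define G where "G = (\<Sum>n. (1/2)^n *\<^sub>R f n)"
  define w where "w n = f n - 4^n *\<^sub>R (\<Sum>i<n. f i)" for n
  define g where "g n = pprt (w n - (1/2)^n *\<^sub>R G)" for n
  have sm: "summable (\<lambda>n. (1/2)^n *\<^sub>R f n)" by (rule summable_scaleR_power) (rule f(2))
  have sf0: "0 \<le> (1/2)^n *\<^sub>R f n" for n using f(1) by (simp add: scaleR_nonneg_nonneg)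
  have fG: "(1/2)^n *\<^sub>R f n \<le> G" for n unfolding G_def by (rule term_le_suminf[OF sm sf0])
  have G0: "0 \<le> G" using fG[of 0] f(1)[of 0] by simp
  have sG0: "0 \<le> (1/2)^n *\<^sub>R G" for n using G0 by (simp add: scaleR_nonneg_nonneg)
  have S0: "0 \<le> 4^n *\<^sub>R (\<Sum>i<n. f i)" for n using f(1) by (simp add: scaleR_nonneg_nonneg sum_nonneg)
  have g0: "0 \<le> g n" for n by (simp add: g_def)
  have wf: "w n \<le> f n" for n using S0[of n] unfolding w_def by simp
  have gf: "g n \<le> f n" for n
    unfolding g_def
  proof (rule pprt_least[OF _ f(1)])
    have "w n - (1/2)^n *\<^sub>R G \<le> w n" using sG0[of n] by simp
    then show "w n - (1/2)^n *\<^sub>R G \<le> f n" using wf[of n] by (rule order.trans)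
  qed
  \<comment> \<open>Both functionals are compared with \<open>a = 2^(m+n) f m - f n\<close>. The
    term \<open>(1/2)^m G\<close> dominates \<open>(1/2)^(m+n) f n\<close>, which places
    \<open>g m\<close> below the positive part of \<open>a\<close>. The factor
    \<open>4^n \<ge> 2^(m+n)\<close> removes enough of \<open>f m\<close> from \<open>f n\<close> to
    place \<open>g n\<close> below the positive part of \<open>- a\<close>.\<close>
  have disj: "inf (g m) (g n) = 0" if mn: "m < n" for m n
  proof -
    define a where "a = 2^(m+n) *\<^sub>R f m - f n"
    have "w m - (1/2)^m *\<^sub>R G \<le> f m - (1/2)^m *\<^sub>R ((1/2)^n *\<^sub>R f n)"
      by (rule diff_mono[OF wf scaleR_left_mono[OF fG]]) simp
    also have "\<dots> = (1/2)^(m+n) *\<^sub>R a"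
      by (simp add: a_def scaleR_diff_right power_add power_divide)
    finally have "g m \<le> (1/2)^(m+n) *\<^sub>R pprt a"
      unfolding g_def using pprt_mono[of _ "(1/2)^(m+n) *\<^sub>R a"] by (simp add: pprt_scaleR)
    also have "\<dots> \<le> 1 *\<^sub>R pprt a" by (rule scaleR_right_mono) (simp_all add: power_le_one)
    finally have gm: "g m \<le> pprt a" by simp
    have "w n - (1/2)^n *\<^sub>R G \<le> - a"
    proof -
      have "2^(m+n) *\<^sub>R f m \<le> 4^n *\<^sub>R f m"
      proof (rule scaleR_right_mono[OF _ f(1)])
        have "(2::real)^(m+n) \<le> 2^(n+n)" by (rule power_increasing) (use mn in simp_all)
        also have "\<dots> = 4^n" by (simp add: power_add flip: power_mult_distrib)
        finally show "(2::real)^(m+n) \<le> 4^n" .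
      qed
      also have "\<dots> \<le> 4^n *\<^sub>R (\<Sum>i<n. f i)"
      proof (rule scaleR_left_mono)
        have "(\<Sum>i\<in>{m}. f i) \<le> (\<Sum>i<n. f i)" by (rule sum_mono2) (use mn f(1) in auto)
        then show "f m \<le> (\<Sum>i<n. f i)" by simp
      qed simp
      finally have "w n \<le> - a" unfolding w_def a_def by simp
      moreover have "w n - (1/2)^n *\<^sub>R G \<le> w n" using sG0[of n] by simp
      ultimately show ?thesis by (rule order.trans[rotated])
    qed
    then have gn: "g n \<le> pprt (- a)" unfolding g_def by (rule pprt_mono)
    have "inf (g m) (g n) \<le> inf (pprt a) (pprt (- a))" by (rule inf_mono[OF gm gn])
    also have "\<dots> = 0" by (rule inf_pprt_pprt_minus)
    finally show ?thesis using g0 by (intro order.antisym) simp_all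
  qed
  have g1: "norm (g n) \<le> 1" for n using norm_mono_pos[OF g0 gf[of n]] f(2)[of n] by linarith
  have lim: "(\<lambda>n. dual_apply F (g n)) \<longlonglongrightarrow> 0"
    by (rule uo_dual_LIMSEQ[OF F(1) g1 disjoint_sequence_uo_null[OF g0 disj]])
  have "(\<lambda>n. dual_apply F (g n) + (1/2)^n * dual_apply F G) \<longlonglongrightarrow> 0 + 0 * dual_apply F G"
    by (intro tendsto_intros lim) simp
  then have lim2: "(\<lambda>n. dual_apply F (g n) + (1/2)^n * dual_apply F G) \<longlonglongrightarrow> 0" by simp
  show ?thesis
  proof (rule tendsto_sandwich[OF _ _ tendsto_const lim2])
    show "\<forall>\<^sub>F n in sequentially. 0 \<le> dual_apply F (pprt (f n - 4^n *\<^sub>R (\<Sum>i<n. f i)))"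
      by (simp add: dual_apply_nonneg[OF F(2)])
    \<comment> \<open>Leaving out the correction \<open>(1/2)^n G\<close> costs at most
      \<open>(1/2)^n F G\<close>, which tends to zero.\<close>
    have "dual_apply F (pprt (w n)) \<le> dual_apply F (g n) + (1/2)^n * dual_apply F G" for n
    proof -
      have "pprt (w n) \<le> g n + (1/2)^n *\<^sub>R G"
      proof (rule pprt_least)
        show "w n \<le> g n + (1/2)^n *\<^sub>R G" unfolding g_def using le_pprt[of "w n - (1/2)^n *\<^sub>R G"]
          by (simp add: algebra_simps)
        show "0 \<le> g n + (1/2)^n *\<^sub>R G" using g0 sG0 by (rule add_nonneg_nonneg)
      qed
      then have "dual_apply F (pprt (w n)) \<le> dual_apply F (g n + (1/2)^n *\<^sub>R G)"
        by (rule dual_apply_mono[OF F(2)])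
      then show ?thesis by (simp add: dual_apply_right)
    qed
    then show "\<forall>\<^sub>F n in sequentially. dual_apply F (pprt (f n - 4^n *\<^sub>R (\<Sum>i<n. f i)))
        \<le> dual_apply F (g n) + (1/2)^n * dual_apply F G"
      by (simp add: w_def)
  qed
qed

text \<open>Each choice depends on the earlier ones only through their sum, so the recursion runs
  over the partial sums \<open>S\<close> and the functionals are read off from its
  increments.\<close>

lemma dependent_functionals:
  fixes P :: "'x::banach_lattice dual \<Rightarrow> 'x dual \<Rightarrow> bool"
  assumes "\<And>h. 0 \<le> h \<Longrightarrow> \<exists>f\<ge>0. norm f \<le> 1 \<and> P h f"
  obtains f :: "nat \<Rightarrow> 'x dual" where "\<And>n. 0 \<le> f n" "\<And>n. norm (f n) \<le> 1"
    "\<And>n. P (4^n *\<^sub>R (\<Sum>i<n. f i)) (f n)"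
proof -
  define c where "c h = (SOME f. 0 \<le> f \<and> norm f \<le> 1 \<and> P h f)" for h
  have c: "0 \<le> c h \<and> norm (c h) \<le> 1 \<and> P h (c h)" if "0 \<le> h" for h
    unfolding c_def by (rule someI_ex) (use assms[OF that] in blast)
  define S where "S = rec_nat 0 (\<lambda>n s. s + c (4^n *\<^sub>R s))"
  have S: "S 0 = 0" "S (Suc n) = S n + c (4^n *\<^sub>R S n)" for n by (simp_all add: S_def)
  have S0: "0 \<le> S n" for n
    by (induction n) (use c in \<open>auto simp: S scaleR_nonneg_nonneg add_nonneg_nonneg\<close>)
  have sum: "S n = (\<Sum>i<n. c (4^i *\<^sub>R S i))" for n by (induction n) (simp_all add: S)
  have c': "0 \<le> c (4^n *\<^sub>R S n) \<and> norm (c (4^n *\<^sub>R S n)) \<le> 1 \<and> P (4^n *\<^sub>R S n) (c (4^n *\<^sub>R S n))" for n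
    by (rule c) (use S0 in \<open>simp add: scaleR_nonneg_nonneg\<close>)
  show thesis
    by (rule that[of "\<lambda>n. c (4^n *\<^sub>R S n)"]) (use c' in \<open>simp_all flip: sum\<close>)
qed

lemma uo_dual_almost_order_bounded:
  fixes F :: "'x::banach_lattice dual dual"
  assumes F: "dual_apply F \<in> uo_dual" "0 \<le> F" and e: "0 < e"
  shows "\<exists>h\<ge>0. \<forall>f\<ge>0. norm f \<le> 1 \<longrightarrow> dual_apply F (pprt (f - h)) \<le> e"
proof (rule ccontr)
  assume contra: "\<not> ?thesis"
  have "\<exists>f\<ge>0. norm f \<le> 1 \<and> e < dual_apply F (pprt (f - h))" if "0 \<le> h" for h
    using contra that by (auto simp: not_le)
  then obtain f where f: "\<And>n. 0 \<le> f n" "\<And>n. norm (f n) \<le> 1"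
    "\<And>n. e < dual_apply F (pprt (f n - 4^n *\<^sub>R (\<Sum>i<n. f i)))"
    by (rule dependent_functionals[where P = "\<lambda>h f. e < dual_apply F (pprt (f - h))"]) blast+
  have "e \<le> 0"
    by (rule LIMSEQ_le_const[OF uo_dual_disjointification[where f = f, OF F f(1,2)]]) (use f(3) less_imp_le in blast)
  then show False using e by simp
qed

text \<open>A failure yields functionals \<open>f n\<close> and elements \<open>u n\<close> of
  \<open>{0..x}\<close> with \<open>f n\<close> at least \<open>e\<close> on \<open>u n\<close>,
  while every earlier \<open>f i\<close> is nearly zero there. The limit superior \<open>v\<close>
  of the \<open>u n\<close> is then annihilated by all \<open>f i\<close>, so
  \<open>f n (s n - v) \<ge> e\<close>, although order continuity makes \<open>s n - v\<close> small
  in norm for some \<open>n\<close>.\<close>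

lemma order_continuous_almost_order_bounded:
  fixes x :: "'x::banach_lattice"
  assumes oc: "order_continuous TYPE('x)" and x: "0 \<le> x" and e: "0 < e"
  shows "\<exists>h\<ge>0. \<forall>f\<ge>0. norm f \<le> 1 \<longrightarrow> dual_apply (pprt (f - h)) x \<le> e"
proof (rule ccontr)
  assume contra: "\<not> ?thesis"
  have "\<exists>f\<ge>0. norm f \<le> 1 \<and> e < dual_apply (pprt (f - h)) x" if "0 \<le> h" for h
    using contra that by (auto simp: not_le)
  then obtain f where f: "\<And>n. 0 \<le> f n" "\<And>n. norm (f n) \<le> 1"
    "\<And>n. e < dual_apply (pprt (f n - 4^n *\<^sub>R (\<Sum>i<n. f i))) x"
    by (rule dependent_functionals[where P = "\<lambda>h f. e < dual_apply (pprt (f - h)) x"]) blast+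
  have "\<exists>u. 0 \<le> u \<and> u \<le> x \<and> e < dual_apply (f n - 4^n *\<^sub>R (\<Sum>i<n. f i)) u" for n
    using pprt_dual_approx[OF x f(3)[of n]] by blast
  then obtain u where u: "\<And>n. 0 \<le> u n" "\<And>n. u n \<le> x"
    "\<And>n. e < dual_apply (f n - 4^n *\<^sub>R (\<Sum>i<n. f i)) (u n)"
    by metis
  have fu: "dual_apply (f n) (u n) \<le> norm x" for n
  proof -
    have "dual_apply (f n) (u n) \<le> dual_apply (f n) x" by (rule dual_apply_mono[OF f(1) u(2)])
    also have "\<dots> \<le> norm (f n) * norm x" using norm_dual_bound[of "f n" x] by simp
    also have "\<dots> \<le> 1 * norm x" by (rule mult_right_mono[OF f(2)]) simp
    finally show ?thesis by simp
  qed
  \<comment> \<open>The choice of \<open>u n\<close> makes \<open>4^n\<close> times the value of the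
    earlier sum at \<open>u n\<close> smaller than \<open>f n (u n)\<close>, hence at most
    \<open>norm x\<close>. The resulting bound is summable in \<open>n\<close> for fixed
    \<open>i\<close>, as Borel-Cantelli requires.\<close>
  have small: "dual_apply (f i) (u n) \<le> (1/4)^n * norm x" if "i < n" for i n
  proof -
    have "(\<Sum>i\<in>{i}. f i) \<le> (\<Sum>i<n. f i)" by (rule sum_mono2) (use that f(1) in auto)
    then have "dual_apply (f i) (u n) \<le> dual_apply (\<Sum>i<n. f i) (u n)"
      using u(1) unfolding less_eq_dual_def by simp
    then have "4^n * dual_apply (f i) (u n) \<le> 4^n * dual_apply (\<Sum>i<n. f i) (u n)" by simp
    moreover have "4^n * dual_apply (\<Sum>i<n. f i) (u n) \<le> norm x"
      using u(3)[of n] fu[of n] e by simp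
    ultimately have "4^n * dual_apply (f i) (u n) \<le> norm x" by linarith
    then show ?thesis by (simp add: field_simps)
  qed
  have big: "e \<le> dual_apply (f n) (u n)" for n
  proof -
    have "0 \<le> dual_apply (4^n *\<^sub>R (\<Sum>i<n. f i)) (u n)"
      by (rule dual_apply_nonneg[OF _ u(1)]) (use f(1) in \<open>simp add: scaleR_nonneg_nonneg sum_nonneg\<close>)
    then show ?thesis using u(3)[of n] by simp
  qed
  obtain s v where s: "down_directed (range s)" "is_glb (range s) v" "0 \<le> v"
    "\<And>m n. m \<le> n \<Longrightarrow> s n \<le> s m" "\<And>n k. n \<le> k \<Longrightarrow> u k \<le> s n"
    "\<And>F r N. order_cont F \<Longrightarrow> summable r \<Longrightarrow> (\<And>k. N \<le> k \<Longrightarrow> dual_apply F (u k) \<le> r k) \<Longrightarrow> dual_apply F v = 0"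
    by (rule limsup_sequence_bounds[where u = u, OF order_continuous_dedekind_complete[OF oc] u(1,2)]) blast+
  have fv: "dual_apply (f i) v = 0" for i
  proof (rule s(6)[OF order_continuous_order_cont[OF oc f(1)]])
    show "summable (\<lambda>n. (1/4)^n * norm x)" by (intro summable_mult2 summable_geometric) simp
    show "dual_apply (f i) (u k) \<le> (1/4)^k * norm x" if "Suc i \<le> k" for k by (rule small) (use that in simp)
  qed
  obtain n where n: "norm (s n - v) < e"
    using order_continuous_glb_norm[OF oc s(1,2) e] by blast
  have "e \<le> dual_apply (f n) (s n - v)"
    using big[of n] dual_apply_mono[OF f(1) s(5)[OF order.refl], of n n] fv[of n]
    by (simp add: dual_apply_right)
  also have "\<dots> \<le> norm (f n) * norm (s n - v)" using norm_dual_bound[of "f n" "s n - v"] by simp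
  also have "\<dots> \<le> 1 * norm (s n - v)" by (rule mult_right_mono[OF f(2)]) simp
  finally show False using n by simp
qed

section \<open>Order continuity of the norm\<close>

lemma order_converges_order_cont:
  fixes x :: "'i \<Rightarrow> 'z::banach_lattice"
  assumes x: "order_converges I le x 0" and F: "order_cont F" and e: "0 < e"
  shows "\<exists>a\<in>I. \<forall>b\<in>I. le a b \<longrightarrow> dual_apply F \<bar>x b\<bar> < e"
proof -
  obtain J :: "'z set" and le' and y :: "'z \<Rightarrow> 'z" where J: "directed_set J le'" "decreases_to_zero J le' y"
    "\<And>c. c \<in> J \<Longrightarrow> \<exists>a\<in>I. \<forall>b\<in>I. le a b \<longrightarrow> \<bar>x b - 0\<bar> \<le> y c"
    using x unfolding order_converges_def by blast
  have D: "down_directed (y ` J)"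
    unfolding down_directed_def
  proof (intro conjI ballI)
    fix a b assume "a \<in> y ` J" "b \<in> y ` J"
    then obtain i j where ij: "i \<in> J" "j \<in> J" "a = y i" "b = y j" by blast
    then obtain k where "k \<in> J" "le' i k" "le' j k"
      using J(1) unfolding directed_set_def by meson
    then show "\<exists>c\<in>y ` J. c \<le> a \<and> c \<le> b"
      using J(2) ij unfolding decreases_to_zero_def by blast
  qed (use J(1) in \<open>simp add: directed_set_def\<close>)
  have glb: "is_glb (y ` J) 0" using J(2) unfolding is_glb_def decreases_to_zero_def by blast
  obtain c where c: "c \<in> J" "dual_apply F (y c) < e"
    using order_contD[OF F D glb e] by (auto simp: dual_apply_right)
  have F0: "0 \<le> F" using F unfolding order_cont_def by blast
  have "dual_apply F \<bar>x b\<bar> < e" if "\<bar>x b - 0\<bar> \<le> y c" for b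
    using dual_apply_mono[OF F0, of "\<bar>x b\<bar>" "y c"] that c(2) by simp
  then show ?thesis using J(3)[OF c(1)] by blast
qed

section \<open>Domination for order convergence and uo-convergence\<close>

lemma order_converges_dominated:
  fixes f g :: "'i \<Rightarrow> 'z::vector_lattice"
  assumes f: "order_converges I le f 0" and le: "\<And>a. a \<in> I \<Longrightarrow> \<bar>g a\<bar> \<le> \<bar>f a\<bar>"
  shows "order_converges I le g 0"
proof -
  obtain J :: "'z set" and le' and y :: "'z \<Rightarrow> 'z" where J: "directed_set J le'" "decreases_to_zero J le' y"
    "\<And>c. c \<in> J \<Longrightarrow> \<exists>a\<in>I. \<forall>b\<in>I. le a b \<longrightarrow> \<bar>f b - 0\<bar> \<le> y c"
    using f unfolding order_converges_def by blast
  show ?thesis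
  proof (rule order_convergesI[OF J(1,2)])
    fix c assume "c \<in> J"
    then obtain a where "a \<in> I" "\<And>b. b \<in> I \<Longrightarrow> le a b \<Longrightarrow> \<bar>f b\<bar> \<le> y c"
      using J(3) by (metis diff_zero)
    then show "\<exists>a\<in>I. \<forall>b\<in>I. le a b \<longrightarrow> \<bar>g b - 0\<bar> \<le> y c"
      using order.trans[OF le] by (auto intro!: bexI[of _ a])
  qed
qed

lemma uo_converges_dominated:
  fixes f g :: "'i \<Rightarrow> 'z::vector_lattice"
  assumes f: "uo_converges I le f 0" and le: "\<And>a. a \<in> I \<Longrightarrow> \<bar>g a\<bar> \<le> \<bar>f a\<bar>"
  shows "uo_converges I le g 0"
  unfolding uo_converges_def
proof (intro allI impI)
  fix h :: 'z assume h: "0 \<le> h"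
  show "order_converges I le (\<lambda>a. inf \<bar>g a - 0\<bar> h) 0"
  proof (rule order_converges_dominated)
    show "order_converges I le (\<lambda>a. inf \<bar>f a - 0\<bar> h) 0" using f h unfolding uo_converges_def by blast
    have "\<bar>inf \<bar>w\<bar> h\<bar> = inf \<bar>w\<bar> h" for w using h by (intro abs_of_nonneg) simp
    then show "\<bar>inf \<bar>g a - 0\<bar> h\<bar> \<le> \<bar>inf \<bar>f a - 0\<bar> h\<bar>" if "a \<in> I" for a
      using inf_mono[OF le[OF that] order.refl, of h] by simp
  qed
qed

lemma order_converges_imp_uo_converges:
  fixes f :: "'i \<Rightarrow> 'z::vector_lattice"
  assumes "order_converges I le f 0"
  shows "uo_converges I le f 0"
  unfolding uo_converges_def
proof (intro allI impI)
  fix h :: 'z assume h: "0 \<le> h"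
  have "\<bar>inf \<bar>w\<bar> h\<bar> \<le> \<bar>w\<bar>" for w
    using h by (subst abs_of_nonneg) simp_all
  then show "order_converges I le (\<lambda>a. inf \<bar>f a - 0\<bar> h) 0"
    by (intro order_converges_dominated[OF assms]) simp
qed

text \<open>Split \<open>\<bar>f a\<bar>\<close> into its infimum with \<open>h\<close> and the
  positive part of \<open>\<bar>f a\<bar> - h\<close>. The second part is uniformly small at
  \<open>\<bar>x\<bar>\<close> by almost order boundedness; the first tends to zero there, since
  uo-convergence makes it order null and evaluations are order continuous.\<close>

lemma order_continuous_evaluation_uo_dual:
  fixes x :: "'x::banach_lattice"
  assumes oc: "order_continuous TYPE('x)"
  shows "dual_apply (evaluation x) \<in> uo_dual"
  unfolding uo_dual_def
proof (intro CollectI conjI allI impI)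
  show "linear (dual_apply (evaluation x))" by (rule linear_dual_apply)
  fix I :: "'x dual set set" and le and f :: "'x dual set \<Rightarrow> 'x dual"
  assume dir: "directed_set I le" and "\<exists>C. \<forall>a\<in>I. norm (f a) \<le> C" and uo: "uo_converges I le f 0"
  then obtain C where C: "\<And>a. a \<in> I \<Longrightarrow> norm (f a) \<le> C" by blast
  \<comment> \<open>The added \<open>1\<close> keeps the scaling factor positive even if
    \<open>C\<close> is zero, so that \<open>f a / K\<close> lies in the unit ball.\<close>
  define K where "K = \<bar>C\<bar> + 1"
  have K: "0 < K" by (simp add: K_def add_nonneg_pos)
  show "((\<lambda>a. dual_apply (evaluation x) (f a)) \<longlongrightarrow> 0) (tails I le)"
  proof (rule tendstoI)
    fix e :: real assume e: "0 < e"
    have "0 < e / (2 * K)" using e K by simp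
    then obtain h0 where h0: "0 \<le> h0"
      "\<And>f. 0 \<le> f \<Longrightarrow> norm f \<le> 1 \<Longrightarrow> dual_apply (pprt (f - h0)) \<bar>x\<bar> \<le> e / (2 * K)"
      using order_continuous_almost_order_bounded[OF oc, of "\<bar>x\<bar>"] by (metis abs_ge_zero)
    define h where "h = K *\<^sub>R h0"
    have h: "0 \<le> h" unfolding h_def using K h0(1) by (simp add: scaleR_nonneg_nonneg)
    have tail: "dual_apply (pprt (\<bar>f a\<bar> - h)) \<bar>x\<bar> \<le> e / 2" if "a \<in> I" for a
    proof -
      define k where "k = inverse K *\<^sub>R \<bar>f a\<bar>"
      have "norm k \<le> 1" using C[OF that] K by (simp add: k_def K_def norm_abs field_simps)
      moreover have "0 \<le> k" unfolding k_def using K by (simp add: scaleR_nonneg_nonneg)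
      ultimately have *: "dual_apply (pprt (k - h0)) \<bar>x\<bar> \<le> e / (2 * K)" using h0(2) by blast
      have "\<bar>f a\<bar> - h = K *\<^sub>R (k - h0)" using K by (simp add: k_def h_def scaleR_diff_right)
      then have "pprt (\<bar>f a\<bar> - h) = K *\<^sub>R pprt (k - h0)" using K by (simp add: pprt_scaleR)
      then show ?thesis using * K by (simp add: field_simps)
    qed
    have "order_converges I le (\<lambda>a. inf \<bar>f a - 0\<bar> h) 0"
      using uo h unfolding uo_converges_def by blast
    then obtain a where a: "a \<in> I"
      "\<And>b. b \<in> I \<Longrightarrow> le a b \<Longrightarrow> dual_apply (evaluation \<bar>x\<bar>) \<bar>inf \<bar>f b - 0\<bar> h\<bar> < e / 2"
      using order_converges_order_cont[OF _ order_cont_evaluation[of "\<bar>x\<bar>"], of I le _ "e/2"] e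
      by (metis abs_ge_zero half_gt_zero)
    have "dist (dual_apply (evaluation x) (f b)) 0 < e" if b: "b \<in> I" "le a b" for b
    proof -
      have "\<bar>inf \<bar>f b\<bar> h\<bar> = inf \<bar>f b\<bar> h" using h by (intro abs_of_nonneg) simp
      then have "dual_apply (inf \<bar>f b\<bar> h) \<bar>x\<bar> < e / 2"
        using a(2)[OF b] by (simp add: dual_apply_evaluation)
      moreover have "dual_apply \<bar>f b\<bar> \<bar>x\<bar> = dual_apply (inf \<bar>f b\<bar> h) \<bar>x\<bar> + dual_apply (pprt (\<bar>f b\<bar> - h)) \<bar>x\<bar>"
        by (metis dual_apply_left(1) inf_plus_pprt)
      ultimately have "dual_apply \<bar>f b\<bar> \<bar>x\<bar> < e" using tail[OF b(1)] by linarith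
      then show ?thesis using abs_dual_apply_le[of "f b" x] by (simp add: dual_apply_evaluation)
    qed
    then show "\<forall>\<^sub>F a in tails I le. dist (dual_apply (evaluation x) (f a)) 0 < e"
      unfolding eventually_tails[OF dir] using a(1) by blast
  qed
qed

text \<open>Otherwise there are increments of norm at least \<open>e\<close>; functionals norming them are almost
  dominated by a single \<open>h\<close>, but \<open>h\<close> is small on late increments.\<close>

lemma uo_dual_dominated_Cauchy:
  fixes F :: "'x::banach_lattice dual dual"
  assumes F: "dual_apply F \<in> uo_dual" "0 \<le> F"
    and K: "K \<noteq> {}" "\<And>k. k \<in> K \<Longrightarrow> 0 \<le> k \<and> evaluation k \<le> F" and e: "0 < e"
  shows "\<exists>k\<in>K. \<forall>k'\<in>K. k \<le> k' \<longrightarrow> norm (k' - k) \<le> e"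
proof (rule ccontr)
  assume "\<not> ?thesis"
  then have "\<forall>k\<in>K. \<exists>k'\<in>K. k \<le> k' \<and> e < norm (k' - k)" by (auto simp: not_le)
  then obtain c where c: "\<And>k. k \<in> K \<Longrightarrow> c k \<in> K \<and> k \<le> c k \<and> e < norm (c k - k)" by metis
  obtain k0 where k0: "k0 \<in> K" using K(1) by blast
  define k where "k n = (c ^^ n) k0" for n
  have kK: "k n \<in> K" for n by (induction n) (use k0 c in \<open>auto simp: k_def\<close>)
  have kS: "k (Suc n) = c (k n)" for n by (simp add: k_def)
  obtain h where h: "0 \<le> h" "\<And>f. 0 \<le> f \<Longrightarrow> norm f \<le> 1 \<Longrightarrow> dual_apply F (pprt (f - h)) \<le> e / 2"
    using uo_dual_almost_order_bounded[OF F, of "e/2"] e by auto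
  \<comment> \<open>A functional \<open>f\<close> norming the increment \<open>v\<close> takes a
    value above \<open>e\<close>. Since \<open>v\<close> lies below an element of \<open>K\<close>,
    the excess of \<open>f\<close> over \<open>h\<close> contributes at most
    \<open>F (pprt (f - h)) \<le> e / 2\<close>, so \<open>h\<close> must account for the other
    half.\<close>
  have step: "e / 2 \<le> dual_apply h (k (Suc n) - k n)" for n
  proof -
    define v where "v = k (Suc n) - k n"
    have v: "0 \<le> v" "e < norm v" "v \<le> k (Suc n)"
      using c[OF kK[of n]] K(2)[OF kK[of n]] by (simp_all add: v_def kS)
    obtain f :: "'x dual" where f: "0 \<le> f" "norm f \<le> 1" "dual_apply f v = norm (pprt v)"
      using norming_positive_functional[of v] by blast
    have "dual_apply (pprt (f - h)) v \<le> dual_apply (pprt (f - h)) (k (Suc n))"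
      by (rule dual_apply_mono[OF _ v(3)]) simp
    also have "\<dots> \<le> dual_apply F (pprt (f - h))"
      using K(2)[OF kK[of "Suc n"]] unfolding less_eq_dual_def[of "evaluation _"] dual_apply_evaluation by simp
    also have "\<dots> \<le> e / 2" by (rule h(2)[OF f(1,2)])
    finally have "dual_apply (pprt (f - h)) v \<le> e / 2" .
    moreover have "dual_apply f v = dual_apply (inf f h) v + dual_apply (pprt (f - h)) v"
      by (metis dual_apply_left(1) inf_plus_pprt)
    moreover have "dual_apply (inf f h) v \<le> dual_apply h v"
      using v(1) inf_le2[of f h] unfolding less_eq_dual_def by blast
    ultimately show ?thesis using f(3) v unfolding v_def[symmetric] by simp
  qed
  \<comment> \<open>The increments telescope. The growth is unbounded, whereas
    \<open>h (k n) \<le> F h\<close> for all \<open>n\<close>.\<close>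
  have grow: "real n * (e / 2) \<le> dual_apply h (k n) - dual_apply h (k 0)" for n
  proof (induction n)
    case (Suc n)
    have "real (Suc n) * (e / 2) = real n * (e / 2) + e / 2" by (simp add: algebra_simps)
    then show ?case using Suc step[of n] unfolding dual_apply_right by linarith
  qed simp
  have top: "dual_apply h (k n) \<le> dual_apply F h" for n
    using K(2)[OF kK[of n]] h(1) unfolding less_eq_dual_def[of "evaluation _"] dual_apply_evaluation by blast
  have bot: "0 \<le> dual_apply h (k 0)" by (rule dual_apply_nonneg[OF h(1)]) (use K(2)[OF kK] in blast)
  obtain n where "dual_apply F h < real n * (e / 2)"
    using reals_Archimedean3[of "e / 2"] e by auto
  then show False using grow[of n] top[of n] bot by linarith
qed

text \<open>The chosen \<open>k n\<close> need not increase, but a common upper bound in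
  \<open>K\<close> of two of them is close to both. In the same way, an upper bound
  \<open>c n\<close> of \<open>k n\<close> and a given \<open>a\<close> stays close to
  \<open>k n\<close>, so the limit of the \<open>k n\<close> lies above \<open>a\<close>.\<close>

lemma uo_dual_dominated_converges:
  fixes F :: "'x::banach_lattice dual dual"
  assumes F: "dual_apply F \<in> uo_dual" "0 \<le> F"
    and K: "K \<noteq> {}" "\<And>k. k \<in> K \<Longrightarrow> 0 \<le> k \<and> evaluation k \<le> F"
    and dir: "\<And>a b. a \<in> K \<Longrightarrow> b \<in> K \<Longrightarrow> \<exists>c\<in>K. a \<le> c \<and> b \<le> c"
  obtains y where "\<And>k. k \<in> K \<Longrightarrow> k \<le> y" "\<And>e. 0 < e \<Longrightarrow> \<exists>k\<in>K. norm (y - k) < e"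
proof -
  have "\<exists>k\<in>K. \<forall>k'\<in>K. k \<le> k' \<longrightarrow> norm (k' - k) \<le> inverse (real (Suc n))" for n
    by (rule uo_dual_dominated_Cauchy[OF F K]) simp_all
  then obtain k where k: "\<And>n. k n \<in> K"
    "\<And>n k'. k' \<in> K \<Longrightarrow> k n \<le> k' \<Longrightarrow> norm (k' - k n) \<le> inverse (real (Suc n))"
    by metis
  have small: "\<exists>N. \<forall>n\<ge>N. inverse (real (Suc n)) < e" if "0 < e" for e
    using order_tendstoD(2)[OF LIMSEQ_inverse_real_of_nat that] unfolding eventually_sequentially .
  have "Cauchy k"
  proof (rule metric_CauchyI)
    fix e :: real assume "0 < e"
    then obtain N where N: "\<And>n. n \<ge> N \<Longrightarrow> inverse (real (Suc n)) < e / 2"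
      using small[of "e/2"] by auto
    have "dist (k m) (k n) < e" if mn: "m \<ge> N" "n \<ge> N" for m n
    proof -
      obtain c where c: "c \<in> K" "k m \<le> c" "k n \<le> c" using dir k(1) by blast
      have "norm (k m - k n) \<le> norm (c - k n) + norm (c - k m)"
        using norm_triangle_ineq4[of "c - k n" "c - k m"] by simp
      then show ?thesis
        using k(2)[OF c(1,2)] k(2)[OF c(1,3)] N[OF mn(1)] N[OF mn(2)] by (simp add: dist_norm)
    qed
    then show "\<exists>N. \<forall>m\<ge>N. \<forall>n\<ge>N. dist (k m) (k n) < e" by blast
  qed
  then obtain y where y: "k \<longlonglongrightarrow> y" using Cauchy_convergent convergent_def by blast
  show thesis
  proof (rule that[of y])
    fix a assume a: "a \<in> K"
    have "\<forall>n. \<exists>c. c \<in> K \<and> k n \<le> c \<and> a \<le> c" using dir k(1) a by blast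
    then obtain c where c: "\<And>n. c n \<in> K" "\<And>n. k n \<le> c n" "\<And>n. a \<le> c n" by metis
    have "(\<lambda>n. c n - k n) \<longlonglongrightarrow> 0"
      by (rule Lim_null_comparison[OF _ LIMSEQ_inverse_real_of_nat])
         (use k(2)[OF c(1,2)] in \<open>auto intro!: always_eventually\<close>)
    then have "c \<longlonglongrightarrow> y" using tendsto_add[OF y] by fastforce
    then show "a \<le> y" by (rule tendsto_ge_const) (use c(3) in simp_all)
  next
    fix e :: real assume "0 < e"
    then obtain n where "norm (k n - y) < e" using y unfolding LIMSEQ_iff by blast
    then show "\<exists>k\<in>K. norm (y - k) < e" using k(1) by (auto simp: norm_minus_commute)
  qed
qed

lemma order_continuous_if_evaluation_uo_dual:
  assumes ev: "\<And>x :: 'x::banach_lattice. dual_apply (evaluation x) \<in> uo_dual"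
  shows "order_continuous TYPE('x)"
  unfolding order_continuous_def
proof (intro allI impI)
  fix I :: "'x set set" and le and x :: "'x set \<Rightarrow> 'x"
  assume dirI: "directed_set I le" and "order_converges I le x 0"
  then obtain J :: "'x set" and le' and y :: "'x \<Rightarrow> 'x" where J: "directed_set J le'" "decreases_to_zero J le' y"
    "\<And>c. c \<in> J \<Longrightarrow> \<exists>a\<in>I. \<forall>b\<in>I. le a b \<longrightarrow> \<bar>x b - 0\<bar> \<le> y c"
    unfolding order_converges_def by blast
  have y: "\<And>a b. a \<in> J \<Longrightarrow> b \<in> J \<Longrightarrow> le' a b \<Longrightarrow> y b \<le> y a" "\<And>a. a \<in> J \<Longrightarrow> 0 \<le> y a"
    "\<And>z. (\<And>a. a \<in> J \<Longrightarrow> z \<le> y a) \<Longrightarrow> z \<le> 0"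
    using J(2) unfolding decreases_to_zero_def by blast+
  have up: "\<exists>c\<in>J. le' a c \<and> le' b c" if "a \<in> J" "b \<in> J" for a b
    using J(1) that unfolding directed_set_def by blast
  have trans: "le' a c" if "a \<in> J" "b \<in> J" "c \<in> J" "le' a b" "le' b c" for a b c
    using J(1) that unfolding directed_set_def by blast
  obtain c0 where c0: "c0 \<in> J" using J(1) unfolding directed_set_def by blast
  have refl0: "le' c0 c0" using J(1) c0 unfolding directed_set_def by blast
  \<comment> \<open>The decreasing net \<open>y\<close> becomes an increasing one below
    \<open>y c0\<close>. Its norm limit must be \<open>y c0\<close> because \<open>y\<close>
    decreases to zero, and the distance of \<open>y c0\<close> from a member
    \<open>y c0 - y c\<close> is the norm of \<open>y c\<close>.\<close>
  define K where "K = (\<lambda>c. y c0 - y c) ` {c\<in>J. le' c0 c}"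
  have K0: "K \<noteq> {}" using c0 refl0 unfolding K_def by blast
  have Kle: "k \<le> y c0" if "k \<in> K" for k using that y(2) by (auto simp: K_def)
  have K: "0 \<le> k \<and> evaluation k \<le> evaluation (y c0)" if "k \<in> K" for k
    using that Kle[OF that] y(1) c0 by (auto simp: K_def evaluation_le_iff)
  have dirK: "\<exists>c\<in>K. a \<le> c \<and> b \<le> c" if "a \<in> K" "b \<in> K" for a b
  proof -
    obtain i j where ij: "i \<in> J" "j \<in> J" "le' c0 i" "le' c0 j" "a = y c0 - y i" "b = y c0 - y j"
      using \<open>a \<in> K\<close> \<open>b \<in> K\<close> unfolding K_def by blast
    obtain m where m: "m \<in> J" "le' i m" "le' j m" using up ij(1,2) by blast
    show ?thesis
    proof (intro bexI conjI)
      show "y c0 - y m \<in> K" unfolding K_def using m trans[OF c0 ij(1) m(1) ij(3) m(2)] by blast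
      show "a \<le> y c0 - y m" "b \<le> y c0 - y m"
        unfolding ij using y(1)[OF ij(1) m(1,2)] y(1)[OF ij(2) m(1,3)] by simp_all
    qed
  qed
  have yc0: "0 \<le> evaluation (y c0)" using y(2)[OF c0] by (simp add: evaluation_nonneg)
  obtain z where z: "\<And>k. k \<in> K \<Longrightarrow> k \<le> z" "\<And>e. 0 < e \<Longrightarrow> \<exists>k\<in>K. norm (z - k) < e"
    by (rule uo_dual_dominated_converges[OF ev yc0 K0 K dirK]) blast+
  have "z = y c0"
  proof (rule order.antisym)
    have "y c0 - z \<le> 0"
    proof (rule y(3))
      fix a assume a: "a \<in> J"
      then obtain c where c: "c \<in> J" "le' a c" "le' c0 c" using up c0 by blast
      then have "y c0 - y c \<le> z" by (intro z(1)) (auto simp: K_def)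
      then have "y c0 - z \<le> y c" by (simp add: algebra_simps)
      then show "y c0 - z \<le> y a" using y(1)[OF a c(1,2)] by (rule order.trans)
    qed
    then show "y c0 \<le> z" by simp
    show "z \<le> y c0"
    proof (rule le_if_norm_pprt_small)
      fix e :: real assume "0 < e"
      then obtain k where k: "k \<in> K" "norm (z - k) < e" using z(2) by blast
      have "pprt (z - y c0) \<le> pprt (z - k)" using Kle[OF k(1)] by (intro pprt_mono) simp
      then have "norm (pprt (z - y c0)) \<le> norm (pprt (z - k))" by (intro norm_mono_pos) simp_all
      then show "norm (pprt (z - y c0)) \<le> e" using norm_pprt_le[of "z - k"] k(2) by linarith
    qed
  qed
  show "((\<lambda>a. norm (x a)) \<longlongrightarrow> 0) (tails I le)"
  proof (rule tendstoI)
    fix e :: real assume "0 < e"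
    then obtain c where c: "c \<in> J" "norm (y c) < e"
      using z(2)[of e] unfolding \<open>z = y c0\<close> K_def by auto
    obtain a where a: "a \<in> I" "\<And>b. b \<in> I \<Longrightarrow> le a b \<Longrightarrow> \<bar>x b - 0\<bar> \<le> y c" using J(3)[OF c(1)] by blast
    have "dist (norm (x b)) 0 < e" if "b \<in> I" "le a b" for b
      using norm_mono_pos[OF abs_ge_zero, of "x b" "y c"] a(2)[OF that] c(2) by (simp add: norm_abs)
    then show "\<forall>\<^sub>F a in tails I le. dist (norm (x a)) 0 < e"
      unfolding eventually_tails[OF dirI] using a(1) by blast
  qed
qed

section \<open>Order continuous functionals on the dual\<close>

text \<open>Split \<open>f\<close> into \<open>f - g\<close> and \<open>g\<close>, where
  \<open>g\<close> acts as the part of \<open>f\<close> on which \<open>y\<close> exceeds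
  \<open>x\<close>. The supremum is then tested as \<open>x\<close> by the first piece and as
  \<open>y\<close> by the second. This makes the set of positive elements below \<open>F\<close>
  upward directed.\<close>

lemma evaluation_sup_le:
  fixes F :: "'x::banach_lattice dual dual"
  assumes "evaluation x \<le> F" "evaluation y \<le> F"
  shows "evaluation (sup x y) \<le> F"
  unfolding less_eq_dual_def[of "evaluation _"] dual_apply_evaluation
proof (intro allI impI)
  fix f :: "'x dual" assume f: "0 \<le> f"
  obtain g where g: "0 \<le> g" "g \<le> f" "dual_apply g (y - x) = dual_apply f (pprt (y - x))"
    by (rule positive_part_functional[OF f])
  have le: "dual_apply k x \<le> dual_apply F k" "dual_apply k y \<le> dual_apply F k" if "0 \<le> k" for k
    using assms that unfolding less_eq_dual_def[of "evaluation _"] dual_apply_evaluation by blast+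
  have "sup x y = x + pprt (y - x)"
    unfolding pprt_def by (simp add: add_sup_distrib_left sup_commute)
  then have "dual_apply f (sup x y) = dual_apply (f - g) x + dual_apply g y"
    using g(3) by (simp add: dual_apply_right)
  also have "\<dots> \<le> dual_apply F (f - g) + dual_apply F g" 
    by (rule add_mono[OF le(1) le(2)]) (use g in simp_all)
  also have "\<dots> = dual_apply F f" by (simp add: dual_apply_right)
  finally show "dual_apply f (sup x y) \<le> dual_apply F f" .
qed

lemma uo_dual_order_cont:
  fixes F :: "'z::banach_lattice dual"
  assumes F: "dual_apply F \<in> uo_dual" "0 \<le> F"
  shows "order_cont F"
  unfolding order_cont_def
proof (intro conjI allI impI)
  fix D and m :: 'z and e :: real
  assume D: "down_directed D" "is_glb D m" and e: "0 < e"
  obtain d0 where d0: "d0 \<in> D" using D(1) unfolding down_directed_def by blast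
  \<comment> \<open>Cutting \<open>D\<close> off at \<open>d0\<close> keeps the infimum and makes
    the net \<open>d - m\<close> norm bounded, as \<open>uo_dual\<close> demands.\<close>
  define I where "I = {d\<in>D. d \<le> d0}"
  define le :: "'z \<Rightarrow> 'z \<Rightarrow> bool" where "le a b \<longleftrightarrow> b \<le> a" for a b
  have lower: "m \<le> d" if "d \<in> D" for d using D(2) that unfolding is_glb_def by blast
  have down: "\<exists>c\<in>I. c \<le> a \<and> c \<le> b" if "a \<in> D" "b \<in> I" for a b
  proof -
    have b: "b \<in> D" "b \<le> d0" using that(2) by (simp_all add: I_def)
    obtain c where c: "c \<in> D" "c \<le> a" "c \<le> b"
      using D(1) \<open>a \<in> D\<close> b(1) unfolding down_directed_def by meson
    have "c \<in> I" using c(1) order.trans[OF c(3) b(2)] by (simp add: I_def)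
    then show ?thesis using c(2,3) by meson
  qed
  have dir: "directed_set I le"
    unfolding directed_set_def
  proof (intro conjI ballI impI)
    show "I \<noteq> {}" using d0 unfolding I_def by blast
    show "\<exists>c\<in>I. le a c \<and> le b c" if "a \<in> I" "b \<in> I" for a b
      unfolding le_def using down[of a b] that by (auto simp: I_def)
  qed (auto simp: le_def)
  have dec: "decreases_to_zero I le (\<lambda>d. d - m)"
    unfolding decreases_to_zero_def
  proof (intro conjI ballI allI impI)
    fix z assume z: "\<forall>a\<in>I. z \<le> a - m"
    have "z + m \<le> d" if d: "d \<in> D" for d
    proof -
      have "d0 \<in> I" using d0 by (simp add: I_def)
      then obtain c where c: "c \<in> I" "c \<le> d" using down[OF d] by meson
      then have "z + m \<le> c" using z by (simp add: algebra_simps)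
      then show ?thesis using c(2) by simp
    qed
    then have "z + m \<le> m" using D(2) unfolding is_glb_def by blast
    then show "z \<le> 0" by simp
  qed (auto simp: le_def I_def lower)
  have "order_converges I le (\<lambda>d. d - m) 0"
  proof (rule order_convergesI[OF dir dec])
    fix c assume c: "c \<in> I"
    have "\<bar>b - m - 0\<bar> \<le> c - m" if "b \<in> I" "le c b" for b
      using that lower unfolding I_def le_def by simp
    then show "\<exists>a\<in>I. \<forall>b\<in>I. le a b \<longrightarrow> \<bar>b - m - 0\<bar> \<le> c - m" using c by blast
  qed
  then have uo: "uo_converges I le (\<lambda>d. d - m) 0" by (rule order_converges_imp_uo_converges)
  have bd: "norm (d - m) \<le> norm (d0 - m)" if "d \<in> I" for d
    using that lower unfolding I_def by (intro norm_mono_pos) simp_all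
  have "((\<lambda>d. dual_apply F (d - m)) \<longlongrightarrow> 0) (tails I le)" by (rule uo_dualD[OF F(1) dir bd uo])
  then have "\<forall>\<^sub>F d in tails I le. dist (dual_apply F (d - m)) 0 < e" using e by (rule tendstoD)
  then obtain a where "a \<in> I" "dist (dual_apply F (a - m)) 0 < e"
    unfolding eventually_tails[OF dir] by (auto simp: le_def)
  then show "\<exists>d\<in>D. dual_apply F d < dual_apply F m + e"
    by (intro bexI[of _ a]) (auto simp: I_def dual_apply_right)
qed (rule F(2))

text \<open>The elements of \<open>{0..e}\<close> with full value are closed under infima, by
  \<open>F (sup a b) + F (inf a b) = F a + F b\<close> and \<open>F (sup a b) \<le> F e\<close>.
  Order continuity keeps the full value at their infimum.\<close>

lemma order_cont_carrier:
  fixes F :: "'z::banach_lattice dual"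
  assumes dc: "dedekind_complete TYPE('z)" and F: "order_cont F" and e: "0 \<le> e"
  obtains u where "0 \<le> u" "u \<le> e" "dual_apply F u = dual_apply F e"
    "\<And>v. 0 \<le> v \<Longrightarrow> v \<le> e \<Longrightarrow> dual_apply F v = dual_apply F e \<Longrightarrow> u \<le> v"
proof -
  have F0: "0 \<le> F" using F unfolding order_cont_def by blast
  define D where "D = {v. 0 \<le> v \<and> v \<le> e \<and> dual_apply F v = dual_apply F e}"
  have D: "down_directed D"
    unfolding down_directed_def
  proof (intro conjI ballI)
    show "D \<noteq> {}" using e unfolding D_def by blast
    fix a b assume ab: "a \<in> D" "b \<in> D"
    have "dual_apply F (sup a b) \<le> dual_apply F e"
      by (rule dual_apply_mono[OF F0]) (use ab in \<open>simp add: D_def\<close>)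
    moreover have "dual_apply F a + dual_apply F b = dual_apply F (sup a b) + dual_apply F (inf a b)"
      by (metis add_eq_inf_sup dual_apply_right(1))
    moreover have "dual_apply F (inf a b) \<le> dual_apply F a" by (rule dual_apply_mono[OF F0]) simp
    ultimately have "inf a b \<in> D" using ab by (simp add: D_def le_infI1)
    then show "\<exists>c\<in>D. c \<le> a \<and> c \<le> b" by (intro bexI[of _ "inf a b"]) simp_all
  qed
  have "\<forall>d\<in>D. 0 \<le> d" by (simp add: D_def)
  then obtain u where u: "is_glb D u" using dc D unfolding dedekind_complete_def by blast
  have "0 \<le> u" using u unfolding is_glb_def D_def by blast
  moreover have "e \<in> D" using e by (simp add: D_def)
  then have "u \<le> e" using u unfolding is_glb_def by blast
  moreover have "dual_apply F e \<le> dual_apply F u"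
    by (rule order_cont_inf_le[OF F D u]) (simp add: D_def)
  then have "dual_apply F u = dual_apply F e" using dual_apply_mono[OF F0 \<open>u \<le> e\<close>] by simp
  moreover have "u \<le> v" if "0 \<le> v" "v \<le> e" "dual_apply F v = dual_apply F e" for v
    using u that unfolding is_glb_def D_def by blast
  ultimately show thesis by (rule that)
qed

lemma dual_eq_0_if_pos:
  fixes F :: "'z::banach_lattice dual"
  assumes "0 \<le> F" "\<And>x. 0 \<le> x \<Longrightarrow> dual_apply F x \<le> 0"
  shows "F = 0"
  by (rule dual_mono_ext) (use assms dual_apply_nonneg order.antisym in fastforce)

text \<open>If \<open>F\<close> were disjoint from every evaluation, each \<open>x \<ge> 0\<close>
  would admit a part of \<open>f\<close> that carries all of \<open>F\<close> and vanishes at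
  \<open>x\<close>. The smallest carrier lies below all these parts, so it is zero, against
  \<open>F f > 0\<close>.\<close>

lemma order_cont_not_disjoint:
  fixes F :: "'x::banach_lattice dual dual"
  assumes F: "order_cont F" "F \<noteq> 0"
  shows "\<exists>x\<ge>0. inf F (evaluation x) \<noteq> 0"
proof (rule ccontr)
  assume contra: "\<not> ?thesis"
  have disj: "inf F (evaluation x) = 0" if "0 \<le> x" for x using contra that by blast
  have F0: "0 \<le> F" using F(1) unfolding order_cont_def by blast
  obtain f where f: "0 \<le> f" "0 < dual_apply F f"
    using dual_eq_0_if_pos[OF F0] F(2) by (meson not_less)
  obtain u where u: "0 \<le> u" "u \<le> f" "dual_apply F u = dual_apply F f"
    "\<And>v. 0 \<le> v \<Longrightarrow> v \<le> f \<Longrightarrow> dual_apply F v = dual_apply F f \<Longrightarrow> u \<le> v"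
    by (rule order_cont_carrier[OF dedekind_complete_dual F(1) f(1)]) blast
  have "u = 0"
  proof (rule dual_eq_0_if_pos[OF u(1)])
    fix x :: 'x assume x: "0 \<le> x"
    obtain v where v: "0 \<le> v" "v \<le> f" "dual_apply F v = dual_apply F f" "dual_apply (evaluation x) v = 0"
      by (rule Hahn_decomposition[OF dedekind_complete_dual F(1) order_cont_evaluation[OF x] disj[OF x] f(1)])
    then have "u \<le> v" by (intro u(4))
    then show "dual_apply u x \<le> 0" using v(4) x unfolding less_eq_dual_def dual_apply_evaluation by force
  qed
  then show False using u(3) f(2) by (simp add: dual_apply_right)
qed

text \<open>The element \<open>d\<close> stands for the part of \<open>f\<close> outside the band of
  \<open>a\<close>. If \<open>z\<close> is below \<open>d\<close> and \<open>a\<close>, then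
  \<open>n z \<le> f\<close> implies \<open>z \<le> pprt (f - n a) \<le> f - n z\<close>, so all
  multiples of \<open>z\<close> stay below \<open>f\<close>.\<close>

lemma inf_pprt_diff_multiples:
  fixes f a d :: "'x::banach_lattice"
  assumes f: "0 \<le> f" and d: "0 \<le> d" "\<And>n. d \<le> pprt (f - real n *\<^sub>R a)" and z: "0 \<le> z" "z \<le> d" "z \<le> a"
  shows "z = 0"
proof (rule order.antisym[OF _ z(1)])
  show "z \<le> 0"
  proof (rule archimedean_le_0)
    show "real n *\<^sub>R z \<le> f" for n
    proof (induction n)
      case (Suc n)
      have "f - real n *\<^sub>R a \<le> f - real n *\<^sub>R z" using z(3) by (simp add: scaleR_left_mono)
      then have "pprt (f - real n *\<^sub>R a) \<le> pprt (f - real n *\<^sub>R z)" by (rule pprt_mono)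
      also have "\<dots> = f - real n *\<^sub>R z" using Suc by simp
      finally have "z \<le> f - real n *\<^sub>R z" using d(2)[of n] z(2) by (meson order.trans)
      then show ?case by (simp add: algebra_simps)
    qed (use f in simp)
  qed
qed

text \<open>Where \<open>F \<ge> c x\<close> holds on the functionals below \<open>f\<close>, the smallest component of \<open>x\<close>
  carrying \<open>f\<close> is annihilated by all functionals disjoint from \<open>f\<close>, so that \<open>c\<close> times this
  component lies below \<open>F\<close> everywhere.\<close>

lemma order_cont_dominates_evaluation:
  fixes F :: "'x::banach_lattice dual dual"
  assumes oc: "order_continuous TYPE('x)" and F: "order_cont F" "F \<noteq> 0"
  obtains y where "0 \<le> y" "y \<noteq> 0" "evaluation y \<le> F"
proof -
  have dc: "dedekind_complete TYPE('x)" by (rule order_continuous_dedekind_complete[OF oc])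
  have F0: "0 \<le> F" using F(1) unfolding order_cont_def by blast
  obtain x where x: "0 \<le> x" "inf F (evaluation x) \<noteq> 0" using order_cont_not_disjoint[OF F] by blast
  \<comment> \<open>Passing from \<open>F\<close> to \<open>G \<le> evaluation x\<close> ensures
    that a functional on which \<open>G\<close> is positive is also positive at \<open>x\<close>;
    this makes the final \<open>y\<close> nonzero.\<close>
  define G where "G = inf F (evaluation x)"
  have ex0: "0 \<le> evaluation x" using x(1) by (simp add: evaluation_nonneg)
  have G: "0 \<le> G" "G \<le> F" "G \<le> evaluation x" using F0 ex0 by (simp_all add: G_def)
  have ocG: "order_cont G" by (rule order_cont_dominated[OF F(1) G(1,2)])
  have Gx: "dual_apply G f \<le> dual_apply f x" if "0 \<le> f" for f
    using G(3) that unfolding less_eq_dual_def[of G] dual_apply_evaluation by blast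
  obtain f0 where f0: "0 \<le> f0" "0 < dual_apply G f0"
    using dual_eq_0_if_pos[OF G(1)] x(2) unfolding G_def by (meson not_less)
  \<comment> \<open>The added \<open>1\<close> prevents division by zero and makes
    \<open>c f0(x) < G f0\<close> strict, so \<open>W\<close> is positive at
    \<open>f0\<close>.\<close>
  define c where "c = dual_apply G f0 / (dual_apply f0 x + 1)"
  have f0x: "0 \<le> dual_apply f0 x" by (rule dual_apply_nonneg[OF f0(1) x(1)])
  have c: "0 < c" "c * dual_apply f0 x < dual_apply G f0"
    using f0(2) f0x by (simp_all add: c_def field_simps add_nonneg_pos)
  define W where "W = G - c *\<^sub>R evaluation x"
  have cx: "0 \<le> c *\<^sub>R x" using c(1) x(1) by (simp add: scaleR_nonneg_nonneg)
  have cex: "c *\<^sub>R evaluation x = evaluation (c *\<^sub>R x)" by (simp add: evaluation_simps)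
  have W_apply: "dual_apply W f = dual_apply G f - c * dual_apply f x" for f
    by (simp add: W_def dual_apply_evaluation)
  have "pprt W \<le> G"
    by (rule pprt_least) (use cx G(1) in \<open>simp_all add: W_def cex evaluation_nonneg\<close>)
  then have ocP: "order_cont (pprt W)" and PG: "dual_apply (pprt W) f \<le> dual_apply G f" if "0 \<le> f" for f
    using order_cont_dominated[OF ocG zero_le_pprt] that unfolding less_eq_dual_def[of _ G] by blast+
  have "pprt (- W) \<le> evaluation (c *\<^sub>R x)"
    by (rule pprt_least) (use cx G(1) in \<open>simp_all add: W_def cex evaluation_nonneg\<close>)
  then have ocN: "order_cont (pprt (- W))"
    by (rule order_cont_dominated[OF order_cont_evaluation[OF cx] zero_le_pprt])
  \<comment> \<open>In Radon-Nikodym terms \<open>f\<close> is the part of \<open>f0\<close> on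
    which the density of \<open>G\<close> with respect to \<open>x\<close> is at least
    \<open>c\<close>. It retains all of \<open>pprt W\<close>, hence is nonzero.\<close>
  obtain f where f: "0 \<le> f" "f \<le> f0" "dual_apply (pprt W) f = dual_apply (pprt W) f0"
    "dual_apply (pprt (- W)) f = 0"
    by (rule Hahn_decomposition[OF dedekind_complete_dual ocP[OF order.refl] ocN inf_pprt_pprt_minus f0(1)])
  have "0 < dual_apply W f0" using c(2) by (simp add: W_apply)
  also have "\<dots> \<le> dual_apply (pprt W) f0"
    using le_pprt[of W] f0(1) unfolding less_eq_dual_def[of W] by blast
  also have "\<dots> = dual_apply (pprt W) f" using f(3) by simp
  also have "\<dots> \<le> dual_apply G f" by (rule PG[OF f(1)])
  also have "\<dots> \<le> dual_apply f x" by (rule Gx[OF f(1)])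
  finally have fx: "0 < dual_apply f x" .
  have below: "c * dual_apply g x \<le> dual_apply G g" if g: "0 \<le> g" "g \<le> real n *\<^sub>R f" for g n
  proof -
    have "dual_apply (- W) g \<le> dual_apply (pprt (- W)) g"
      using le_pprt[of "- W"] g(1) unfolding less_eq_dual_def[of "- W"] by blast
    also have "\<dots> \<le> dual_apply (pprt (- W)) (real n *\<^sub>R f)" by (rule dual_apply_mono[OF zero_le_pprt g(2)])
    also have "\<dots> = 0" using f(4) by (simp add: dual_apply_right)
    finally show ?thesis by (simp add: W_apply)
  qed
  have ocf: "order_cont f" by (rule order_continuous_order_cont[OF oc f(1)])
  obtain y where y: "0 \<le> y" "y \<le> x" "dual_apply f y = dual_apply f x"
    "\<And>v. 0 \<le> v \<Longrightarrow> v \<le> x \<Longrightarrow> dual_apply f v = dual_apply f x \<Longrightarrow> y \<le> v"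
    by (rule order_cont_carrier[OF dc ocf x(1)]) blast
  have "evaluation (c *\<^sub>R y) \<le> G"
    unfolding less_eq_dual_def[of "evaluation _"] dual_apply_evaluation
  proof (intro allI impI)
    fix g :: "'x dual" assume g: "0 \<le> g"
    \<comment> \<open>For each \<open>n\<close>, \<open>g\<close> is the sum of
      \<open>inf g (n f)\<close> and \<open>r n\<close>. The first summand satisfies the estimate
      \<open>below\<close>; the infimum \<open>d\<close> of the second is disjoint from
      \<open>f\<close> and so vanishes at \<open>y\<close>.\<close>
    define r where "r n = pprt (g - real n *\<^sub>R f)" for n
    have r_mono: "r n \<le> r m" if "m \<le> n" for m n
      unfolding r_def using that f(1) by (intro pprt_mono diff_mono scaleR_right_mono) simp_all
    have D: "down_directed (range r)"
      unfolding down_directed_def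
    proof (intro conjI ballI)
      fix a b assume "a \<in> range r" "b \<in> range r"
      then obtain i j where "a = r i" "b = r j" by blast
      then show "\<exists>c\<in>range r. c \<le> a \<and> c \<le> b"
        using r_mono[of i "max i j"] r_mono[of j "max i j"] by (intro bexI[of _ "r (max i j)"]) auto
    qed simp
    have r0: "0 \<le> a" if "a \<in> range r" for a using that by (auto simp: r_def)
    obtain d where d: "is_glb (range r) d" using dual_glb[OF D r0] by blast
    have d0: "0 \<le> d" using d r0 unfolding is_glb_def by blast
    have dr: "d \<le> r n" for n using d unfolding is_glb_def by blast
    have "inf f d = 0"
      by (rule inf_pprt_diff_multiples[OF g d0, of f]) (use dr d0 f(1) in \<open>simp_all add: r_def\<close>)
    then obtain v where v: "0 \<le> v" "v \<le> x" "dual_apply f v = dual_apply f x" "dual_apply d v = 0"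
      using Hahn_decomposition[OF dc ocf order_continuous_order_cont[OF oc d0] _ x(1)] by blast
    have "dual_apply d y \<le> dual_apply d v" by (rule dual_apply_mono[OF d0 y(4)[OF v(1-3)]])
    then have dy: "dual_apply d y \<le> 0" using v(4) by simp
    show "dual_apply g (c *\<^sub>R y) \<le> dual_apply G g"
    proof (rule field_le_epsilon)
      fix e :: real assume "0 < e"
      then obtain n where n: "dual_apply (r n) y < dual_apply d y + e / c"
        using order_contD[OF order_cont_evaluation[OF y(1)] D d, of "e / c"] c(1)
        by (auto simp: dual_apply_evaluation)
      have "c * dual_apply (r n) y < c * (e / c)"
        by (rule mult_strict_left_mono[OF _ c(1)]) (use n dy in linarith)
      then have rn: "c * dual_apply (r n) y < e" using c(1) by simp
      define k where "k = inf g (real n *\<^sub>R f)"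
      have k: "0 \<le> k" "k \<le> real n *\<^sub>R f" "k \<le> g"
        using g f(1) by (simp_all add: k_def scaleR_nonneg_nonneg)
      have "c * dual_apply k y \<le> c * dual_apply k x"
        using dual_apply_mono[OF k(1) y(2)] c(1) by simp
      also have "\<dots> \<le> dual_apply G k" by (rule below[OF k(1,2)])
      also have "\<dots> \<le> dual_apply G g" by (rule dual_apply_mono[OF G(1) k(3)])
      finally have ck: "c * dual_apply k y \<le> dual_apply G g" .
      have "dual_apply g y = dual_apply k y + dual_apply (r n) y"
        unfolding k_def r_def by (metis dual_apply_left(1) inf_plus_pprt)
      then have "dual_apply g (c *\<^sub>R y) = c * dual_apply k y + c * dual_apply (r n) y"
        by (simp add: dual_apply_right algebra_simps)
      then show "dual_apply g (c *\<^sub>R y) \<le> dual_apply G g + e" using ck rn by linarith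
    qed
  qed
  then have "evaluation (c *\<^sub>R y) \<le> F" using G(2) by (rule order.trans)
  moreover have "y \<noteq> 0" using y(3) fx by (auto simp: dual_apply_right)
  ultimately show thesis using that[of "c *\<^sub>R y"] c(1) y(1) by (simp add: scaleR_nonneg_nonneg)
qed

lemma uo_dual_pos_eq_evaluation:
  fixes F :: "'x::banach_lattice dual dual"
  assumes oc: "order_continuous TYPE('x)" and F: "dual_apply F \<in> uo_dual" "0 \<le> F"
  obtains y where "F = evaluation y"
proof -
  define K where "K = {k. 0 \<le> k \<and> evaluation k \<le> F}"
  have z: "0 \<in> K" using F(2) by (simp add: K_def evaluation_simps)
  have dir: "\<exists>c\<in>K. a \<le> c \<and> b \<le> c" if "a \<in> K" "b \<in> K" for a b
    by (rule bexI[of _ "sup a b"]) (use that in \<open>auto simp: K_def evaluation_sup_le le_supI1\<close>)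
  have K: "K \<noteq> {}" "0 \<le> k \<and> evaluation k \<le> F" if "k \<in> K" for k using z that by (auto simp: K_def)
  obtain y where y: "\<And>k. k \<in> K \<Longrightarrow> k \<le> y" "\<And>e. 0 < e \<Longrightarrow> \<exists>k\<in>K. norm (y - k) < e"
    by (rule uo_dual_dominated_converges[OF F K(1)[OF z] K(2) dir]) blast+
  have yF: "evaluation y \<le> F"
    unfolding less_eq_dual_def[of "evaluation _"] dual_apply_evaluation
  proof (intro allI impI)
    fix f :: "'x dual" assume f: "0 \<le> f"
    show "dual_apply f y \<le> dual_apply F f"
    proof (rule field_le_epsilon)
      fix e :: real assume e: "0 < e"
      have n: "0 < norm f + 1" by (simp add: add_nonneg_pos)
      then obtain k where k: "k \<in> K" "norm (y - k) < e / (norm f + 1)" using y(2) e by (meson divide_pos_pos)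
      have "dual_apply f (y - k) \<le> norm f * norm (y - k)" using norm_dual_bound[of f "y - k"] by simp
      also have "\<dots> \<le> (norm f + 1) * norm (y - k)" by (rule mult_right_mono) simp_all
      also have "\<dots> < e" using k(2) n by (simp add: field_simps)
      finally have "dual_apply f y < dual_apply f k + e" by (simp add: dual_apply_right)
      moreover have "dual_apply f k \<le> dual_apply F f"
        using K(2)[OF k(1)] f unfolding less_eq_dual_def[of "evaluation _"] dual_apply_evaluation by blast
      ultimately show "dual_apply f y \<le> dual_apply F f + e" by simp
    qed
  qed
  have y0: "0 \<le> y" by (rule y(1)[OF z])
  have "F - evaluation y = 0"
  proof (rule ccontr)
    \<comment> \<open>A nonzero remainder would dominate some \<open>w > 0\<close> in the space;
      then \<open>y + w\<close> belongs to \<open>K\<close>, although \<open>y\<close> is an upper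
      bound of \<open>K\<close>.\<close>
    assume ne: "F - evaluation y \<noteq> 0"
    have "order_cont (F - evaluation y)"
      by (rule order_cont_dominated[OF uo_dual_order_cont[OF F]]) (use yF y0 in \<open>simp_all add: evaluation_nonneg\<close>)
    then obtain w where w: "0 \<le> w" "w \<noteq> 0" "evaluation w \<le> F - evaluation y"
      using order_cont_dominates_evaluation[OF oc _ ne] by blast
    then have "y + w \<in> K" using y0 by (simp add: K_def evaluation_simps algebra_simps)
    then have "w \<le> 0" using y(1) by fastforce
    then show False using w by simp
  qed
  then show thesis using that[of y] by simp
qed

section \<open>Functionals on norm bounded uo-null nets\<close>

lemma unbounded_linear_sequence:
  fixes T :: "'z::real_normed_vector \<Rightarrow> 'w::real_normed_vector"
  assumes T: "linear T" and nb: "\<not> bounded_linear T"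
  obtains x where "\<And>n. norm (x n) \<le> (1/4)^n" "\<And>n :: nat. real n \<le> norm (T (x n))"
proof -
  have "\<exists>x. norm x \<le> (1/4)^n \<and> real n \<le> norm (T x)" for n :: nat
  proof (rule ccontr)
    assume no: "\<not> ?thesis"
    have "norm (T x) \<le> norm x * (4^n * real n)" for x
    proof (cases "x = 0")
      case False
      define r where "r = (1/4)^n / norm x"
      have r: "0 < r" using False by (simp add: r_def)
      have "norm (r *\<^sub>R x) \<le> (1/4)^n" using False by (simp add: r_def)
      then have "norm (T (r *\<^sub>R x)) < real n" using no by (meson not_le)
      then have "r * norm (T x) < real n" using r by (simp add: linear_scale[OF T])
      then show ?thesis using False by (simp add: r_def field_simps)
    qed (simp add: linear_0[OF T])
    then have "bounded_linear T"
      by (intro bounded_linear_intro) (use T in \<open>auto simp: linear_add linear_scale\<close>)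
    then show False using nb by blast
  qed
  then show thesis using that by metis
qed

text \<open>The bound \<open>(1/4)^n\<close> leaves room for weights \<open>2^n\<close>: the series
  of \<open>2^n \<bar>x n\<bar>\<close> still converges, and its sum is \<open>u\<close>. The
  sequence is therefore null relatively uniformly, not just in norm.\<close>

lemma rapidly_decreasing_dominated:
  fixes x :: "nat \<Rightarrow> 'z::banach_lattice"
  assumes x: "\<And>n. norm (x n) \<le> (1/4)^n"
  obtains u where "0 \<le> u" "\<And>n. \<bar>x n\<bar> \<le> (1/2)^n *\<^sub>R u"
proof -
  have "norm (4^n *\<^sub>R \<bar>x n\<bar>) \<le> 1" for n
    using x[of n] by (simp add: norm_abs power_divide field_simps)
  then have sm: "summable (\<lambda>n. (1/2)^n *\<^sub>R (4^n *\<^sub>R \<bar>x n\<bar>))" by (rule summable_scaleR_power)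
  have pos: "0 \<le> (1/2)^n *\<^sub>R (4^n *\<^sub>R \<bar>x n\<bar>)" for n by (simp add: scaleR_nonneg_nonneg)
  define u where "u = (\<Sum>n. (1/2)^n *\<^sub>R (4^n *\<^sub>R \<bar>x n\<bar>))"
  have le: "(1/2)^n *\<^sub>R (4^n *\<^sub>R \<bar>x n\<bar>) \<le> u" for n unfolding u_def by (rule term_le_suminf[OF sm pos])
  show thesis
  proof (rule that[of u])
    show "0 \<le> u" by (rule order.trans[OF pos le[of 0]])
    have four: "(4::real)^n = 2^n * 2^n" for n by (simp flip: power_mult_distrib)
    show "\<bar>x n\<bar> \<le> (1/2)^n *\<^sub>R u" for n
      using scaleR_left_mono[OF le[of n], of "(1/2)^n"] by (simp add: four power_divide)
  qed
qed

text \<open>An unbounded functional would be large on a sequence dominated by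
  \<open>(1/2)^n u\<close>. Such a sequence is norm bounded and order null, hence uo-null.\<close>

lemma uo_dual_bounded:
  fixes \<phi> :: "'z::banach_lattice \<Rightarrow> real"
  assumes \<phi>: "\<phi> \<in> uo_dual"
  obtains F where "\<phi> = dual_apply F"
proof -
  have "bounded_linear \<phi>"
  proof (rule ccontr)
    assume "\<not> bounded_linear \<phi>"
    then obtain x where x: "\<And>n. norm (x n) \<le> (1/4)^n" "\<And>n :: nat. real n \<le> norm (\<phi> (x n))"
      using unbounded_linear_sequence[OF uo_dual_linear[OF \<phi>]] by blast
    obtain u where u: "0 \<le> u" "\<And>n. \<bar>x n\<bar> \<le> (1/2)^n *\<^sub>R u"
      using rapidly_decreasing_dominated[OF x(1)] by blast
    have mono: "(1/2)^n *\<^sub>R u \<le> (1/2)^m *\<^sub>R u" if "m \<le> n" for m n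
      using that u(1) by (intro scaleR_right_mono power_decreasing) simp_all
    have "(\<lambda>n. (1/2)^n *\<^sub>R u) \<longlonglongrightarrow> 0 *\<^sub>R u" by (intro tendsto_intros LIMSEQ_realpow_zero) simp_all
    then have lim: "(\<lambda>n. (1/2)^n *\<^sub>R u) \<longlonglongrightarrow> 0" by simp
    have "order_converges UNIV (\<le>) x 0"
    proof (rule order_convergesI[OF directed_set_nat])
      show "decreases_to_zero UNIV (\<le>) (\<lambda>n. (1/2)^n *\<^sub>R u)"
        unfolding decreases_to_zero_def
      proof (intro conjI ballI allI impI)
        fix z assume "\<forall>n\<in>UNIV. z \<le> (1/2)^n *\<^sub>R u"
        then show "z \<le> 0" by (intro tendsto_ge_const[OF lim]) simp_all
      qed (use mono u(1) in \<open>simp_all add: scaleR_nonneg_nonneg\<close>)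
      have "\<bar>x b - 0\<bar> \<le> (1/2)^c *\<^sub>R u" if "c \<le> b" for b c
        using order.trans[OF u(2) mono[OF that]] by simp
      then show "\<exists>a\<in>UNIV. \<forall>b\<in>UNIV. a \<le> b \<longrightarrow> \<bar>x b - 0\<bar> \<le> (1/2)^c *\<^sub>R u" for c by blast
    qed
    then have uo: "uo_converges UNIV (\<le>) x 0" by (rule order_converges_imp_uo_converges)
    have "norm (x n) \<le> 1" for n using x(1)[of n] power_le_one[of "1/4::real" n] by simp
    then have "(\<lambda>n. \<phi> (x n)) \<longlonglongrightarrow> 0" by (rule uo_dual_LIMSEQ[OF \<phi> _ uo])
    then have "\<forall>\<^sub>F n in sequentially. norm (\<phi> (x n)) < 1" by (simp add: tendsto_iff)
    then obtain N where N: "\<And>n. n \<ge> N \<Longrightarrow> norm (\<phi> (x n)) < 1" unfolding eventually_sequentially by blast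
    have "1 \<le> real (Suc N)" by simp
    then show False using x(2)[of "Suc N"] N[of "Suc N"] by simp
  qed
  then have "dual_apply (dual_of_blinfun (Blinfun \<phi>)) = \<phi>"
    by (simp add: fun_eq_iff dual_apply.rep_eq dual_of_blinfun_inverse bounded_linear_Blinfun_apply)
  then show thesis using that by metis
qed

lemma uo_dual_uminus:
  assumes "dual_apply F \<in> uo_dual"
  shows "dual_apply (- F) \<in> uo_dual"
  unfolding uo_dual_def
proof (intro CollectI conjI allI impI)
  show "linear (dual_apply (- F))" by (rule linear_dual_apply)
  fix I :: "'a set set" and le and x :: "'a set \<Rightarrow> 'a"
  assume "directed_set I le" "\<exists>C. \<forall>a\<in>I. norm (x a) \<le> C" "uo_converges I le x 0"
  then have "((\<lambda>a. dual_apply F (x a)) \<longlongrightarrow> 0) (tails I le)"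
    using assms unfolding uo_dual_def by blast
  then show "((\<lambda>a. dual_apply (- F) (x a)) \<longlongrightarrow> 0) (tails I le)" using tendsto_minus by fastforce
qed

text \<open>By Riesz-Kantorovich, \<open>pprt F\<close> at \<open>\<bar>x a\<bar>\<close> is
  approximated by \<open>F (g a)\<close> with \<open>g a\<close> between \<open>0\<close> and
  \<open>\<bar>x a\<bar>\<close>. Such a net \<open>g\<close> is again norm bounded and
  uo-null.\<close>

lemma uo_dual_pprt:
  fixes F :: "'z::banach_lattice dual"
  assumes F: "dual_apply F \<in> uo_dual"
  shows "dual_apply (pprt F) \<in> uo_dual"
  unfolding uo_dual_def
proof (intro CollectI conjI allI impI)
  show "linear (dual_apply (pprt F))" by (rule linear_dual_apply)
  fix I :: "'z set set" and le and x :: "'z set \<Rightarrow> 'z"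
  assume dir: "directed_set I le" and "\<exists>C. \<forall>a\<in>I. norm (x a) \<le> C" and uo: "uo_converges I le x 0"
  then obtain C where C: "\<And>a. a \<in> I \<Longrightarrow> norm (x a) \<le> C" by blast
  show "((\<lambda>a. dual_apply (pprt F) (x a)) \<longlongrightarrow> 0) (tails I le)"
  proof (rule tendstoI)
    fix e :: real assume e: "0 < e"
    have "\<exists>g. 0 \<le> g \<and> g \<le> \<bar>x a\<bar> \<and> dual_apply (pprt F) \<bar>x a\<bar> - e / 2 < dual_apply F g" for a
      using pprt_dual_approx[of "\<bar>x a\<bar>" "dual_apply (pprt F) \<bar>x a\<bar> - e / 2" F] e by auto
    then obtain g where g: "\<And>a. 0 \<le> g a" "\<And>a. g a \<le> \<bar>x a\<bar>"
      "\<And>a. dual_apply (pprt F) \<bar>x a\<bar> - e / 2 < dual_apply F (g a)"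
      by metis
    have "norm (g a) \<le> C" if "a \<in> I" for a
      using norm_mono_pos[OF g(1,2)[of a]] C[OF that] by (simp add: norm_abs)
    moreover have "uo_converges I le g 0" by (rule uo_converges_dominated[OF uo]) (use g in simp)
    ultimately have "((\<lambda>a. dual_apply F (g a)) \<longlongrightarrow> 0) (tails I le)" using uo_dualD[OF F dir] by blast
    then have "\<forall>\<^sub>F a in tails I le. dist (dual_apply F (g a)) 0 < e / 2" by (rule tendstoD) (use e in simp)
    then show "\<forall>\<^sub>F a in tails I le. dist (dual_apply (pprt F) (x a)) 0 < e"
    proof (rule eventually_mono)
      fix a assume "dist (dual_apply F (g a)) 0 < e / 2"
      then have "dual_apply (pprt F) \<bar>x a\<bar> < e" using g(3)[of a] by simp
      moreover have "\<bar>dual_apply (pprt F) (x a)\<bar> \<le> dual_apply (pprt F) \<bar>x a\<bar>"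
        using abs_dual_apply_le[of "pprt F" "x a"] by simp
      ultimately show "dist (dual_apply (pprt F) (x a)) 0 < e" by simp
    qed
  qed
qed

lemma uo_dual_eq_evaluation:
  fixes \<phi> :: "'x::banach_lattice dual \<Rightarrow> real"
  assumes oc: "order_continuous TYPE('x)" and \<phi>: "\<phi> \<in> uo_dual"
  obtains x where "\<phi> = dual_apply (evaluation x)"
proof -
  obtain F where F: "\<phi> = dual_apply F" by (rule uo_dual_bounded[OF \<phi>])
  have uo: "dual_apply (pprt F) \<in> uo_dual" "dual_apply (pprt (- F)) \<in> uo_dual"
    using \<phi> uo_dual_pprt uo_dual_uminus unfolding F by blast+
  obtain y where "pprt F = evaluation y" by (rule uo_dual_pos_eq_evaluation[OF oc uo(1) zero_le_pprt])
  moreover obtain z where "pprt (- F) = evaluation z"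
    by (rule uo_dual_pos_eq_evaluation[OF oc uo(2) zero_le_pprt])
  ultimately have "F = evaluation (y - z)" using pprt_minus_swap[of F] by (simp add: evaluation_simps)
  then show thesis using that F by blast
qed

lemma range_evaluation_eq_uo_dual:
  assumes "order_continuous TYPE('x::banach_lattice)"
  shows "range (\<lambda>x :: 'x. dual_apply (evaluation x)) = uo_dual"
proof (intro equalityI subsetI)
  fix \<phi> :: "'x dual \<Rightarrow> real" assume "\<phi> \<in> uo_dual"
  then obtain x where "\<phi> = dual_apply (evaluation x)" by (rule uo_dual_eq_evaluation[OF assms])
  then show "\<phi> \<in> range (\<lambda>x :: 'x. dual_apply (evaluation x))" by blast
qed (use order_continuous_evaluation_uo_dual[OF assms] in blast)

section \<open>Lattice isomorphisms\<close>

lemma lattice_isomorphism_inv: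
  assumes "lattice_isomorphism T"
  shows "lattice_isomorphism (inv T)"
proof -
  have T: "linear T" "bij T" "\<And>x y. T (sup x y) = sup (T x) (T y)" "\<And>x y. T (inf x y) = inf (T x) (T y)"
    using assms unfolding lattice_isomorphism_def by blast+
  have inj: "inv T (T x) = x" for x using T(2) by (simp add: bij_is_inj)
  have surj: "T (inv T y) = y" for y using T(2) by (simp add: bij_is_surj surj_f_inv_f)
  have "linear (inv T)"
  proof (rule linearI)
    show "inv T (x + y) = inv T x + inv T y" for x y
      using inj[of "inv T x + inv T y"] by (simp add: linear_add[OF T(1)] surj)
    show "inv T (c *\<^sub>R x) = c *\<^sub>R inv T x" for c x
      using inj[of "c *\<^sub>R inv T x"] by (simp add: linear_scale[OF T(1)] surj)
  qed
  moreover have "inv T (sup x y) = sup (inv T x) (inv T y)" "inv T (inf x y) = inf (inv T x) (inv T y)" for x y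
    using inj[of "sup (inv T x) (inv T y)"] inj[of "inf (inv T x) (inv T y)"] by (simp_all add: T(3,4) surj)
  ultimately show ?thesis unfolding lattice_isomorphism_def using bij_imp_bij_inv[OF T(2)] by blast
qed

lemma lattice_isomorphism_comp:
  "lattice_isomorphism S \<Longrightarrow> lattice_isomorphism T \<Longrightarrow> lattice_isomorphism (S \<circ> T)"
  unfolding lattice_isomorphism_def by (simp add: linear_compose bij_comp)

lemma lattice_isomorphism_mono:
  assumes "lattice_isomorphism T" "x \<le> y"
  shows "T x \<le> T y"
  using assms unfolding lattice_isomorphism_def by (metis sup.orderE sup.orderI sup_commute)

lemma lattice_isomorphism_abs: "lattice_isomorphism T \<Longrightarrow> T \<bar>x\<bar> = \<bar>T x\<bar>"
  unfolding lattice_isomorphism_def by (simp add: abs_lattice linear_neg)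

text \<open>Automatic continuity of positive operators: an order bounded sequence has order bounded,
  hence norm bounded, images.\<close>

lemma lattice_isomorphism_bounded:
  fixes T :: "'z::banach_lattice \<Rightarrow> 'w::banach_lattice"
  assumes T: "lattice_isomorphism T"
  shows "bounded_linear T"
proof (rule ccontr)
  assume nb: "\<not> bounded_linear T"
  have lin: "linear T" using T unfolding lattice_isomorphism_def by blast
  obtain x where x: "\<And>n. norm (x n) \<le> (1/4)^n" "\<And>n :: nat. real n \<le> norm (T (x n))"
    using unbounded_linear_sequence[OF lin nb] by blast
  obtain u where u: "0 \<le> u" "\<And>n. \<bar>x n\<bar> \<le> (1/2)^n *\<^sub>R u"
    using rapidly_decreasing_dominated[OF x(1)] by blast
  have "norm (T (x n)) \<le> norm (T u)" for n
  proof (rule norm_mono_abs)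
    have "\<bar>x n\<bar> \<le> 1 *\<^sub>R u"
      by (rule order.trans[OF u(2) scaleR_right_mono[OF _ u(1)]]) (simp add: power_le_one)
    then have "T \<bar>x n\<bar> \<le> T u" by (intro lattice_isomorphism_mono[OF T]) simp
    then show "\<bar>T (x n)\<bar> \<le> \<bar>T u\<bar>"
      unfolding lattice_isomorphism_abs[OF T] using abs_ge_self order.trans by blast
  qed
  moreover obtain n where "norm (T u) < real n" using reals_Archimedean2 by blast
  ultimately show False using x(2)[of n] by (meson less_le_trans not_less)
qed

text \<open>Norm boundedness of the image net is automatic continuity. For uo-convergence, test
  elements and lower bounds are pulled back through \<open>inv S\<close>; surjectivity is what makes
  images of decreasing nets have infimum zero.\<close>

lemma uo_dual_comp_lattice_isomorphism:
  fixes S :: "'z::banach_lattice \<Rightarrow> 'w::banach_lattice"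
  assumes S: "lattice_isomorphism S" and \<phi>: "\<phi> \<in> uo_dual"
  shows "\<phi> \<circ> S \<in> uo_dual"
  unfolding uo_dual_def
proof (intro CollectI conjI allI impI)
  have lin: "linear S" and bij: "bij S" and inf: "\<And>x y. S (inf x y) = inf (S x) (S y)"
    using S unfolding lattice_isomorphism_def by blast+
  show "linear (\<phi> \<circ> S)" by (rule linear_compose[OF lin uo_dual_linear[OF \<phi>]])
  have surj: "S (inv S y) = y" for y using bij by (simp add: bij_is_surj surj_f_inv_f)
  fix I :: "'z set set" and le and x :: "'z set \<Rightarrow> 'z"
  assume dir: "directed_set I le" and "\<exists>C. \<forall>a\<in>I. norm (x a) \<le> C" and uo: "uo_converges I le x 0"
  then obtain C where C: "\<And>a. a \<in> I \<Longrightarrow> norm (x a) \<le> C" by blast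
  obtain K where K: "\<And>x. norm (S x) \<le> norm x * K" "0 < K"
    using bounded_linear.pos_bounded[OF lattice_isomorphism_bounded[OF S]] by blast
  have bd: "norm (S (x a)) \<le> C * K" if "a \<in> I" for a
    by (rule order.trans[OF K(1)]) (use C[OF that] K(2) in simp)
  have "uo_converges I le (\<lambda>a. S (x a)) 0"
    unfolding uo_converges_def
  proof (intro allI impI)
    fix h :: 'w assume h: "0 \<le> h"
    define k where "k = inv S h"
    have k: "S k = h" by (simp add: k_def surj)
    have "inv S 0 \<le> inv S h" by (rule lattice_isomorphism_mono[OF lattice_isomorphism_inv[OF S] h])
    moreover have "inv S 0 = 0"
      using lattice_isomorphism_inv[OF S] unfolding lattice_isomorphism_def by (blast intro: linear_0)
    ultimately have "0 \<le> k" by (simp add: k_def)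
    then have "order_converges I le (\<lambda>a. inf \<bar>x a - 0\<bar> k) 0" using uo unfolding uo_converges_def by blast
    then obtain J :: "'z set" and le' and y :: "'z \<Rightarrow> 'z" where J: "directed_set J le'" "decreases_to_zero J le' y"
      "\<And>c. c \<in> J \<Longrightarrow> \<exists>a\<in>I. \<forall>b\<in>I. le a b \<longrightarrow> \<bar>inf \<bar>x b - 0\<bar> k - 0\<bar> \<le> y c"
      unfolding order_converges_def by blast
    show "order_converges I le (\<lambda>a. inf \<bar>S (x a) - 0\<bar> h) 0"
    proof (rule order_convergesI[OF J(1)])
      show "decreases_to_zero J le' (\<lambda>c. S (y c))"
        unfolding decreases_to_zero_def
      proof (intro conjI ballI allI impI)
        show "S (y b) \<le> S (y a)" if "a \<in> J" "b \<in> J" "le' a b" for a b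
          by (rule lattice_isomorphism_mono[OF S]) (use J(2) that in \<open>simp add: decreases_to_zero_def\<close>)
        show "0 \<le> S (y a)" if "a \<in> J" for a
          using lattice_isomorphism_mono[OF S, of 0 "y a"] J(2) that
          by (simp add: decreases_to_zero_def linear_0[OF lin])
        fix z assume z: "\<forall>a\<in>J. z \<le> S (y a)"
        have "inv S z \<le> y a" if "a \<in> J" for a
        proof -
          have "inv S z \<le> inv S (S (y a))"
            by (rule lattice_isomorphism_mono[OF lattice_isomorphism_inv[OF S]]) (use z that in blast)
          then show ?thesis using bij by (simp add: bij_is_inj)
        qed
        then have "inv S z \<le> 0" using J(2) unfolding decreases_to_zero_def by blast
        then have "S (inv S z) \<le> S 0" by (rule lattice_isomorphism_mono[OF S])
        then show "z \<le> 0" by (simp add: surj linear_0[OF lin])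
      qed
      fix c assume "c \<in> J"
      then obtain a where a: "a \<in> I" "\<And>b. b \<in> I \<Longrightarrow> le a b \<Longrightarrow> \<bar>inf \<bar>x b - 0\<bar> k - 0\<bar> \<le> y c"
        using J(3) by blast
      have "\<bar>inf \<bar>S (x b) - 0\<bar> h - 0\<bar> \<le> S (y c)" if "b \<in> I" "le a b" for b
      proof -
        have "S \<bar>inf \<bar>x b - 0\<bar> k - 0\<bar> \<le> S (y c)" by (rule lattice_isomorphism_mono[OF S a(2)[OF that]])
        then show ?thesis by (simp add: lattice_isomorphism_abs[OF S] inf k)
      qed
      then show "\<exists>a\<in>I. \<forall>b\<in>I. le a b \<longrightarrow> \<bar>inf \<bar>S (x b) - 0\<bar> h - 0\<bar> \<le> S (y c)" using a(1) by blast
    qed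
  qed
  then show "((\<lambda>a. (\<phi> \<circ> S) (x a)) \<longlongrightarrow> 0) (tails I le)" using uo_dualD[OF \<phi> dir bd] by simp
qed

section \<open>Recovering the predual from the dual\<close>

lemma predual_map:
  fixes S :: "'b::banach_lattice dual \<Rightarrow> 'a::banach_lattice dual"
  assumes oc: "order_continuous TYPE('a)" "order_continuous TYPE('b)" and S: "lattice_isomorphism S"
  obtains R :: "'a \<Rightarrow> 'b" where "\<And>a g. dual_apply g (R a) = dual_apply (S g) a"
proof -
  have "\<exists>b. \<forall>g. dual_apply g b = dual_apply (S g) a" for a
  proof -
    \<comment> \<open>The map sought is the adjoint of \<open>S\<close> restricted to the space: it
      sends evaluations to members of \<open>uo_dual\<close>, and over an order continuous space
      these are evaluations again.\<close>
    have "dual_apply (evaluation a) \<circ> S \<in> uo_dual"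
      by (rule uo_dual_comp_lattice_isomorphism[OF S order_continuous_evaluation_uo_dual[OF oc(1)]])
    then obtain b where "dual_apply (evaluation a) \<circ> S = dual_apply (evaluation b)"
      by (rule uo_dual_eq_evaluation[OF oc(2)])
    then show ?thesis by (metis comp_apply dual_apply_evaluation)
  qed
  then show thesis using that by metis
qed

lemma eq_if_dual_apply_eq:
  fixes x y :: "'a::banach_lattice"
  assumes "\<And>f. dual_apply f x = dual_apply f y"
  shows "x = y"
  using assms by (intro order.antisym le_if_dual_apply_le) simp_all

lemma lattice_isomorphismI:
  fixes T :: "'z::vector_lattice \<Rightarrow> 'w::vector_lattice"
  assumes lin: "linear T" and inv: "\<And>x. T' (T x) = x" "\<And>y. T (T' y) = y"
    and mono: "\<And>x y. x \<le> y \<Longrightarrow> T x \<le> T y" "\<And>x y. x \<le> y \<Longrightarrow> T' x \<le> T' y"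
  shows "lattice_isomorphism T"
proof -
  have le: "T x \<le> y \<longleftrightarrow> x \<le> T' y" "y \<le> T x \<longleftrightarrow> T' y \<le> x" for x y
    using mono inv by metis+
  have "bij T" using inv by (metis bijI')
  moreover have "T (sup x y) = sup (T x) (T y)" for x y
  proof (rule order.antisym)
    have "x \<le> T' (sup (T x) (T y))" "y \<le> T' (sup (T x) (T y))" by (simp_all flip: le(1))
    then show "T (sup x y) \<le> sup (T x) (T y)" unfolding le(1) by simp
  qed (simp add: mono)
  moreover have "T (inf x y) = inf (T x) (T y)" for x y
  proof (rule order.antisym)
    have "T' (inf (T x) (T y)) \<le> x" "T' (inf (T x) (T y)) \<le> y" by (simp_all flip: le(2))
    then show "inf (T x) (T y) \<le> T (inf x y)" unfolding le(2) by simp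
  qed (simp add: mono)
  ultimately show ?thesis using lin unfolding lattice_isomorphism_def by blast
qed

text \<open>The restricted adjoints of \<open>S\<close> and \<open>inv S\<close> are mutually
  inverse and positive. Functionals separate points and determine the order, so all required
  identities can be tested on them.\<close>

lemma order_continuous_predual_unique:
  fixes S :: "'b::banach_lattice dual \<Rightarrow> 'a::banach_lattice dual"
  assumes oc: "order_continuous TYPE('a)" "order_continuous TYPE('b)" and S: "lattice_isomorphism S"
  shows "\<exists>T :: 'a \<Rightarrow> 'b. lattice_isomorphism T"
proof -
  have S': "lattice_isomorphism (inv S)" by (rule lattice_isomorphism_inv[OF S])
  have bij: "bij S" and lin: "linear S" "linear (inv S)"
    using S S' unfolding lattice_isomorphism_def by blast+
  obtain R :: "'a \<Rightarrow> 'b" where R: "\<And>a g. dual_apply g (R a) = dual_apply (S g) a"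
    by (rule predual_map[OF oc S]) blast
  obtain R' :: "'b \<Rightarrow> 'a" where R': "\<And>b f. dual_apply f (R' b) = dual_apply (inv S f) b"
    by (rule predual_map[OF oc(2,1) S']) blast
  have pos: "0 \<le> S g" if "0 \<le> g" for g
    using lattice_isomorphism_mono[OF S that] by (simp add: linear_0[OF lin(1)])
  have pos': "0 \<le> inv S f" if "0 \<le> f" for f
    using lattice_isomorphism_mono[OF S' that] by (simp add: linear_0[OF lin(2)])
  have "lattice_isomorphism R"
  proof (rule lattice_isomorphismI)
    show "linear R"
      by (rule linearI; rule eq_if_dual_apply_eq) (simp_all add: R dual_apply_right)
    show "R' (R a) = a" for a
      by (rule eq_if_dual_apply_eq) (use bij in \<open>simp add: R R' bij_is_surj surj_f_inv_f\<close>)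
    show "R (R' b) = b" for b
      by (rule eq_if_dual_apply_eq) (use bij in \<open>simp add: R R' bij_is_inj\<close>)
    show "R x \<le> R y" if "x \<le> y" for x y
      by (rule le_if_dual_apply_le) (use dual_apply_mono[OF pos that] in \<open>simp add: R\<close>)
    show "R' x \<le> R' y" if "x \<le> y" for x y
      by (rule le_if_dual_apply_le) (use dual_apply_mono[OF pos' that] in \<open>simp add: R'\<close>)
  qed
  then show ?thesis by blast
qed

theorem proposition2p6:
  shows "((range (\<lambda>x :: 'x::banach_lattice. dual_apply (evaluation x)) \<subseteq> uo_dual
             \<longleftrightarrow> order_continuous TYPE('x)) \<and>
          (order_continuous TYPE('x)
             \<longleftrightarrow> range (\<lambda>x :: 'x. dual_apply (evaluation x)) = uo_dual)) \<and>
         (order_continuous TYPE('a::banach_lattice) \<longrightarrow> order_continuous TYPE('b::banach_lattice) \<longrightarrow>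
            (\<exists>T :: 'a dual \<Rightarrow> 'y::banach_lattice. lattice_isomorphism T) \<longrightarrow>
            (\<exists>T :: 'b dual \<Rightarrow> 'y. lattice_isomorphism T) \<longrightarrow>
            (\<exists>T :: 'a \<Rightarrow> 'b. lattice_isomorphism T))"
proof (intro conjI impI)
  have "order_continuous TYPE('x)" if "range (\<lambda>x :: 'x. dual_apply (evaluation x)) \<subseteq> uo_dual"
    by (rule order_continuous_if_evaluation_uo_dual) (use that in blast)
  moreover have "range (\<lambda>x :: 'x. dual_apply (evaluation x)) = uo_dual" if "order_continuous TYPE('x)"
    by (rule range_evaluation_eq_uo_dual[OF that])
  ultimately show "range (\<lambda>x :: 'x. dual_apply (evaluation x)) \<subseteq> uo_dual \<longleftrightarrow> order_continuous TYPE('x)"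
    "order_continuous TYPE('x) \<longleftrightarrow> range (\<lambda>x :: 'x. dual_apply (evaluation x)) = uo_dual"
    by blast+
  assume oc: "order_continuous TYPE('a)" "order_continuous TYPE('b)"
  assume "\<exists>T :: 'a dual \<Rightarrow> 'y. lattice_isomorphism T" "\<exists>T :: 'b dual \<Rightarrow> 'y. lattice_isomorphism T"
  then obtain T1 :: "'a dual \<Rightarrow> 'y" and T2 :: "'b dual \<Rightarrow> 'y"
    where T: "lattice_isomorphism T1" "lattice_isomorphism T2" by blast
  \<comment> \<open>Passing to adjoints reverses arrows: a map from the dual of \<open>'b\<close> to
    the dual of \<open>'a\<close> yields one from \<open>'a\<close> to \<open>'b\<close>.\<close>
  have "lattice_isomorphism (inv T1 \<circ> T2)"
    by (rule lattice_isomorphism_comp[OF lattice_isomorphism_inv[OF T(1)] T(2)])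
  then show "\<exists>T :: 'a \<Rightarrow> 'b. lattice_isomorphism T" by (rule order_continuous_predual_unique[OF oc])
qed

end
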